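(* Let $p>2$, $x_0\in\mathbb{R}^n$, $r>0$ and $t_0\in(r^{ps},T-r^{ps})$. Suppose that $u$ is a weak supersolution of $\partial_t(u^{p-1})+\mathcal{L}u=0$ in $\Omega\times(0,T)$ with $u\ge\rho>0$ in $\mathbb{R}^n\times(t_0-r^{ps},t_0+r^{ps})$. Then there exists a positive constant $C=C(n,p,s,\Lambda)$ such that for every $\lambda>0$, $$\big|\{(x,t)\in U^{+}(x_0,t_0,r):\log u(x,t)<-\lambda-b\}\big|\le\frac{Cr^{n+ps}}{\lambda^{p-1}}$$ and $$\big|\{(x,t)\in U^{-}(x_0,t_0,r):\log u(x,t)>\lambda-b\}\big|\le\frac{Cr^{n+ps}}{\lambda^{p-1}},$$ where $$b=b(u(\cdot,t_0))=-\frac{\int_{B_{\frac{3r}2}(x_0)}\log u(x,t_0)\,\psi(x)^p\,dx}{\int_{B_{\frac{3r}2}(x_0)}\psi(x)^p\,dx}.$$ Here $U^{+}(x_0,t_0,r)=B_r(x_0)\times(t_0,t_0+r^{sp})$, $U^{-}(x_0,t_0,r)=B_r(x_0)\times(t_0-r^{sp},t_0)$, and $\psi\in C_0^\infty(B_{\frac{3r}2}(x_0))$ is a nonnegative radially decreasing function (about $x_0$) such that $0\le\psi\le1$ in $B_{\frac{3r}2}(x_0)$, $\psi\equiv1$ in $B_r(x_0)$ and $|\nabla\psi|\le\frac{C_0}{r}$ in $B_{\frac{3r}2}(x_0)$, with $C_0$ a fixed absolute constant.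
   Context: Setting: $\Omega\subset\mathbb{R}^n$ is a bounded smooth domain, $T>0$, $s\in(0,1)$, $\Lambda\ge1$. The kernel $K(x,y,t)$ is symmetric in $x$ and $y$ and satisfies $\frac{\Lambda^{-1}}{|x-y|^{n+ps}}\le K(x,y,t)\le\frac{\Lambda}{|x-y|^{n+ps}}$ uniformly in $t\in(0,T)$. The operator is $\mathcal{L}u(x,t)=\mathrm{P.V.}\int_{\mathbb{R}^n}|u(x,t)-u(y,t)|^{p-2}(u(x,t)-u(y,t))K(x,y,t)\,dy$. Function spaces: $W^{s,p}(\Omega)$ is the space of $u\in L^p(\Omega)$ with $\int_\Omega\int_\Omega\frac{|u(x)-u(y)|^p}{|x-y|^{n+sp}}\,dx\,dy<\infty$, with norm the $p$-th root of $\|u\|_{L^p(\Omega)}^p$ plus this double integral; $W_0^{s,p}(\Omega)=\{u\in W^{s,p}(\mathbb{R}^n):u=0\text{ on }\mathbb{R}^n\setminus\Omega\}$; the local and parabolic (Bochner) versions are defined in the usual way. Weak supersolution: a function $u\in L^\infty(0,T;L^\infty(\mathbb{R}^n))$ with $u>0$ in $\mathbb{R}^n\times(0,T)$ is a weak supersolution of $\partial_t(u^{p-1})+\mathcal{L}u=0$ in $\Omega\times(0,T)$ if $u\in C_{\mathrm{loc}}(0,T;L^p_{\mathrm{loc}}(\Omega))\cap L^p_{\mathrm{loc}}(0,T;W^{s,p}_{\mathrm{loc}}(\Omega))$ and for every $\Omega'\times[t_1,t_2]\Subset\Omega\times(0,T)$ and every nonnegative $\phi\in W^{1,p}_{\mathrm{loc}}(0,T;L^p(\Omega'))\cap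 L^p_{\mathrm{loc}}(0,T;W^{s,p}_0(\Omega'))$ one has $$\int_{\Omega'}u(x,t_2)^{p-1}\phi(x,t_2)\,dx-\int_{\Omega'}u(x,t_1)^{p-1}\phi(x,t_1)\,dx-\int_{t_1}^{t_2}\int_{\Omega'}u^{p-1}\partial_t\phi\,dx\,dt$$ $$+\int_{t_1}^{t_2}\int_{\mathbb{R}^n}\int_{\mathbb{R}^n}|u(x,t)-u(y,t)|^{p-2}(u(x,t)-u(y,t))(\phi(x,t)-\phi(y,t))K(x,y,t)\,dx\,dy\,dt\ge0.$$ $|E|$ denotes the Lebesgue measure of a set $E\subset\mathbb{R}^{n+1}$; $B_r(x_0)$ is the open ball of radius $r$ and center $x_0$ in $\mathbb{R}^n$; $\rho$ is a constant.
   Formalization: The formal statement additionally assumes that the ball B_{3r/2}(x_0) is contained in Ω; without this the claim fails, e.g. for u equal to a large constant in Ω and a tiny constant outside when ψ has mass outside Ω. *)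

theory Defs
  imports "HOL-Analysis.Analysis"
begin

text \<open>
  A function \<open>u(x,t)\<close> on \<open>\<real>\<^sup>n \<times> (0,T)\<close> is a curried total function; its values for
  \<open>t \<notin> (0,T)\<close> are never used. Measurability is Lebesgue measurability, and pointwise (in)equalities
  between measurable functions are understood almost everywhere.
\<close>

section \<open>Smoothness\<close>

text \<open>For open \<open>S\<close>: \<open>f\<close> is differentiable and all its directional derivatives are \<open>C\<^sup>k\<close>.\<close>

primrec Ck_on :: "nat \<Rightarrow> 'a::euclidean_space set \<Rightarrow> ('a \<Rightarrow> real) \<Rightarrow> bool" where
  "Ck_on 0 S f \<longleftrightarrow> continuous_on S f"
| "Ck_on (Suc k) S f \<longleftrightarrow>
     (\<exists>f'. (\<forall>x\<in>S. (f has_derivative f' x) (at x)) \<and> (\<forall>v. Ck_on k S (\<lambda>x. f' x v)))"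

definition smooth_on :: "'a::euclidean_space set \<Rightarrow> ('a \<Rightarrow> real) \<Rightarrow> bool" where
  "smooth_on S f \<longleftrightarrow> (\<forall>k. Ck_on k S f)"

text \<open>\<open>C\<^sub>0\<^sup>\<infinity>(S)\<close>, each function being extended by zero to the whole space.\<close>

definition test_function :: "'a::euclidean_space set \<Rightarrow> ('a \<Rightarrow> real) \<Rightarrow> bool" where
  "test_function S f \<longleftrightarrow>
     smooth_on UNIV f \<and> compact (closure {x. f x \<noteq> 0}) \<and> closure {x. f x \<noteq> 0} \<subseteq> S"

text \<open>The boundary is smooth in the sense of local smooth defining functions with non-vanishing
  gradient.\<close>

definition bounded_smooth_domain :: "'a::euclidean_space set \<Rightarrow> bool" where
  "bounded_smooth_domain \<Omega> \<longleftrightarrow>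
     open \<Omega> \<and> connected \<Omega> \<and> \<Omega> \<noteq> {} \<and> bounded \<Omega> \<and>
     (\<forall>z\<in>frontier \<Omega>. \<exists>V g. open V \<and> z \<in> V \<and> smooth_on V g \<and>
        (\<forall>x\<in>V. \<not> GDERIV g x :> 0) \<and> \<Omega> \<inter> V = {x\<in>V. g x < 0})"

definition compactly_inside :: "'a::euclidean_space set \<Rightarrow> 'a set \<Rightarrow> bool" where
  "compactly_inside U \<Omega> \<longleftrightarrow> open U \<and> compact (closure U) \<and> closure U \<subseteq> \<Omega>"

section \<open>Function spaces\<close>

text \<open>\<open>Lp_pow\<close> and \<open>Wsp_pow\<close> are the \<open>p\<close>-th powers of the norms of \<open>L\<^sup>p(U)\<close> and
  \<open>W\<^sup>s\<^sup>,\<^sup>p(U)\<close>.\<close>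

definition Lp_pow :: "real \<Rightarrow> 'a::euclidean_space set \<Rightarrow> ('a \<Rightarrow> real) \<Rightarrow> ennreal" where
  "Lp_pow p U f = (\<integral>\<^sup>+x\<in>U. ennreal (\<bar>f x\<bar> powr p) \<partial>lebesgue)"

definition Lp :: "real \<Rightarrow> 'a::euclidean_space set \<Rightarrow> ('a \<Rightarrow> real) set" where
  "Lp p U = {f \<in> borel_measurable (lebesgue_on U). Lp_pow p U f < \<infinity>}"

definition Wsp_pow :: "real \<Rightarrow> real \<Rightarrow> 'a::euclidean_space set \<Rightarrow> ('a \<Rightarrow> real) \<Rightarrow> ennreal" where
  "Wsp_pow s p U f = Lp_pow p U f +
     (\<integral>\<^sup>+x\<in>U. (\<integral>\<^sup>+y\<in>U. ennreal (\<bar>f x - f y\<bar> powr p / norm (x - y) powr (real DIM('a) + s * p))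
        \<partial>lebesgue) \<partial>lebesgue)"

definition Wsp :: "real \<Rightarrow> real \<Rightarrow> 'a::euclidean_space set \<Rightarrow> ('a \<Rightarrow> real) set" where
  "Wsp s p U = {f \<in> Lp p U. Wsp_pow s p U f < \<infinity>}"

definition Wsp0 :: "real \<Rightarrow> real \<Rightarrow> 'a::euclidean_space set \<Rightarrow> ('a \<Rightarrow> real) set" where
  "Wsp0 s p U = {f \<in> Wsp s p UNIV. AE x in lebesgue. x \<notin> U \<longrightarrow> f x = 0}"

text \<open>\<open>L\<^sup>p\<^sub>l\<^sub>o\<^sub>c(0,T;X)\<close> for a space \<open>X\<close> of functions on \<open>D\<close> whose norm has \<open>p\<close>-th power \<open>N\<close>; functions of
  time with values in \<open>X\<close> are represented by jointly measurable functions.\<close>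

definition Lp_loc_time ::
  "real \<Rightarrow> 'a::euclidean_space set \<Rightarrow> ('a \<Rightarrow> real) set \<Rightarrow> (('a \<Rightarrow> real) \<Rightarrow> ennreal) \<Rightarrow>
     ('a \<Rightarrow> real \<Rightarrow> real) set" where
  "Lp_loc_time T D X N = {f.
     (\<lambda>(x, t). f x t) \<in> borel_measurable (lebesgue_on (D \<times> {0<..<T})) \<and>
     (AE t in lebesgue_on {0<..<T}. (\<lambda>x. f x t) \<in> X) \<and>
     (\<forall>t1 t2. 0 < t1 \<longrightarrow> t1 < t2 \<longrightarrow> t2 < T \<longrightarrow>
        (\<integral>\<^sup>+t\<in>{t1..t2}. N (\<lambda>x. f x t) \<partial>lebesgue) < \<infinity>)}"

definition Cont_time_Lp ::
  "real \<Rightarrow> real \<Rightarrow> 'a::euclidean_space set \<Rightarrow> ('a \<Rightarrow> real \<Rightarrow> real) set" where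
  "Cont_time_Lp T p U = {f. \<forall>t\<in>{0<..<T}. (\<lambda>x. f x t) \<in> Lp p U \<and>
     ((\<lambda>\<tau>. Lp_pow p U (\<lambda>x. f x \<tau> - f x t)) \<longlongrightarrow> 0) (at t)}"

text \<open>\<open>\<phi>t\<close> is the weak derivative in time of \<open>\<phi>\<close>, as functions with values in \<open>L\<^sup>p(U)\<close>.\<close>

definition weak_time_derivative ::
  "real \<Rightarrow> 'a::euclidean_space set \<Rightarrow> ('a \<Rightarrow> real \<Rightarrow> real) \<Rightarrow> ('a \<Rightarrow> real \<Rightarrow> real) \<Rightarrow> bool" where
  "weak_time_derivative T U \<phi> \<phi>t \<longleftrightarrow>
     (\<forall>\<eta>. test_function {0<..<T} \<eta> \<longrightarrow>
        (AE x in lebesgue_on U.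
           (LINT t:{0<..<T}|lebesgue. \<phi> x t * deriv \<eta> t) =
         - (LINT t:{0<..<T}|lebesgue. \<phi>t x t * \<eta> t)))"

text \<open>\<open>\<phi> \<in> W\<^sup>1\<^sup>,\<^sup>p\<^sub>l\<^sub>o\<^sub>c(0,T;L\<^sup>p(U))\<close> with time derivative \<open>\<phi>t\<close>. Such a \<open>\<phi>\<close> has a representative that is
  continuous in time with values in \<open>L\<^sup>p(U)\<close>; we require \<open>\<phi>\<close> to be that representative, so that
  its values at a given time are meaningful.\<close>

definition W1p_loc_time ::
  "real \<Rightarrow> real \<Rightarrow> 'a::euclidean_space set \<Rightarrow> ('a \<Rightarrow> real \<Rightarrow> real) \<Rightarrow> ('a \<Rightarrow> real \<Rightarrow> real) \<Rightarrow> bool" where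
  "W1p_loc_time T p U \<phi> \<phi>t \<longleftrightarrow>
     \<phi> \<in> Lp_loc_time T U (Lp p U) (Lp_pow p U) \<and>
     \<phi>t \<in> Lp_loc_time T U (Lp p U) (Lp_pow p U) \<and>
     weak_time_derivative T U \<phi> \<phi>t \<and>
     \<phi> \<in> Cont_time_Lp T p U"

definition Linf_time ::
  "real \<Rightarrow> ('a::euclidean_space \<Rightarrow> real \<Rightarrow> real) set" where
  "Linf_time T = {f.
     (\<lambda>(x, t). f x t) \<in> borel_measurable (lebesgue_on (UNIV \<times> {0<..<T})) \<and>
     (\<exists>M. AE t in lebesgue_on {0<..<T}. AE x in lebesgue. \<bar>f x t\<bar> \<le> M)}"

section \<open>The equation\<close>

text \<open>On the diagonal the bounds are singular and nothing is required of \<open>K\<close>.\<close>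

definition admissible_kernel ::
  "real \<Rightarrow> real \<Rightarrow> real \<Rightarrow> real \<Rightarrow> ('a::euclidean_space \<Rightarrow> 'a \<Rightarrow> real \<Rightarrow> real) \<Rightarrow> bool" where
  "admissible_kernel s p \<Lambda> T K \<longleftrightarrow>
     (\<lambda>(x, y, t). K x y t) \<in> borel_measurable (lebesgue_on (UNIV \<times> UNIV \<times> {0<..<T})) \<and>
     (\<forall>t\<in>{0<..<T}. \<forall>x y. K x y t = K y x t) \<and>
     (\<forall>t\<in>{0<..<T}. \<forall>x y. x \<noteq> y \<longrightarrow>
        inverse \<Lambda> / norm (x - y) powr (real DIM('a) + p * s) \<le> K x y t \<and>
        K x y t \<le> \<Lambda> / norm (x - y) powr (real DIM('a) + p * s))"

text \<open>Weak supersolutions of \<open>\<partial>\<^sub>t(u\<^sup>p\<^sup>-\<^sup>1) + L u = 0\<close> in \<open>\<Omega> \<times> (0,T)\<close>, where \<open>L\<close> is the nonlocal operator with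
  kernel \<open>K\<close>.\<close>

definition weak_supersolution ::
  "real \<Rightarrow> real \<Rightarrow> real \<Rightarrow> 'a::euclidean_space set \<Rightarrow> ('a \<Rightarrow> 'a \<Rightarrow> real \<Rightarrow> real) \<Rightarrow>
     ('a \<Rightarrow> real \<Rightarrow> real) \<Rightarrow> bool" where
  "weak_supersolution s p T \<Omega> K u \<longleftrightarrow>
     u \<in> Linf_time T \<and>
     (AE (x, t) in lebesgue_on (UNIV \<times> {0<..<T}). u x t > 0) \<and>
     (\<forall>U. compactly_inside U \<Omega> \<longrightarrow>
        u \<in> Cont_time_Lp T p U \<and> u \<in> Lp_loc_time T U (Wsp s p U) (Wsp_pow s p U)) \<and>
     (\<forall>U t1 t2 \<phi> \<phi>t.
        compactly_inside U \<Omega> \<longrightarrow> 0 < t1 \<longrightarrow> t1 < t2 \<longrightarrow> t2 < T \<longrightarrow>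
        W1p_loc_time T p U \<phi> \<phi>t \<longrightarrow>
        \<phi> \<in> Lp_loc_time T UNIV (Wsp0 s p U) (Wsp_pow s p UNIV) \<longrightarrow>
        (AE (x, t) in lebesgue_on (UNIV \<times> {0<..<T}). \<phi> x t \<ge> 0) \<longrightarrow>
        (LINT x:U|lebesgue. u x t2 powr (p - 1) * \<phi> x t2)
        - (LINT x:U|lebesgue. u x t1 powr (p - 1) * \<phi> x t1)
        - (LINT t:{t1..t2}|lebesgue. (LINT x:U|lebesgue. u x t powr (p - 1) * \<phi>t x t))
        + (LINT t:{t1..t2}|lebesgue. (LINT y|lebesgue. (LINT x|lebesgue.
             \<bar>u x t - u y t\<bar> powr (p - 2) * (u x t - u y t) * (\<phi> x t - \<phi> y t) * K x y t)))
        \<ge> 0)"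

section \<open>Cylinders, cut-off function and weighted mean\<close>

definition U_plus :: "real \<Rightarrow> real \<Rightarrow> 'a::euclidean_space \<Rightarrow> real \<Rightarrow> real \<Rightarrow> ('a \<times> real) set" where
  "U_plus s p x0 t0 r = ball x0 r \<times> {t0<..<t0 + r powr (s * p)}"

definition U_minus :: "real \<Rightarrow> real \<Rightarrow> 'a::euclidean_space \<Rightarrow> real \<Rightarrow> real \<Rightarrow> ('a \<times> real) set" where
  "U_minus s p x0 t0 r = ball x0 r \<times> {t0 - r powr (s * p)<..<t0}"

definition radially_decreasing :: "'a::euclidean_space \<Rightarrow> ('a \<Rightarrow> real) \<Rightarrow> bool" where
  "radially_decreasing x0 \<psi> \<longleftrightarrow> (\<forall>x y. norm (x - x0) \<le> norm (y - x0) \<longrightarrow> \<psi> y \<le> \<psi> x)"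

definition cutoff :: "real \<Rightarrow> 'a::euclidean_space \<Rightarrow> real \<Rightarrow> ('a \<Rightarrow> real) \<Rightarrow> bool" where
  "cutoff C0 x0 r \<psi> \<longleftrightarrow>
     test_function (ball x0 (3 * r / 2)) \<psi> \<and>
     radially_decreasing x0 \<psi> \<and>
     (\<forall>x\<in>ball x0 (3 * r / 2). 0 \<le> \<psi> x \<and> \<psi> x \<le> 1) \<and>
     (\<forall>x\<in>ball x0 r. \<psi> x = 1) \<and>
     (\<forall>x\<in>ball x0 (3 * r / 2). \<exists>g. GDERIV \<psi> x :> g \<and> norm g \<le> C0 / r)"

definition log_mean ::
  "real \<Rightarrow> 'a::euclidean_space \<Rightarrow> real \<Rightarrow> ('a \<Rightarrow> real) \<Rightarrow> ('a \<Rightarrow> real) \<Rightarrow> real" where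
  "log_mean p x0 r \<psi> v =
     - (LINT x:ball x0 (3 * r / 2)|lebesgue. ln (v x) * \<psi> x powr p)
       / (LINT x:ball x0 (3 * r / 2)|lebesgue. \<psi> x powr p)"

end

theory Submission
  imports Defs
begin

text \<open>
  Formally one tests the equation with \<open>\<psi> powr p * u powr (1 - p)\<close>. The time derivative becomes that of the
  weighted mean \<open>V\<close> of \<open>ln u\<close>, and the nonlocal term is bounded by minus a double integral of
  \<open>\<bar>ln u(x) - ln u(y)\<bar> powr p\<close> plus the energy of the cut-off. All points of the ball have distance at most \<open>3 * r\<close>,
  so the kernel is bounded below there, and Jensen's inequality turns the double integral into a bound for
  \<open>|{x. \<bar>ln u(x,t) - V t\<bar> \<ge> H}| * H powr p\<close>. Hence, up to a linear drift, \<open>V\<close> satisfies \<open>V' \<ge> c * e * H powr p\<close>,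
  where \<open>e\<close> is the measure of the level set and \<open>H\<close> is the distance of the level from \<open>V\<close>;
  integrating \<open>(H powr (1 - p))'\<close> bounds the integral of \<open>e\<close> by a multiple of \<open>\<lambda> powr (1 - p)\<close>.

  Since \<open>u\<close> has no time derivative, only test functions frozen in time are used:
  \<open>\<psi> powr p * u(t') powr (1 - p)\<close> on a short interval \<open>[t, t']\<close>. Concavity of the logarithm gives the increment of \<open>V\<close>
  with the right sign. The error of testing the flux at time \<open>\<tau>\<close> with the slice \<open>t'\<close> is small away from
  the diagonal by continuity of \<open>u\<close> in \<open>L\<^sup>p\<close>, and near the diagonal because the fractional energies of
  the two slices are small there, on average in time.
\<close>

section \<open>Elementary inequalities\<close>

text \<open>The bounds \<open>\<rho>\<close> and \<open>M\<close> of the solution are qualitative.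
  They enter through \<open>lip\<close> and the error constants of \<open>form_le\<close> and
  \<open>one_step\<close>, and those errors disappear in the limit of fine time steps and of a small
  cut around the diagonal. What survives contains only the dimension, \<open>p\<close>,
  \<open>s\<close>, \<open>\<Lambda>\<close> and \<open>C0\<close>, which is why the final constant
  sees neither bound. The drift of V is the price of the cut-off: its energy is of order r^(-ps) per
  unit of mass, so over the time r^(ps) the drift is a fixed number. A level of at least twice that
  height loses at most half of itself to the drift; for lower levels the volume of the cylinder
  already has the claimed order. Once the drift is added, V is nondecreasing. Hence low levels
  recede from it after t0 and high levels recede from it before t0, and a sign
  \<open>\<sigma>\<close> lets both cases be treated at once. The number b is read off at the single
  time t0, whereas measurability, energy and representatives are controlled at almost every time
  only. Continuity in L^p is what brings t0 into the set \<open>G\<close> of good times.\<close>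

lemma powr_above_tangent:
  fixes p x y :: real
  assumes "p \<ge> 1" "x > 0" "y \<ge> 0"
  shows "x powr p + p * x powr (p - 1) * (y - x) \<le> y powr p"
proof (cases "y = 0")
  case True
  have "x powr p = x powr (p - 1) * x" using assms by (simp add: powr_diff)
  then have "x powr p + p * x powr (p - 1) * (y - x) = (1 - p) * (x powr (p-1) * x)"
    using True by (simp add: algebra_simps)
  also have "\<dots> \<le> 0" using assms by (simp add: mult_nonpos_nonneg)
  finally show ?thesis using True by simp
next
  case False
  have "y powr p - x powr p \<ge> (p * x powr (p - 1)) * (y - x)"
  proof (rule convex_on_imp_above_tangent[where A="{0<..}"])
    show "convex_on {0<..} (\<lambda>x::real. x powr p)" using assms by (intro powr_convex)
    show "((\<lambda>x. x powr p) has_real_derivative p * x powr (p - 1)) (at x within {0<..})"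
      using assms by (auto intro!: derivative_eq_intros simp: powr_diff)
  qed (use assms False in \<open>auto simp: interior_open\<close>)
  then show ?thesis by simp
qed

text \<open>The left side is affine in \<open>z\<close>, so this is Jensen's inequality in pointwise
  form: integrated against a weight, the left side only sees the mean of \<open>z\<close>. The
  tangent point will be a lower bound for the distance of a level from the logarithmic mean.\<close>

lemma abs_powr_above_tangent:
  fixes p x z :: real
  assumes "p \<ge> 1" "x > 0"
  shows "x powr p + p * x powr (p - 1) * (z - x) \<le> \<bar>z\<bar> powr p"
proof -
  have "x powr p + p * x powr (p - 1) * (z - x) \<le> x powr p + p * x powr (p - 1) * (\<bar>z\<bar> - x)"
    using assms by (intro add_left_mono mult_left_mono) auto
  also have "\<dots> \<le> \<bar>z\<bar> powr p" using assms by (intro powr_above_tangent) auto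
  finally show ?thesis .
qed

text \<open>The second derivative (1 - p)(-p) z^(-p-1) is nonnegative. Both the Lipschitz bound for
  the test function and the growth of \<open>H powr (1 - p)\<close> rest on this tangent.\<close>

lemma powr_neg_above_tangent:
  fixes p x y :: real
  assumes "p \<ge> 1" "x > 0" "y > 0"
  shows "x powr (1 - p) + (1 - p) * x powr (-p) * (y - x) \<le> y powr (1 - p)"
proof -
  have "y powr (1-p) - x powr (1-p) \<ge> ((1-p) * x powr (-p)) * (y - x)"
  proof (rule f''_imp_f'[where f = "\<lambda>x. x powr (1-p)" and f' = "\<lambda>x. (1-p) * x powr (-p)"
        and f'' = "\<lambda>z. (1-p) * (-p * z powr (-p-1))" and C = "{0<..}"])
    fix z :: real assume z: "z \<in> {0<..}"
    show "((\<lambda>x. x powr (1-p)) has_real_derivative (1-p) * z powr (-p)) (at z)"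
      using has_real_derivative_powr[of z "1-p"] z by simp
    show "((\<lambda>x. (1-p) * x powr (-p)) has_real_derivative (1-p) * (-p * z powr (-p-1))) (at z)"
      using has_real_derivative_powr[of z "-p"] z by (intro DERIV_cmult) simp
    show "0 \<le> (1-p) * (-p * z powr (-p-1))"
      using assms by (intro mult_nonpos_nonpos mult_nonpos_nonneg) auto
  qed (use assms in auto)
  then show ?thesis by simp
qed

text \<open>Convexity applied to x + d = (1 - \<theta>) (x / (1 - \<theta>)) + \<theta> (d /
  \<theta>). For small \<theta> the coefficient of \<open>x powr p\<close> stays close to 1, at the
  price of a large one on \<open>d powr p\<close>.\<close>

lemma powr_add_le_weighted:
  fixes p \<theta> x d :: real
  assumes "p \<ge> 1" "0 < \<theta>" "\<theta> < 1" "0 \<le> x" "0 \<le> d"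
  shows "(x + d) powr p \<le> (1 - \<theta>) powr (1 - p) * x powr p + \<theta> powr (1 - p) * d powr p"
proof -
  have ge1: "1 \<le> z powr (1 - p)" if "0 < z" "z < 1" for z :: real
    using powr_mono'[of "1-p" 0 z] assms that by auto
  consider "x = 0" | "d = 0" | "0 < x" "0 < d" using assms by fastforce
  then show ?thesis
  proof cases
    case 1
    then show ?thesis using ge1[of \<theta>] assms mult_right_mono[OF ge1[of \<theta>], of "d powr p"] by simp
  next
    case 2
    then show ?thesis using ge1[of "1-\<theta>"] assms mult_right_mono[OF ge1[of "1-\<theta>"], of "x powr p"] by simp
  next
    case 3
    have "((1-\<theta>) *\<^sub>R (x / (1-\<theta>)) + \<theta> *\<^sub>R (d / \<theta>)) powr p
        \<le> (1-\<theta>) * (x / (1-\<theta>)) powr p + \<theta> * (d / \<theta>) powr p"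
      using convex_onD[OF powr_convex[OF assms(1)], of \<theta> "x/(1-\<theta>)" "d/\<theta>"] 3 assms by simp
    moreover have "z * (y / z) powr p = z powr (1-p) * y powr p" if "z > 0" for y z :: real
      using that by (simp add: powr_divide powr_diff)
    ultimately show ?thesis using assms by simp
  qed
qed

lemma powr_sum_le:
  fixes p x y :: real
  assumes "p \<ge> 0" "0 \<le> x" "0 \<le> y"
  shows "(x + y) powr p \<le> 2 powr p * (x powr p + y powr p)"
proof -
  have "(x + y) powr p \<le> (2 * max x y) powr p" using assms by (intro powr_mono2) auto
  also have "\<dots> = 2 powr p * max x y powr p" by (simp add: powr_mult)
  also have "\<dots> \<le> 2 powr p * (x powr p + y powr p)"
    by (intro mult_left_mono) (auto simp: max_def)
  finally show ?thesis .
qed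

text \<open>A crude Young inequality: the left side is at most the p-th power of the larger of the
  two numbers.\<close>

lemma powr_mult_le_sum:
  fixes p x y :: real
  assumes "p \<ge> 1" "0 \<le> x" "0 \<le> y"
  shows "x powr (p - 1) * y \<le> x powr p + y powr p"
proof -
  have *: "z powr (p-1) * z = z powr p" if "z \<ge> 0" for z :: real
    using that by (cases "z = 0") (auto simp: powr_diff)
  show ?thesis
  proof (cases "x \<le> y")
    case True
    then have "x powr (p-1) * y \<le> y powr (p-1) * y" using assms by (intro mult_right_mono powr_mono2) auto
    then show ?thesis using * assms by (smt (verit) powr_ge_zero)
  next
    case False
    then have "x powr (p-1) * y \<le> x powr (p-1) * x" using assms by (intro mult_left_mono) auto
    then show ?thesis using * assms by (smt (verit) powr_ge_zero)
  qed
qed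

text \<open>The splitting parameter \<open>\<theta>\<close> is a multiple of \<open>1 - b / a\<close>, so that its negative power is absorbed
  by the factor \<open>(a - b) powr (p - 1)\<close>.\<close>

lemma log_inequality_ordered:
  fixes p a b \<alpha> \<beta> :: real
  assumes p: "p \<ge> 2" and ab: "a \<ge> b" "b > 0" and nn: "\<alpha> \<ge> 0" "\<beta> \<ge> 0"
  shows "(a - b) powr (p - 1) * (\<alpha> powr p * a powr (1 - p) - \<beta> powr p * b powr (1 - p))
    \<le> - (1/2) * \<beta> powr p * (ln a - ln b) powr p + (4 * (p - 1)) powr (p - 1) * \<bar>\<alpha> - \<beta>\<bar> powr p"
proof (cases "a = b")
  case True
  then show ?thesis by simp
next
  case False
  \<comment> \<open>By homogeneity the left side of the claim depends on \<open>a\<close> and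
    \<open>b\<close> only through this ratio; see \<open>fac\<close>.\<close>
  define q where "q = b / a"
  define L where "L = ln a - ln b"
  have a0: "a > 0" and q01: "0 < q" "q < 1" and L0: "L > 0"
    using ab False by (auto simp: q_def L_def)
  have qL: "q = exp (- L)" using a0 ab by (simp add: q_def L_def exp_diff)
  define \<theta> where "\<theta> = (1 - q) / (4 * (p - 1))"
  have \<theta>: "0 < \<theta>" "\<theta> < 1" "(p - 1) * \<theta> = (1-q)/4"
    using q01 p by (auto simp: \<theta>_def field_simps)
  have e1: "q powr (1-p) = exp ((p-1)*L)" using q01 by (simp add: powr_def qL algebra_simps)
  have "q powr (1-p) - 1 \<ge> (p-1) * L" unfolding e1 using exp_ge_add_one_self[of "(p-1)*L"] by linarith
  moreover have "(p-1)*L \<ge> L" using p L0 by simp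
  moreover have "L \<ge> 1 - q" using exp_ge_add_one_self[of "-L"] qL by simp
  \<comment> \<open>The excess of \<open>q powr (1 - p)\<close> over 1 dominates 1 - q, so half of
    it pays for the loss (1 - q)/2 caused by replacing \<alpha> by \<beta>.\<close>
  ultimately have q1: "q powr (1-p) - 1 \<ge> 1 - q" by linarith
  \<comment> \<open>Bernoulli's inequality, as the tangent at 1 of the power p - 1 >= 1, followed by
    inversion. The choice (p - 1) \<theta> = (1 - q)/4 leaves room for the clean bound.\<close>
  have bern: "(1-\<theta>) powr (1-p) \<le> 1 + (1-q)/2"
  proof -
    have t: "1 - (1-q)/4 \<le> (1-\<theta>) powr (p-1)"
      using powr_above_tangent[of "p-1" 1 "1-\<theta>"] p \<theta> by simp
    have "(1-\<theta>) powr (1-p) = inverse ((1-\<theta>) powr (p-1))"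
      by (simp add: powr_minus[symmetric])
    also have "\<dots> \<le> inverse (1 - (1-q)/4)" using t q01 by (intro le_imp_inverse_le) auto
    also have "\<dots> \<le> 1 + (1-q)/2"
    proof -
      have "(1 + (1-q)/2) * (1 - (1-q)/4) - 1 = (1 - q) * (1 + q) / 8" by (simp add: field_simps)
      moreover have "(1 - q) * (1 + q) \<ge> 0" using q01 by simp
      ultimately have "1 \<le> (1 + (1-q)/2) * (1 - (1-q)/4)" by linarith
      then show ?thesis using q01 by (simp add: field_simps)
    qed
    finally show ?thesis .
  qed
  have \<alpha>: "\<alpha> powr p \<le> (1 + (1-q)/2) * \<beta> powr p + \<theta> powr (1-p) * \<bar>\<alpha> - \<beta>\<bar> powr p"
  proof (cases "\<alpha> \<le> \<beta>")
    case True
    then have "\<alpha> powr p \<le> 1 * \<beta> powr p" using nn p by (simp add: powr_mono2)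
    also have "\<dots> \<le> (1 + (1-q)/2) * \<beta> powr p" using q01 by (intro mult_right_mono) auto
    finally show ?thesis by (smt (verit) powr_ge_zero mult_nonneg_nonneg)
  next
    case False
    have "\<alpha> powr p \<le> (1-\<theta>) powr (1-p) * \<beta> powr p + \<theta> powr (1-p) * (\<alpha> - \<beta>) powr p"
      using powr_add_le_weighted[of p \<theta> \<beta> "\<alpha>-\<beta>"] p \<theta> nn False by simp
    also have "\<dots> \<le> (1 + (1-q)/2) * \<beta> powr p + \<theta> powr (1-p) * (\<alpha> - \<beta>) powr p"
      using bern by (intro add_right_mono mult_right_mono) auto
    finally show ?thesis using False by simp
  qed
  have fac: "(a - b) powr (p-1) * (\<alpha> powr p * a powr (1-p) - \<beta> powr p * b powr (1-p))
     = (1-q) powr (p-1) * (\<alpha> powr p - \<beta> powr p * q powr (1-p))"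
  proof -
    have "a - b = a * (1-q)" using a0 by (simp add: q_def field_simps)
    then have 1: "(a - b) powr (p-1) = a powr (p-1) * (1-q) powr (p-1)" by (simp add: powr_mult)
    have "b = a * q" using a0 by (simp add: q_def)
    then have 2: "b powr (1-p) = a powr (1-p) * q powr (1-p)" by (simp add: powr_mult)
    have 3: "a powr (p-1) * a powr (1-p) = 1" using a0 by (simp add: powr_add[symmetric])
    have "(a - b) powr (p-1) * (\<alpha> powr p * a powr (1-p) - \<beta> powr p * b powr (1-p))
      = (a powr (p-1) * a powr (1-p)) * ((1-q) powr (p-1) * (\<alpha> powr p - \<beta> powr p * q powr (1-p)))"
      unfolding 1 2 by (simp only: algebra_simps)
    then show ?thesis using 3 by simp
  qed
  \<comment> \<open>With q = exp (-L) the product is (e^L - 1)^(p-1) (1 - e^(-(p-1)L)), which is at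
    least (e^L - 1)^p e^(-L). Since e^L - 1 >= L e^(L/2), this is at least L^p e^((p/2 - 1) L), and
    p >= 2 makes the last exponent nonnegative.\<close>
  have main: "(1-q) powr (p-1) * (q powr (1-p) - 1) \<ge> L powr p"
  proof -
    have sh: "exp L - 1 \<ge> L * exp (L/2)"
    proof -
      have "exp (L/2) - exp (-(L/2)) \<ge> L" 
      proof -
        \<comment> \<open>The inequality 2 sinh y >= 2 y from the quadratic Taylor bound
          \<open>A\<close> of the exponential: A - 1/A >= 2 y because A^2 - 1 - 2 y A =
          y^4/4.\<close>
        define y A where "y = L/2" and "A = 1 + y + y\<^sup>2/2"
        have y: "y > 0" and A: "A \<ge> 1" using L0 by (auto simp: y_def A_def)
        have eA: "exp y \<ge> A" using exp_lower_Taylor_quadratic[of y] y by (simp add: A_def)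
        have "A * A - 1 - 2 * y * A = y^4/4" by (simp add: A_def field_simps power2_eq_square power4_eq_xxxx)
        then have "2 * y * A \<le> A * A - 1" using zero_le_power[of y 4] y by linarith
        then have "2 * y \<le> A - inverse A" using A by (simp add: field_simps)
        also have "\<dots> \<le> exp y - inverse (exp y)" using eA A by (intro diff_mono le_imp_inverse_le) auto
        finally show ?thesis by (simp add: y_def exp_minus)
      qed
      then have "exp (L/2) * L \<le> exp (L/2) * (exp (L/2) - exp (-(L/2)))" by (intro mult_left_mono) auto
      also have "\<dots> = exp L - 1" by (simp add: algebra_simps exp_add[symmetric])
      finally show ?thesis by (simp add: mult.commute)
    qed
    have r: "1 - q = exp (-L) * (exp L - 1)" using qL by (simp add: algebra_simps exp_minus_inverse)
    have r1: "(1-q) powr (p-1) = exp (-((p-1)*L)) * (exp L - 1) powr (p-1)"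
      unfolding r powr_mult by (simp add: powr_def[of "exp (-L)"])
    moreover have "(1-q) powr (p-1) * q powr (1-p) = (exp L - 1) powr (p-1)"
      unfolding r1 e1 by (simp add: exp_minus)
    ultimately have "(1-q) powr (p-1) * (q powr (1-p) - 1) = (exp L - 1) powr (p-1) * (1 - exp (-((p-1)*L)))"
      by (simp add: algebra_simps)
    also have "\<dots> \<ge> (exp L - 1) powr (p-1) * (1 - exp (-L))"
      using p L0 by (intro mult_left_mono) auto
    also have "(exp L - 1) powr (p-1) * (1 - exp (-L)) = (exp L - 1) powr p * exp (-L)"
    proof -
      have "1 - exp (-L) = (exp L - 1) * exp (-L)" by (simp add: algebra_simps exp_minus_inverse)
      moreover have "(exp L - 1) powr (p-1) * (exp L - 1) = (exp L - 1) powr p"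
        using L0 by (simp add: powr_diff)
      ultimately show ?thesis by (simp add: mult.assoc[symmetric])
    qed
    also have "(exp L - 1) powr p * exp (-L) \<ge> (L * exp (L/2)) powr p * exp (-L)"
      using sh p L0 by (intro mult_right_mono powr_mono2) auto
    also have "(L * exp (L/2)) powr p * exp (-L) = L powr p * exp (p * (L/2) - L)"
      by (simp add: powr_mult powr_def[of "exp (L/2)"] mult.assoc exp_add[symmetric])
    also have "\<dots> \<ge> L powr p * 1"
      using p L0 by (intro mult_left_mono) auto
    finally show ?thesis by simp
  qed
  have "(1-q) powr (p-1) * (\<alpha> powr p - \<beta> powr p * q powr (1-p))
    \<le> (1-q) powr (p-1) * ((1 + (1-q)/2) * \<beta> powr p + \<theta> powr (1-p) * \<bar>\<alpha> - \<beta>\<bar> powr p - \<beta> powr p * q powr (1-p))"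
    using \<alpha> by (intro mult_left_mono) auto
  also have "\<dots> = - (\<beta> powr p) * ((1-q) powr (p-1) * (q powr (1-p) - 1 - (1-q)/2)) +
     ((1-q) powr (p-1) * \<theta> powr (1-p)) * \<bar>\<alpha> - \<beta>\<bar> powr p"
    by (simp add: field_simps)
  \<comment> \<open>The degenerate factor 1 - q cancels here, so the coefficient of
    \<open>\<bar>\<alpha> - \<beta>\<bar> powr p\<close> depends on \<open>p\<close> alone.\<close>
  also have "(1-q) powr (p-1) * \<theta> powr (1-p) = (4 * (p-1)) powr (p-1)"
  proof -
    have "\<theta> powr (1-p) = (1-q) powr (1-p) * (4*(p-1)) powr (p-1)"
      unfolding \<theta>_def powr_divide using powr_minus_divide[of "4*(p-1)" "1-p"] by (simp add: divide_inverse)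
    then show ?thesis using q01 by (simp add: mult.assoc[symmetric] powr_add[symmetric])
  qed
  also have "- (\<beta> powr p) * ((1-q) powr (p-1) * (q powr (1-p) - 1 - (1-q)/2)) \<le> - (\<beta> powr p) * (L powr p / 2)"
  proof -
    have "(1-q) powr (p-1) * (q powr (1-p) - 1 - (1-q)/2) \<ge> (1-q) powr (p-1) * ((q powr (1-p) - 1)/2)"
    proof (rule mult_left_mono)
      show "(q powr (1-p) - 1)/2 \<le> q powr (1-p) - 1 - (1-q)/2" using q1 by (simp add: field_simps)
    qed simp
    then have "(1-q) powr (p-1) * (q powr (1-p) - 1 - (1-q)/2) \<ge> L powr p / 2" using main by simp
    then have "\<beta> powr p * (L powr p / 2) \<le> \<beta> powr p * ((1-q) powr (p-1) * (q powr (1-p) - 1 - (1-q)/2))"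
      by (rule mult_left_mono) simp
    then show ?thesis by linarith
  qed
  finally show ?thesis unfolding fac L_def[symmetric] by simp
qed

text \<open>The ordered version keeps only the weight attached to the smaller value. As the weights
  are at most 1, that weight may be lowered to the symmetric product, after which exchanging the two
  points covers the other order.\<close>

lemma log_inequality:
  fixes p a b \<alpha> \<beta> :: real
  assumes p: "p \<ge> 2" and ab: "a > 0" "b > 0" and nn: "0 \<le> \<alpha>" "\<alpha> \<le> 1" "0 \<le> \<beta>" "\<beta> \<le> 1"
  shows "\<bar>a - b\<bar> powr (p - 2) * (a - b) * (\<alpha> powr p * a powr (1 - p) - \<beta> powr p * b powr (1 - p))
    \<le> - (1/2) * (\<bar>ln a - ln b\<bar> powr p * (\<alpha> powr p * \<beta> powr p)) + (4 * (p - 1)) powr (p - 1) * \<bar>\<alpha> - \<beta>\<bar> powr p"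
proof -
  have *: "\<bar>a - b\<bar> powr (p - 2) * (a - b) * (\<alpha> powr p * a powr (1 - p) - \<beta> powr p * b powr (1 - p))
    \<le> - (1/2) * (\<bar>ln a - ln b\<bar> powr p * (\<alpha> powr p * \<beta> powr p)) + (4 * (p - 1)) powr (p - 1) * \<bar>\<alpha> - \<beta>\<bar> powr p"
    if "a \<ge> b" "b > 0" and nn: "0 \<le> \<alpha>" "\<alpha> \<le> 1" "0 \<le> \<beta>" "\<beta> \<le> 1" for a b \<alpha> \<beta> :: real
  proof -
    have 1: "\<bar>a - b\<bar> powr (p - 2) * (a - b) = (a - b) powr (p - 1)"
      using that by (cases "a = b") (auto simp: powr_diff power2_eq_square)
    have "\<alpha> powr p * \<beta> powr p \<le> 1 * \<beta> powr p"
      using nn p by (intro mult_right_mono powr_le1) auto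
    then have "(ln a - ln b) powr p * (\<alpha> powr p * \<beta> powr p) \<le> (ln a - ln b) powr p * \<beta> powr p"
      by (intro mult_left_mono) auto
    moreover have "\<bar>ln a - ln b\<bar> = ln a - ln b" using that by simp
    ultimately show ?thesis using log_inequality_ordered[OF p that(1,2) nn(1,3)] unfolding 1
      by (simp add: mult.commute)
  qed
  show ?thesis
  proof (cases "a \<ge> b")
    case True
    then show ?thesis using * ab nn by blast
  next
    case False
    have "\<bar>a - b\<bar> powr (p - 2) * (a - b) * (\<alpha> powr p * a powr (1 - p) - \<beta> powr p * b powr (1 - p))
      = \<bar>b - a\<bar> powr (p - 2) * (b - a) * (\<beta> powr p * b powr (1 - p) - \<alpha> powr p * a powr (1 - p))"
      by (simp add: abs_minus_commute algebra_simps)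
    also have "\<dots> \<le> - (1/2) * (\<bar>ln b - ln a\<bar> powr p * (\<beta> powr p * \<alpha> powr p)) + (4 * (p - 1)) powr (p - 1) * \<bar>\<beta> - \<alpha>\<bar> powr p"
      using *[of a b \<beta> \<alpha>] False ab nn by auto
    finally show ?thesis by (simp add: abs_minus_commute mult.commute)
  qed
qed

section \<open>Increments and integrals of functions of time\<close>

text \<open>If every good point exceeded the mean by \<open>e\<close>, the integrand would do so up
  to a null set; the slack \<open>e\<close> makes the contradiction strict. The right endpoint is
  excluded so that points taken from consecutive cells are distinct. With \<open>n = 0\<close> the
  lemma just supplies a point of \<open>G\<close>.\<close>

lemma ex_le_average:
  fixes n :: "real \<Rightarrow> real"
  assumes "n integrable_on {a..b}" "a < b" "negligible ({a..b} - G)" "e > 0"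
  obtains t where "t \<in> G" "a \<le> t" "t < b" "(b - a) * n t \<le> integral {a..b} n + e * (b - a)"
proof (rule ccontr)
  assume *: "\<not> thesis"
  note found = that
  define c where "c = integral {a..b} n / (b - a) + e"
  define m where "m t = (if t \<in> G \<and> t < b then n t else c)" for t
  have "negligible ({a..b} - G \<union> {b})" using assms(3) by (intro negligible_Un) auto
  then have neg: "negligible ({a..b} - {t \<in> {a..b}. t \<in> G \<and> t < b})"
    by (rule negligible_subset) auto
  have m: "m integrable_on {a..b}" "integral {a..b} m = integral {a..b} n"
    by (auto intro!: integrable_spike[OF assms(1) neg] integral_spike[OF neg] simp: m_def)
  have "c \<le> m t" if "t \<in> {a..b}" for t
  proof (cases "t \<in> G \<and> t < b")
    case True
    then have "\<not> (b - a) * n t \<le> integral {a..b} n + e * (b - a)" using * that found by auto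
    then show ?thesis using True assms(2) by (simp add: m_def c_def field_simps)
  qed (auto simp: m_def)
  then have "integral {a..b} (\<lambda>_. c) \<le> integral {a..b} m"
    using m by (intro integral_le) auto
  then have "(b - a) * c \<le> integral {a..b} n" using m assms(2) by simp
  moreover have "(b - a) * c = integral {a..b} n + e * (b - a)" using assms(2) by (simp add: c_def distrib_left)
  ultimately show False using assms(2,4) mult_pos_pos[of e "b - a"] by linarith
qed

text \<open>The term \<open>n t'\<close> need not be small for a particular \<open>t'\<close>; the partition points are chosen in
  consecutive cells such that \<open>n\<close> does not exceed its mean over the cell there.\<close>

lemma increment_ge_integral:
  fixes V g :: "real \<Rightarrow> real"
  assumes t12: "t1 < t2" and G: "t1 \<in> G" "negligible ({t1..t2} - G)"
    and g: "g integrable_on {t1..t2}" and B: "\<And>t. t \<in> {t1..t2} \<Longrightarrow> g t \<le> B"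
    and V: "\<And>e. e > 0 \<Longrightarrow> \<exists>\<eta>>0. \<forall>t\<in>G. t1 \<le> t \<and> t \<le> t2 \<and> t2 - t < \<eta> \<longrightarrow> V t \<le> V t2 + e"
    and step: "\<And>e. e > 0 \<Longrightarrow> \<exists>n \<eta>. \<eta> > 0 \<and> (\<forall>t. n t \<ge> 0) \<and> n integrable_on {t1..t2} \<and> integral {t1..t2} n \<le> e \<and>
       (\<forall>t\<in>G. \<forall>t'\<in>G. t1 \<le> t \<and> t < t' \<and> t' \<le> t2 \<and> t' - t < \<eta> \<longrightarrow>
          V t' - V t \<ge> integral {t..t'} g - integral {t..t'} n - (t' - t) * (n t' + e))"
  shows "integral {t1..t2} g \<le> V t2 - V t1"
proof -
  \<comment> \<open>The 5 stands for up to three integrals of \<open>n\<close>, the integral of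
    \<open>g\<close> over the last cell, and the passage of \<open>V\<close> from the last chosen
    point to \<open>t2\<close>. The multiple of t2 - t1 collects the errors proportional to elapsed
    time.\<close>
  have key: "integral {t1..t2} g - e * (5 + 3 * (t2 - t1)) \<le> V t2 - V t1" if e: "e > 0" for e
  proof -
    obtain \<eta>1 where \<eta>1: "\<eta>1 > 0" "\<And>t. t \<in> G \<Longrightarrow> t1 \<le> t \<Longrightarrow> t \<le> t2 \<Longrightarrow> t2 - t < \<eta>1 \<Longrightarrow> V t \<le> V t2 + e"
      using V[OF e] by blast
    obtain n \<eta> where \<eta>: "\<eta> > 0" and n0: "\<And>t. n t \<ge> (0::real)" and ni: "n integrable_on {t1..t2}"
      and ne: "integral {t1..t2} n \<le> e"
      and st: "\<And>t t'. t \<in> G \<Longrightarrow> t' \<in> G \<Longrightarrow> t1 \<le> t \<Longrightarrow> t < t' \<Longrightarrow> t' \<le> t2 \<Longrightarrow> t' - t < \<eta> \<Longrightarrow>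
          V t' - V t \<ge> integral {t..t'} g - integral {t..t'} n - (t' - t) * (n t' + e)"
      using step[OF e] by blast
    \<comment> \<open>Consecutive chosen points lie in adjacent cells, hence less than two cells
      apart: this is the reason for \<eta>/2. The other two bounds control the last cell, where
      \<open>V\<close> and the integral of \<open>g\<close> are estimated directly.\<close>
    define \<delta> where "\<delta> = min (min (\<eta>/2) \<eta>1) (e / (\<bar>B\<bar> + 1))"
    have \<delta>: "\<delta> > 0" using \<eta> \<eta>1 e by (auto simp: \<delta>_def)
    obtain N :: nat where N: "(t2 - t1) / \<delta> < real N" using reals_Archimedean2 by blast
    have N0: "N > 0" using N t12 \<delta> by (cases N) (auto simp: field_simps)
    define h where "h = (t2 - t1) / N"
    have h: "h > 0" "h * N = t2 - t1" using t12 N0 by (auto simp: h_def)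
    have "h < \<delta>" using N \<delta> N0 t12 by (simp add: h_def field_simps)
    then have h\<delta>: "2 * h < \<eta>" "h < \<eta>1" "h < e / (\<bar>B\<bar> + 1)" by (auto simp: \<delta>_def)
    have Bh: "B * h \<le> e"
    proof -
      have "B * h \<le> (\<bar>B\<bar> + 1) * h" using h by (intro mult_right_mono) auto
      also have "\<dots> \<le> e" using h\<delta>(3) by (simp add: field_simps)
      finally show ?thesis .
    qed
    have sub_int: "f integrable_on {a..b}" if "f integrable_on {t1..t2}" "t1 \<le> a" "b \<le> t2" for f :: "real \<Rightarrow> real" and a b
      using that integrable_on_subinterval[of f "{t1..t2}" a b] by auto
    have comb: "integral {t1..b} f = integral {t1..a} f + integral {a..b} f"
      if "f integrable_on {t1..t2}" "t1 \<le> a" "a \<le> b" "b \<le> t2" for f :: "real \<Rightarrow> real" and a b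
      using Henstock_Kurzweil_Integration.integral_combine[of t1 a b f] sub_int[of f t1 b] that by auto
    \<comment> \<open>One point per cell. As n(t') is at most its mean over its own cell plus
      \<open>e\<close>, and t' - t < 2 h, the terms (t' - t) n(t') add up to at most twice the
      integral of \<open>n\<close> over the cells visited plus 2 e h per cell.\<close>
    have "i < N \<Longrightarrow> \<exists>t\<in>G. t1 + i * h \<le> t \<and> t < t1 + (real i + 1) * h \<and>
       V t - V t1 \<ge> integral {t1..t} g - integral {t1..t} n - e * (t - t1) - 2 * integral {t1..t1 + (real i + 1) * h} n
          - 2 * e * (i * h)" for i
    proof (induction i)
      \<comment> \<open>\<open>t1\<close> represents the first cell: it lies in \<open>G\<close> and
        never occurs as a right endpoint, so no bound on \<open>n t1\<close> is required.\<close>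
      case 0
      have "integral {t1..t1 + h} n \<ge> 0"
      proof (intro integral_nonneg sub_int[OF ni])
        show "t1 + h \<le> t2" using h N0 mult_left_mono[of 1 "real N" h] by simp
      qed (use n0 in auto)
      then show ?case using G h by (intro bexI[of _ t1]) auto
    next
      case (Suc i)
      obtain t where t: "t \<in> G" "t1 + i * h \<le> t" "t < t1 + (real i + 1) * h"
         and IH: "V t - V t1 \<ge> integral {t1..t} g - integral {t1..t} n - e * (t - t1)
            - 2 * integral {t1..t1 + (real i + 1) * h} n - 2 * e * (i * h)"
        using Suc.IH[OF Suc_lessD[OF Suc.prems]] by (elim bexE conjE) (rule that; assumption)
      define a where "a = t1 + (real i + 1) * h"
      have bN: "a + h \<le> t2"
      proof -
        have "real (i + 2) * h \<le> real N * h"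
        proof (rule mult_right_mono)
          show "real (i + 2) \<le> real N" using Suc.prems by linarith
        qed (use h in simp)
        then show ?thesis using h(2) by (simp add: a_def algebra_simps)
      qed
      have a1: "t1 \<le> a" using h by (simp add: a_def)
      have "0 \<le> real i * h" using h by simp
      then have tge: "t1 \<le> t" using t(2) by linarith
      have "negligible ({a..a + h} - G)"
        using G(2) by (rule negligible_subset) (use a1 bN in auto)
      then obtain t' where t': "t' \<in> G" "a \<le> t'" "t' < a + h" "h * n t' \<le> integral {a..a+h} n + e * h"
        using ex_le_average[of n a "a+h" G e] sub_int[OF ni a1 bN] h e by auto
      have tt: "t < t'" "t' - t < 2 * h" "t' \<le> t2" using t t' bN by (auto simp: a_def algebra_simps)
      have "V t' - V t \<ge> integral {t..t'} g - integral {t..t'} n - (t' - t) * (n t' + e)"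
        using st[of t t'] t t' tt h\<delta> tge by auto
      moreover have "(t' - t) * (n t' + e) \<le> 2 * integral {a..a+h} n + 2 * (e * h) + (e * (t' - t1) - e * (t - t1))"
      proof -
        have "(t' - t) * n t' \<le> 2 * h * n t'" using tt n0 by (intro mult_right_mono) auto
        also have "\<dots> \<le> 2 * integral {a..a+h} n + 2 * (e * h)" using t'(4) by simp
        finally show ?thesis by (simp add: algebra_simps)
      qed
      moreover have "integral {t1..t'} g = integral {t1..t} g + integral {t..t'} g"
        "integral {t1..t'} n = integral {t1..t} n + integral {t..t'} n"
        by (rule comb[OF g tge less_imp_le[OF tt(1)] tt(3)] comb[OF ni tge less_imp_le[OF tt(1)] tt(3)])+
      moreover have "integral {t1..a + h} n = integral {t1..a} n + integral {a..a+h} n"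
        using h by (intro comb[OF ni a1 _ bN]) simp
      moreover have ah: "t1 + (real (Suc i) + 1) * h = a + h"
        and eh: "2 * e * (real (Suc i) * h) = 2 * e * (i * h) + 2 * (e * h)"
         by (auto simp: a_def algebra_simps)
      ultimately have "V t' - V t1 \<ge> integral {t1..t'} g - integral {t1..t'} n - e * (t' - t1)
            - 2 * integral {t1..t1 + (real (Suc i) + 1) * h} n - 2 * e * (real (Suc i) * h)"
        using IH unfolding a_def[symmetric] ah eh by linarith
      moreover have "t1 + real (Suc i) * h \<le> t'" "t' < t1 + (real (Suc i) + 1) * h"
        using t' by (auto simp: a_def algebra_simps)
      ultimately show ?case using t'(1) by auto
    qed
    \<comment> \<open>The induction ends in the last cell. Nothing controls \<open>n\<close> at
      \<open>t2\<close> itself, so the remaining gap is closed by the one-sided continuity of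
      \<open>V\<close>.\<close>
    from this[of "N - 1"] N0 obtain t where t: "t \<in> G" "t1 + real (N - 1) * h \<le> t" "t < t1 + N * h"
      and IH: "V t - V t1 \<ge> integral {t1..t} g - integral {t1..t} n - e * (t - t1) - 2 * integral {t1..t1 + N * h} n
          - 2 * e * (real (N - 1) * h)" by auto
    have Nh: "t1 + N * h = t2" "real (N - 1) * h = t2 - t1 - h" using h N0 by (auto simp: algebra_simps of_nat_diff)
    have tr: "t1 \<le> t" "t \<le> t2" "t2 - t \<le> h" 
    proof -
      have "0 \<le> real (N - 1) * h" using h by simp
      then show "t1 \<le> t" using t(2) by linarith
      show "t \<le> t2" "t2 - t \<le> h" using t Nh by linarith+
    qed
    have "V t \<le> V t2 + e" using \<eta>1(2)[OF t(1)] tr h\<delta> by auto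
    moreover have "integral {t1..t2} g = integral {t1..t} g + integral {t..t2} g"
       "integral {t1..t2} n = integral {t1..t} n + integral {t..t2} n"
      by (rule comb[OF g tr(1,2) order_refl] comb[OF ni tr(1,2) order_refl])+
    moreover have "integral {t..t2} n \<ge> 0" using n0 tr by (intro integral_nonneg sub_int[OF ni]) auto
    moreover have "integral {t..t2} g \<le> e"
    proof -
      have "integral {t..t2} g \<le> integral {t..t2} (\<lambda>_. \<bar>B\<bar>)"
      proof (rule integral_le)
        show "g integrable_on {t..t2}" using sub_int[OF g] tr by simp
        show "g x \<le> \<bar>B\<bar>" if "x \<in> {t..t2}" for x using B[of x] tr that by simp
      qed (rule integrable_const_ivl)
      also have "\<dots> = \<bar>B\<bar> * (t2 - t)" using tr by simp
      also have "\<dots> \<le> \<bar>B\<bar> * h" using tr(3) by (rule mult_left_mono) simp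
      also have "\<dots> \<le> (\<bar>B\<bar> + 1) * h" using h by (intro mult_right_mono) auto
      also have "\<dots> \<le> e" using h\<delta>(3) by (simp add: field_simps)
      finally show ?thesis .
    qed
    moreover have "e * (t - t1) \<le> e * (t2 - t1)" "2 * e * (real (N-1) * h) \<le> 2 * e * (t2 - t1)"
      using e tr h unfolding Nh by (intro mult_left_mono; simp)+
    ultimately show ?thesis using IH ne unfolding Nh(1) by (simp add: algebra_simps)
  qed
  show ?thesis
  proof (rule field_le_epsilon)
    fix e :: real assume "e > 0"
    moreover have "5 + 3 * (t2 - t1) > 0" using t12 by simp
    ultimately show "integral {t1..t2} g \<le> V t2 - V t1 + e"
      using key[of "e / (5 + 3 * (t2 - t1))"] by simp
  qed
qed

section \<open>Integrals of the singular kernel\<close>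

lemma ex_dyadic_real:
  fixes x :: real
  assumes "1 \<le> x"
  obtains k :: nat where "2 ^ k \<le> x" "x < 2 ^ Suc k"
proof
  define k where "k = nat \<lfloor>log 2 x\<rfloor>"
  have k: "real k = of_int \<lfloor>log 2 x\<rfloor>" using assms by (simp add: k_def)
  have "2 powr real k \<le> x" "x < 2 powr (real k + 1)"
    using assms unfolding k by (auto simp: le_log_iff[symmetric] log_less_iff[symmetric])
  then show "2 ^ k \<le> x" "x < 2 ^ Suc k" by (auto simp: powr_realpow powr_add)
qed

text \<open>The sets may overlap: the value at a point is bounded by one term of a series of
  nonnegative terms. The covers in question are dyadic annuli.\<close>

lemma nn_integral_le_suminf_cover:
  fixes b m :: "nat \<Rightarrow> ennreal"
  assumes [measurable]: "\<And>k. A k \<in> sets M"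
    and cover: "\<And>x. x \<in> space M \<Longrightarrow> g x \<noteq> 0 \<Longrightarrow> \<exists>k. x \<in> A k \<and> g x \<le> b k"
    and m: "\<And>k. emeasure M (A k) \<le> m k"
  shows "(\<integral>\<^sup>+x. g x \<partial>M) \<le> (\<Sum>k. b k * m k)"
proof -
  have "g x \<le> (\<Sum>k. b k * indicator (A k) x)" if xs: "x \<in> space M" for x
  proof (cases "g x = 0")
    case False
    then obtain k where k: "x \<in> A k" "g x \<le> b k" using cover[OF xs] by blast
    have "g x \<le> (\<Sum>k\<in>{k}. b k * indicator (A k) x)" using k by simp
    also have "\<dots> \<le> (\<Sum>k. b k * indicator (A k) x)"
      by (intro sum_le_suminf summableI) auto
    finally show ?thesis .
  qed simp
  then have "(\<integral>\<^sup>+x. g x \<partial>M) \<le> (\<integral>\<^sup>+x. (\<Sum>k. b k * indicator (A k) x) \<partial>M)"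
    by (rule nn_integral_mono)
  also have "\<dots> = (\<Sum>k. \<integral>\<^sup>+x. b k * indicator (A k) x \<partial>M)" by (rule nn_integral_suminf) auto
  also have "\<dots> = (\<Sum>k. b k * emeasure M (A k))" by (simp add: nn_integral_cmult_indicator)
  also have "\<dots> \<le> (\<Sum>k. b k * m k)" by (intro suminf_le summableI mult_left_mono m) auto
  finally show ?thesis .
qed

text \<open>On the annulus from 2^k d to 2^(k+1) d the kernel is at most (2^k d)^(-n-a) and the
  volume at most a multiple of (2^(k+1) d)^n, with n the dimension. The products form a geometric
  series of ratio 2^(-a).\<close>

lemma nn_integral_kernel_tail:
  assumes a: "a > 0"
  shows "\<exists>A>0. \<forall>d>0. (\<integral>\<^sup>+z. ennreal (1 / norm z powr (real DIM('a) + a)) * indicator {z. d \<le> norm z} z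
      \<partial>(lborel :: 'a::euclidean_space measure)) \<le> ennreal (A * d powr - a)"
proof -
  define n where "n = DIM('a)"
  define \<omega> where "\<omega> = unit_ball_vol (real n)"
  have \<omega>: "\<omega> > 0" by (simp add: \<omega>_def)
  have q: "2 powr -a < (1::real)" using a by (simp add: powr_less_one)
  define A where "A = \<omega> * 2 ^ n / (1 - 2 powr - a)"
  have "(\<integral>\<^sup>+z. ennreal (1 / norm z powr (real n + a)) * indicator {z. d \<le> norm z} z
      \<partial>(lborel :: 'a measure)) \<le> ennreal (A * d powr - a)" if d: "d > 0" for d :: real
  proof -
    have "(\<integral>\<^sup>+z. ennreal (1 / norm z powr (real n + a)) * indicator {z. d \<le> norm z} z \<partial>(lborel :: 'a measure))
      \<le> (\<Sum>k. ennreal (1 / (2^k * d) powr (real n + a)) * ennreal (\<omega> * (2 ^ Suc k * d) ^ n))"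
    proof (rule nn_integral_le_suminf_cover[where A = "\<lambda>k. {z. 2 ^ k * d \<le> norm z \<and> norm z < 2 ^ Suc k * d}"])
      fix z :: 'a
      assume "ennreal (1 / norm z powr (real n + a)) * indicator {z. d \<le> norm z} z \<noteq> 0"
      then have dz: "d \<le> norm z" by (auto split: split_indicator_asm)
      obtain k where k: "2 ^ k \<le> norm z / d" "norm z / d < 2 ^ Suc k"
        using ex_dyadic_real[of "norm z / d"] dz d by auto
      then have k': "2 ^ k * d \<le> norm z" "norm z < 2 ^ Suc k * d" using d by (auto simp: field_simps)
      have "0 < norm z" using dz d by linarith
      then have "1 / norm z powr (real n + a) \<le> 1 / (2^k * d) powr (real n + a)"
        using k' d a by (intro divide_left_mono powr_mono2 mult_pos_pos) auto
      then show "\<exists>k. z \<in> {z. 2 ^ k * d \<le> norm z \<and> norm z < 2 ^ Suc k * d} \<and>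
        ennreal (1 / norm z powr (real n + a)) * indicator {z. d \<le> norm z} z \<le> ennreal (1 / (2^k * d) powr (real n + a))"
        using k' dz by (intro exI[of _ k]) (auto intro: ennreal_leI)
    next
      fix k
      have "emeasure lborel {z::'a. 2 ^ k * d \<le> norm z \<and> norm z < 2 ^ Suc k * d} \<le> emeasure lborel (ball (0::'a) (2 ^ Suc k * d))"
        by (intro emeasure_mono) auto
      also have "\<dots> = ennreal (\<omega> * (2 ^ Suc k * d) ^ n)"
        using d by (subst emeasure_ball) (auto simp: \<omega>_def n_def)
      finally show "emeasure lborel {z::'a. 2 ^ k * d \<le> norm z \<and> norm z < 2 ^ Suc k * d} \<le> ennreal (\<omega> * (2 ^ Suc k * d) ^ n)" .
    qed measurable
    also have "\<dots> = (\<Sum>k. ennreal (\<omega> * 2 ^ n * d powr - a * (2 powr -a) ^ k))"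
    proof (intro suminf_cong)
      fix k :: nat
      define x where "x = 2 ^ k * d"
      have x: "x > 0" using d by (simp add: x_def)
      have "x powr - a = (2 powr real k) powr - a * d powr - a"
        by (simp add: x_def powr_mult powr_realpow)
      also have "(2 powr real k) powr - a = (2 powr -a) ^ k"
        by (simp add: powr_powr powr_realpow[symmetric] mult.commute)
      finally have xa: "x powr - a = (2 powr -a) ^ k * d powr - a" .
      have "1 / x powr (real n + a) * (\<omega> * (2 * x) ^ n) = \<omega> * 2 ^ n * x powr - a"
        using x by (simp add: powr_add powr_realpow powr_minus power_mult_distrib field_simps)
      then show "ennreal (1 / (2^k * d) powr (real n + a)) * ennreal (\<omega> * (2 ^ Suc k * d) ^ n)
        = ennreal (\<omega> * 2 ^ n * d powr - a * (2 powr -a) ^ k)"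
        using \<omega> d xa by (simp add: ennreal_mult[symmetric] x_def mult_ac)
    qed
    also have "\<dots> = ennreal (A * d powr - a)"
    proof -
      have "(\<lambda>k. \<omega> * 2 ^ n * d powr - a * (2 powr -a) ^ k) sums (\<omega> * 2 ^ n * d powr - a * (1 / (1 - 2 powr -a)))"
        using q by (intro sums_mult geometric_sums) auto
      then show ?thesis using \<omega> by (subst suminf_ennreal_eq) (auto simp: A_def mult_ac)
    qed
    finally show ?thesis .
  qed
  moreover have "A > 0" using \<omega> q by (simp add: A_def)
  ultimately show ?thesis unfolding n_def by blast
qed

text \<open>The same summation over annuli shrinking to the origin. The ratio is now 2^(a-p), and
  the series converges because a < p; for a = ps this is where s < 1 enters.\<close>

lemma nn_integral_kernel_near:
  assumes a: "0 < a" "a < p"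
  shows "\<exists>A>0. \<forall>d>0. (\<integral>\<^sup>+z. ennreal (norm z powr p / norm z powr (real DIM('a) + a)) * indicator {z. norm z < d} z
      \<partial>(lborel :: 'a::euclidean_space measure)) \<le> ennreal (A * d powr (p - a))"
proof -
  define n where "n = DIM('a)"
  define \<omega> where "\<omega> = unit_ball_vol (real n)"
  have \<omega>: "\<omega> > 0" by (simp add: \<omega>_def)
  have q: "2 powr (a - p) < (1::real)" using a by (simp add: powr_less_one)
  define A where "A = \<omega> * 2 powr (n + a) / (1 - 2 powr (a - p))"
  have "(\<integral>\<^sup>+z. ennreal (norm z powr p / norm z powr (real n + a)) * indicator {z. norm z < d} z
      \<partial>(lborel :: 'a measure)) \<le> ennreal (A * d powr (p - a))" if d: "d > 0" for d :: real
  proof -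
    have "(\<integral>\<^sup>+z. ennreal (norm z powr p / norm z powr (real n + a)) * indicator {z. norm z < d} z \<partial>(lborel :: 'a measure))
      \<le> (\<Sum>k. ennreal ((d / 2^k) powr p / (d / 2 ^ Suc k) powr (real n + a)) * ennreal (\<omega> * (d / 2 ^ k) ^ n))"
    proof (rule nn_integral_le_suminf_cover[where A = "\<lambda>k. {z. d / 2 ^ Suc k \<le> norm z \<and> norm z \<le> d / 2 ^ k}"])
      fix z :: 'a
      assume "ennreal (norm z powr p / norm z powr (real n + a)) * indicator {z. norm z < d} z \<noteq> 0"
      then have dz: "norm z < d" "norm z > 0" by (auto split: split_indicator_asm)
      obtain k where k: "2 ^ k \<le> d / norm z" "d / norm z < 2 ^ Suc k"
        using ex_dyadic_real[of "d / norm z"] dz d by auto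
      then have k': "d / 2 ^ Suc k \<le> norm z" "norm z \<le> d / 2 ^ k" using d dz by (auto simp: field_simps)
      have "norm z powr p / norm z powr (real n + a) \<le> (d / 2^k) powr p / (d / 2 ^ Suc k) powr (real n + a)"
        using k' d a by (intro frac_le powr_mono2) auto
      then show "\<exists>k. z \<in> {z. d / 2 ^ Suc k \<le> norm z \<and> norm z \<le> d / 2 ^ k} \<and>
        ennreal (norm z powr p / norm z powr (real n + a)) * indicator {z. norm z < d} z
          \<le> ennreal ((d / 2^k) powr p / (d / 2 ^ Suc k) powr (real n + a))"
        using k' dz by (intro exI[of _ k]) (auto intro: ennreal_leI)
    next
      fix k
      have "emeasure lborel {z::'a. d / 2 ^ Suc k \<le> norm z \<and> norm z \<le> d / 2 ^ k} \<le> emeasure lborel (cball (0::'a) (d / 2 ^ k))"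
        by (intro emeasure_mono) auto
      also have "\<dots> = ennreal (\<omega> * (d / 2 ^ k) ^ n)"
        using d by (subst emeasure_cball) (auto simp: \<omega>_def n_def)
      finally show "emeasure lborel {z::'a. d / 2 ^ Suc k \<le> norm z \<and> norm z \<le> d / 2 ^ k} \<le> ennreal (\<omega> * (d / 2 ^ k) ^ n)" .
    qed measurable
    also have "\<dots> = (\<Sum>k. ennreal (\<omega> * 2 powr (n + a) * d powr (p - a) * (2 powr (a - p)) ^ k))"
    proof (intro suminf_cong)
      fix k :: nat
      define x where "x = d / 2 ^ k"
      have x: "x > 0" using d by (simp add: x_def)
      have "x powr (p - a) = d powr (p - a) / (2 powr real k) powr (p - a)"
        by (simp add: x_def powr_divide powr_realpow)
      also have "\<dots> = d powr (p - a) * (2 powr (a - p)) ^ k"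
        by (simp add: powr_powr powr_realpow[symmetric] divide_powr_uminus algebra_simps)
      finally have xa: "x powr (p - a) = d powr (p - a) * (2 powr (a - p)) ^ k" .
      have "x powr p / (x/2) powr (real n + a) * (\<omega> * x ^ n) = \<omega> * 2 powr (n + a) * x powr (p - a)"
        using x by (simp add: powr_add powr_realpow powr_diff powr_divide field_simps)
      then show "ennreal ((d / 2^k) powr p / (d / 2 ^ Suc k) powr (real n + a)) * ennreal (\<omega> * (d / 2 ^ k) ^ n)
        = ennreal (\<omega> * 2 powr (n + a) * d powr (p - a) * (2 powr (a - p)) ^ k)"
        using \<omega> d xa by (simp add: ennreal_mult[symmetric] x_def mult_ac)
    qed
    also have "\<dots> = ennreal (A * d powr (p - a))"
    proof -
      have "(\<lambda>k. \<omega> * 2 powr (n + a) * d powr (p - a) * (2 powr (a - p)) ^ k) sums (\<omega> * 2 powr (n + a) * d powr (p - a) * (1 / (1 - 2 powr (a - p))))"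
        using q by (intro sums_mult geometric_sums) auto
      then show ?thesis using \<omega> by (subst suminf_ennreal_eq) (auto simp: A_def mult_ac)
    qed
    finally show ?thesis .
  qed
  moreover have "A > 0" using \<omega> q by (simp add: A_def)
  ultimately show ?thesis unfolding n_def by blast
qed

text \<open>The numerator bounds the p-th power of an increment of the cut-off, so this is the
  cut-off energy per base point. Splitting at distance \<open>r\<close> gives the scaling r^(-a),
  with a constant built from the dimension, \<open>a\<close>, \<open>p\<close> and
  \<open>C0\<close>; it ends up in the final constant.\<close>

lemma nn_integral_kernel_truncated:
  assumes a: "0 < a" "a < p" and C0: "C0 > 0"
  shows "\<exists>A>0. \<forall>r>0. (\<integral>\<^sup>+z. ennreal (min 1 ((C0 * norm z / r) powr p) / norm z powr (real DIM('a) + a))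
      \<partial>(lborel :: 'a::euclidean_space measure)) \<le> ennreal (A * r powr - a)"
proof -
  obtain A1 where A1: "A1 > 0" "\<And>d. d > 0 \<Longrightarrow> (\<integral>\<^sup>+z. ennreal (1 / norm z powr (real DIM('a) + a)) * indicator {z. d \<le> norm z} z
      \<partial>(lborel :: 'a measure)) \<le> ennreal (A1 * d powr - a)"
    using nn_integral_kernel_tail[OF a(1), where 'a='a] by blast
  obtain A2 where A2: "A2 > 0" "\<And>d. d > 0 \<Longrightarrow> (\<integral>\<^sup>+z. ennreal (norm z powr p / norm z powr (real DIM('a) + a)) * indicator {z. norm z < d} z
      \<partial>(lborel :: 'a measure)) \<le> ennreal (A2 * d powr (p - a))"
    using nn_integral_kernel_near[OF a, where 'a='a] by blast
  have "(\<integral>\<^sup>+z. ennreal (min 1 ((C0 * norm z / r) powr p) / norm z powr (real DIM('a) + a))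
      \<partial>(lborel :: 'a measure)) \<le> ennreal ((A1 + C0 powr p * A2) * r powr - a)" if r: "r > 0" for r :: real
  proof -
    have "ennreal (min 1 ((C0 * norm z / r) powr p) / norm z powr (real DIM('a) + a))
      \<le> ennreal (1 / norm z powr (real DIM('a) + a)) * indicator {z. r \<le> norm z} z
       + ennreal ((C0 / r) powr p) * (ennreal (norm z powr p / norm z powr (real DIM('a) + a)) * indicator {z. norm z < r} z)" for z :: 'a
    proof (cases "r \<le> norm z")
      case True
      then show ?thesis by (auto intro!: ennreal_leI divide_right_mono)
    next
      case False
      have "(C0 * norm z / r) powr p = (C0 / r) powr p * norm z powr p"
        by (simp add: powr_mult[symmetric])
      then have "min 1 ((C0 * norm z / r) powr p) / norm z powr (real DIM('a) + a)
        \<le> (C0 / r) powr p * (norm z powr p / norm z powr (real DIM('a) + a))"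
        by (simp add: divide_right_mono)
      then show ?thesis using False by (simp add: ennreal_mult[symmetric] ennreal_leI)
    qed
    then have "(\<integral>\<^sup>+z. ennreal (min 1 ((C0 * norm z / r) powr p) / norm z powr (real DIM('a) + a)) \<partial>(lborel :: 'a measure))
      \<le> (\<integral>\<^sup>+z. ennreal (1 / norm z powr (real DIM('a) + a)) * indicator {z. r \<le> norm z} z
       + ennreal ((C0 / r) powr p) * (ennreal (norm z powr p / norm z powr (real DIM('a) + a)) * indicator {z. norm z < r} z) \<partial>(lborel :: 'a measure))"
      by (intro nn_integral_mono) auto
    also have "\<dots> = (\<integral>\<^sup>+z. ennreal (1 / norm z powr (real DIM('a) + a)) * indicator {z. r \<le> norm z} z \<partial>(lborel :: 'a measure))
       + ennreal ((C0 / r) powr p) * (\<integral>\<^sup>+z. (ennreal (norm z powr p / norm z powr (real DIM('a) + a)) * indicator {z. norm z < r} z) \<partial>(lborel :: 'a measure))"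
      by (subst nn_integral_add) (auto simp: nn_integral_cmult)
    also have "\<dots> \<le> ennreal (A1 * r powr - a) + ennreal ((C0 / r) powr p) * ennreal (A2 * r powr (p - a))"
      using A1(2)[OF r] A2(2)[OF r] by (intro add_mono mult_left_mono) auto
    also have "\<dots> = ennreal (A1 * r powr - a + (C0 / r) powr p * (A2 * r powr (p - a)))"
      using A1 A2 by (simp add: ennreal_mult[symmetric])
    also have "A1 * r powr - a + (C0 / r) powr p * (A2 * r powr (p - a)) = (A1 + C0 powr p * A2) * r powr - a"
      using r by (simp add: powr_divide powr_diff powr_minus field_simps)
    finally show ?thesis .
  qed
  moreover have "A1 + C0 powr p * A2 > 0" using A1 A2 by (simp add: add_pos_nonneg)
  ultimately show ?thesis by blast
qed

section \<open>Translation invariance and Lipschitz bounds for powers\<close>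

lemma nn_integral_lborel_diff:
  fixes f :: "'a::euclidean_space \<Rightarrow> ennreal"
  assumes [measurable]: "f \<in> borel_measurable borel"
  shows "(\<integral>\<^sup>+y. f (x - y) \<partial>lborel) = (\<integral>\<^sup>+z. f z \<partial>lborel)"
proof -
  have "(lborel :: 'a measure) = distr lborel borel (\<lambda>z. x - z)"
    using lborel_affine[of "-1" x] by (simp add: density_1)
  then have "(\<integral>\<^sup>+z. f z \<partial>lborel) = (\<integral>\<^sup>+z. f z \<partial>distr lborel borel (\<lambda>z. x - z))" by simp
  then show ?thesis by (simp add: nn_integral_distr)
qed

lemma powr_neg_lipschitz:
  fixes p a b \<rho> :: real
  assumes "p \<ge> 1" "\<rho> > 0" "a \<ge> \<rho>" "b \<ge> \<rho>"
  shows "\<bar>a powr (1 - p) - b powr (1 - p)\<bar> \<le> (p - 1) * \<rho> powr (- p) * \<bar>a - b\<bar>"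
proof -
  have *: "a powr (1 - p) - b powr (1 - p) \<le> (p - 1) * \<rho> powr (- p) * \<bar>a - b\<bar>"
    if "a \<ge> \<rho>" "b \<ge> \<rho>" for a b
  proof -
    have "a powr (1 - p) - b powr (1 - p) \<le> (p - 1) * a powr (-p) * (b - a)"
      using powr_neg_above_tangent[of p a b] that assms by (simp add: algebra_simps)
    also have "\<dots> \<le> (p - 1) * a powr (-p) * \<bar>a - b\<bar>" using assms by (intro mult_left_mono) auto
    also have "\<dots> \<le> (p - 1) * \<rho> powr (-p) * \<bar>a - b\<bar>"
      using that assms by (intro mult_right_mono mult_left_mono powr_mono2') auto
    finally show ?thesis .
  qed
  show ?thesis using *[of a b] *[of b a] assms by (simp add: abs_le_iff abs_minus_commute)
qed

lemma powr_lipschitz_01: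
  fixes p \<alpha> \<beta> :: real
  assumes "p \<ge> 1" "0 \<le> \<alpha>" "\<alpha> \<le> 1" "0 \<le> \<beta>" "\<beta> \<le> 1"
  shows "\<bar>\<alpha> powr p - \<beta> powr p\<bar> \<le> p * \<bar>\<alpha> - \<beta>\<bar>"
proof -
  have *: "\<alpha> powr p - \<beta> powr p \<le> p * \<bar>\<alpha> - \<beta>\<bar>"
    if "0 \<le> \<alpha>" "\<alpha> \<le> 1" "0 \<le> \<beta>" "\<beta> \<le> 1" for \<alpha> \<beta>
  proof (cases "\<alpha> = 0")
    case True
    then show ?thesis using assms that by (smt (verit) mult_nonneg_nonneg powr_0 powr_ge_zero)
  next
    case False
    have "\<alpha> powr p - \<beta> powr p \<le> p * \<alpha> powr (p - 1) * (\<alpha> - \<beta>)"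
      using powr_above_tangent[of p \<alpha> \<beta>] that assms False by (simp add: algebra_simps)
    also have "\<dots> \<le> p * \<alpha> powr (p - 1) * \<bar>\<alpha> - \<beta>\<bar>" using assms by (intro mult_left_mono) auto
    also have "\<dots> \<le> p * 1 * \<bar>\<alpha> - \<beta>\<bar>"
      using that assms by (intro mult_right_mono mult_left_mono powr_le1) auto
    finally show ?thesis by simp
  qed
  show ?thesis using *[of \<alpha> \<beta>] *[of \<beta> \<alpha>] assms by (simp add: abs_le_iff abs_minus_commute)
qed

lemma integral_le_of_nn_integral_le:
  fixes f :: "'a \<Rightarrow> real"
  assumes [measurable]: "f \<in> borel_measurable M" and "\<And>x. 0 \<le> f x" "c \<ge> 0"
    and le: "(\<integral>\<^sup>+x. ennreal (f x) \<partial>M) \<le> ennreal c"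
  shows "integrable M f" "integral\<^sup>L M f \<le> c"
proof -
  show i: "integrable M f"
    using assms by (intro integrableI_nonneg) (auto intro: le_less_trans[OF le])
  show "integral\<^sup>L M f \<le> c"
    using nn_integral_eq_integral[OF i] assms(2) le \<open>c \<ge> 0\<close> by simp
qed

lemma nn_integral_lborel_translate:
  fixes f :: "'a::euclidean_space \<Rightarrow> ennreal"
  assumes [measurable]: "f \<in> borel_measurable borel"
  shows "(\<integral>\<^sup>+x. f (x - y) \<partial>lborel) = (\<integral>\<^sup>+z. f z \<partial>lborel)"
proof -
  have "(lborel :: 'a measure) = distr lborel borel (\<lambda>z. - y + z)"
    using lborel_affine[of 1 "- y"] by (simp add: density_1)
  then have "(\<integral>\<^sup>+z. f z \<partial>lborel) = (\<integral>\<^sup>+z. f z \<partial>distr lborel borel (\<lambda>z. - y + z))" by simp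
  then show ?thesis by (simp add: nn_integral_distr)
qed

text \<open>Tonelli: for a fixed point, the integral of q(x - y) over the other point is the
  integral of \<open>q\<close>. The 2 counts the two positions of \<open>h\<close>. Both the far
  part of the form and the cut-off energy are reduced to this shape.\<close>

lemma nn_integral_difference_kernel:
  fixes h q :: "'a::euclidean_space \<Rightarrow> ennreal"
  assumes [measurable]: "h \<in> borel_measurable borel" "q \<in> borel_measurable borel"
  shows "(\<integral>\<^sup>+z. (h (fst z) + h (snd z)) * q (fst z - snd z) \<partial>(lborel :: ('a \<times> 'a) measure))
    = 2 * (\<integral>\<^sup>+z. q z \<partial>lborel) * (\<integral>\<^sup>+x. h x \<partial>lborel)"
proof -
  have "(\<integral>\<^sup>+z. (h (fst z) + h (snd z)) * q (fst z - snd z) \<partial>(lborel :: ('a \<times> 'a) measure))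
    = (\<integral>\<^sup>+z. h (fst z) * q (fst z - snd z) \<partial>(lborel \<Otimes>\<^sub>M lborel)) + (\<integral>\<^sup>+z. h (snd z) * q (fst z - snd z) \<partial>(lborel \<Otimes>\<^sub>M lborel))"
    unfolding lborel_prod[symmetric] by (subst nn_integral_add[symmetric]) (auto simp: distrib_right)
  also have "(\<integral>\<^sup>+z. h (fst z) * q (fst z - snd z) \<partial>(lborel \<Otimes>\<^sub>M lborel)) = (\<integral>\<^sup>+x. h x \<partial>lborel) * (\<integral>\<^sup>+z. q z \<partial>lborel)"
    by (subst lborel.nn_integral_fst[symmetric])
       (auto simp: nn_integral_cmult nn_integral_lborel_diff nn_integral_multc)
  also have "(\<integral>\<^sup>+z. h (snd z) * q (fst z - snd z) \<partial>(lborel \<Otimes>\<^sub>M lborel)) = (\<integral>\<^sup>+x. h x \<partial>lborel) * (\<integral>\<^sup>+z. q z \<partial>lborel)"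
    by (subst lborel_pair.nn_integral_snd[symmetric])
       (auto simp: nn_integral_cmult nn_integral_lborel_translate nn_integral_multc)
  finally show ?thesis by (simp add: mult_2[symmetric] mult_ac)
qed

section \<open>The nonlocal form with a logarithmic test function\<close>

text \<open>Two radii are carried along: \<open>\<psi>\<close> vanishes outside
  \<open>ball x0 r1\<close>, and the collar of width \<open>r2 - r1\<close> allows pairs close to
  the diagonal to be treated without leaving \<open>ball x0 r2\<close>.\<close>

locale cutoff_region =
  fixes p s \<Lambda> C0 r r1 r2 \<rho> M :: real and x0 :: "'a::euclidean_space" and \<psi> :: "'a \<Rightarrow> real"
  assumes p: "2 < p" and s: "0 < s" "s < 1" and \<Lambda>: "1 \<le> \<Lambda>" and C0: "0 < C0"
    and r: "0 < r" "0 < r1" "r1 < r2" "r2 \<le> 3 * r / 2"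
    and \<rho>: "0 < \<rho>" "\<rho> \<le> M"
    and \<psi>_measurable [measurable]: "\<psi> \<in> borel_measurable borel"
    and \<psi>: "\<And>x. 0 \<le> \<psi> x" "\<And>x. \<psi> x \<le> 1"
    and \<psi>_support: "\<And>x. x \<notin> ball x0 r1 \<Longrightarrow> \<psi> x = 0"
    and \<psi>_lipschitz: "\<And>x y. \<bar>\<psi> x - \<psi> y\<bar> \<le> min 1 (C0 * norm (x - y) / r)"
    and \<psi>_one: "\<And>x. x \<in> ball x0 r \<Longrightarrow> \<psi> x = 1"
begin

definition kern :: "'a \<Rightarrow> 'a \<Rightarrow> real" where
  "kern x y = 1 / norm (x - y) powr (real DIM('a) + p * s)"

text \<open>Increments of \<open>\<psi>\<close> stand beside those of \<open>f\<close> because a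
  difference of \<open>logtest\<close> is controlled by both together.\<close>

definition near :: "real \<Rightarrow> ('a \<Rightarrow> real) \<Rightarrow> 'a \<times> 'a \<Rightarrow> real" where
  "near \<delta> f = (\<lambda>(x, y). if norm (x - y) < \<delta> then indicator (ball x0 r2) x * indicator (ball x0 r2) y *
     (kern x y * (\<bar>f x - f y\<bar> powr p + \<bar>\<psi> x - \<psi> y\<bar> powr p)) else 0)"

definition far :: "real \<Rightarrow> ('a \<Rightarrow> real) \<Rightarrow> 'a \<times> 'a \<Rightarrow> real" where
  "far \<delta> h = (\<lambda>(x, y). if \<delta> \<le> norm (x - y) then kern x y * (h x + h y) else 0)"

definition logtest :: "('a \<Rightarrow> real) \<Rightarrow> 'a \<Rightarrow> real" where
  "logtest f x = \<psi> x powr p * f x powr (1 - p)"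

definition flux :: "('a \<Rightarrow> real) \<Rightarrow> 'a \<Rightarrow> 'a \<Rightarrow> real" where
  "flux f x y = \<bar>f x - f y\<bar> powr (p - 2) * (f x - f y)"

abbreviation form :: "('a \<Rightarrow> real) \<Rightarrow> ('a \<Rightarrow> real) \<Rightarrow> ('a \<Rightarrow> 'a \<Rightarrow> real) \<Rightarrow> 'a \<times> 'a \<Rightarrow> real" where
  "form f g \<kappa> \<equiv> (\<lambda>(x, y). flux f x y * (logtest g x - logtest g y) * \<kappa> x y)"

text \<open>No kernel appears: on the support of the weights it is bounded below by a constant,
  which is kept outside.\<close>

definition logenergy :: "('a \<Rightarrow> real) \<Rightarrow> 'a \<times> 'a \<Rightarrow> real" where
  "logenergy f = (\<lambda>(x, y). \<bar>ln (f x) - ln (f y)\<bar> powr p * (\<psi> x powr p * \<psi> y powr p))"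

definition cutenergy :: "'a \<times> 'a \<Rightarrow> real" where
  "cutenergy = (\<lambda>(x, y). kern x y * \<bar>\<psi> x - \<psi> y\<bar> powr p)"

definition lip :: real where "lip = (p - 1) * \<rho> powr (- p) + p * \<rho> powr (1 - p)"

text \<open>The bounds hold at every point, which keeps logarithms and negative powers bounded
  without exceptional sets.\<close>

definition admissible :: "('a \<Rightarrow> real) \<Rightarrow> bool" where
  "admissible f \<longleftrightarrow> f \<in> borel_measurable borel \<and> (\<forall>x. \<rho> \<le> f x \<and> f x \<le> M)"

section \<open>Pointwise bounds for the logarithmic test function\<close>

lemma admissibleD:
  assumes "admissible f"
  shows "f \<in> borel_measurable borel" "\<rho> \<le> f x" "f x \<le> M" "0 < f x"
  using assms \<rho> by (auto simp: admissible_def intro: less_le_trans)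

lemma ball_measurable [measurable]: "ball x0 r2 \<in> sets borel"
  by simp

lemma kern_nonneg [simp]: "0 \<le> kern x y"
  by (simp add: kern_def)

lemma near_nonneg [simp]: "0 \<le> near \<delta> f z"
  by (auto simp: near_def split: prod.split)

lemma lip_nonneg: "0 \<le> lip" using p by (simp add: lip_def)

text \<open>Product rule for differences: one term carries the increment of
  \<open>g powr (1 - p)\<close>, the other that of \<open>\<psi> powr p\<close>, and
  \<open>lip\<close> dominates both Lipschitz constants.\<close>

lemma logtest_diff:
  assumes "admissible g"
  shows "\<bar>logtest g x - logtest g y\<bar> \<le> lip * (\<bar>g x - g y\<bar> + \<bar>\<psi> x - \<psi> y\<bar>)"
proof -
  note g = admissibleD[OF assms]
  have "logtest g x - logtest g y = \<psi> x powr p * (g x powr (1-p) - g y powr (1-p)) + (\<psi> x powr p - \<psi> y powr p) * g y powr (1-p)"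
    by (simp add: logtest_def algebra_simps)
  also have "\<bar>\<dots>\<bar> \<le> \<psi> x powr p * \<bar>g x powr (1-p) - g y powr (1-p)\<bar> + \<bar>\<psi> x powr p - \<psi> y powr p\<bar> * g y powr (1-p)"
    by (rule order_trans[OF abs_triangle_ineq]) (simp add: abs_mult)
  also have "\<dots> \<le> 1 * ((p - 1) * \<rho> powr (- p) * \<bar>g x - g y\<bar>) + (p * \<bar>\<psi> x - \<psi> y\<bar>) * \<rho> powr (1-p)"
    using g p \<rho> \<psi> by (intro add_mono mult_mono powr_le1 powr_neg_lipschitz powr_lipschitz_01 powr_mono2') auto
  also have "\<dots> \<le> lip * \<bar>g x - g y\<bar> + lip * \<bar>\<psi> x - \<psi> y\<bar>"
  proof (intro add_mono)
    show "1 * ((p - 1) * \<rho> powr (- p) * \<bar>g x - g y\<bar>) \<le> lip * \<bar>g x - g y\<bar>"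
      unfolding mult_1 using p by (intro mult_right_mono) (auto simp: lip_def)
    have "(p * \<rho> powr (1-p)) * \<bar>\<psi> x - \<psi> y\<bar> \<le> lip * \<bar>\<psi> x - \<psi> y\<bar>"
      using p by (intro mult_right_mono) (auto simp: lip_def)
    then show "(p * \<bar>\<psi> x - \<psi> y\<bar>) * \<rho> powr (1-p) \<le> lip * \<bar>\<psi> x - \<psi> y\<bar>" by (simp add: mult_ac)
  qed
  finally show ?thesis by (simp add: distrib_left)
qed

text \<open>At one point the factor \<open>\<psi> powr p\<close> is common to the two slices, so no
  increment of the cut-off appears.\<close>

lemma logtest_diff':
  assumes "admissible g" "admissible f"
  shows "\<bar>logtest g x - logtest f x\<bar> \<le> lip * (indicator (ball x0 r2) x * \<bar>g x - f x\<bar>)"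
proof (cases "x \<in> ball x0 r1")
  case True
  have "logtest g x - logtest f x = \<psi> x powr p * (g x powr (1-p) - f x powr (1-p))"
    by (simp add: logtest_def algebra_simps)
  also have "\<bar>\<dots>\<bar> = \<psi> x powr p * \<bar>g x powr (1-p) - f x powr (1-p)\<bar>" by (simp add: abs_mult)
  also have "\<dots> \<le> 1 * ((p - 1) * \<rho> powr (- p) * \<bar>g x - f x\<bar>)"
    using admissibleD[OF assms(1)] admissibleD[OF assms(2)] p \<rho> \<psi>
    by (intro mult_mono powr_le1 powr_neg_lipschitz) auto
  also have "\<dots> \<le> lip * \<bar>g x - f x\<bar>"
    unfolding mult_1 using p by (intro mult_right_mono) (auto simp: lip_def)
  finally show ?thesis using True r by simp
next
  case False
  then show ?thesis using lip_nonneg \<psi>_support[OF False] p by (simp add: logtest_def)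
qed

lemma logtest_nonneg [simp]: "0 \<le> logtest g x"
  by (simp add: logtest_def)

lemma logtest_support: "x \<notin> ball x0 r1 \<Longrightarrow> logtest g x = 0"
  using \<psi>_support p by (simp add: logtest_def)

lemma logtest_le:
  assumes "admissible g"
  shows "logtest g x \<le> \<rho> powr (1 - p) * indicator (ball x0 r2) x"
proof (cases "x \<in> ball x0 r1")
  case True
  have "logtest g x \<le> 1 * \<rho> powr (1 - p)"
    unfolding logtest_def using admissibleD[OF assms] p \<rho> \<psi>
    by (intro mult_mono powr_le1 powr_mono2') auto
  then show ?thesis using True r by simp
qed (simp add: logtest_support)

lemma logtest_measurable [measurable]:
  assumes "g \<in> borel_measurable borel"
  shows "logtest g \<in> borel_measurable borel"
  using assms unfolding logtest_def[abs_def] by measurable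

lemma abs_flux: "\<bar>flux f x y\<bar> = \<bar>f x - f y\<bar> powr (p - 1)"
  by (cases "f x = f y") (auto simp: flux_def abs_mult powr_diff power2_eq_square)

lemma flux_le:
  assumes "admissible f"
  shows "\<bar>flux f x y\<bar> \<le> M powr (p - 1)"
  unfolding abs_flux using admissibleD(2-4)[OF assms, of x] admissibleD(2-4)[OF assms, of y] p
  by (intro powr_mono2) auto

text \<open>If one of the points lay in \<open>ball x0 r1\<close>, the other would be within
  \<open>r2 - r1\<close> of it, and both would lie in \<open>ball x0 r2\<close>.\<close>

lemma logtest_close:
  assumes "norm (x - y) < r2 - r1" "\<not> (x \<in> ball x0 r2 \<and> y \<in> ball x0 r2)"
  shows "logtest g x = 0" "logtest g y = 0"
proof -
  have "x \<notin> ball x0 r1 \<and> y \<notin> ball x0 r1"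
  proof (rule ccontr)
    assume "\<not> ?thesis"
    moreover have "dist x0 x \<le> dist x0 y + norm (x - y)" "dist x0 y \<le> dist x0 x + norm (x - y)"
      using dist_triangle[of x0 x y] dist_triangle[of x0 y x] by (auto simp: dist_norm norm_minus_commute)
    ultimately show False using assms by auto
  qed
  then show "logtest g x = 0" "logtest g y = 0" by (simp_all add: logtest_support)
qed

text \<open>Below the distance \<open>r2 - r1\<close> the test function only sees pairs inside
  \<open>ball x0 r2\<close>; beyond any fixed distance the kernel is integrable in one variable.\<close>

lemma flux_logtest_le:
  assumes f: "admissible f" and g: "admissible g" and \<delta>: "\<delta> \<le> r2 - r1"
  shows "\<bar>flux f x y\<bar> * \<bar>logtest g x - logtest g y\<bar> * kern x y
    \<le> 2 * lip * (near \<delta> f (x, y) + near \<delta> g (x, y)) + M powr (p - 1) * far \<delta> (logtest g) (x, y)"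
proof (cases "\<delta> \<le> norm (x - y)")
  case True
  have "\<bar>flux f x y\<bar> * \<bar>logtest g x - logtest g y\<bar> * kern x y
    \<le> M powr (p - 1) * (logtest g x + logtest g y) * kern x y"
  proof (intro mult_right_mono mult_mono flux_le[OF f])
    show "\<bar>logtest g x - logtest g y\<bar> \<le> logtest g x + logtest g y"
      using logtest_nonneg[of g x] logtest_nonneg[of g y] by linarith
  qed auto
  also have "\<dots> = M powr (p - 1) * far \<delta> (logtest g) (x, y)"
    using True by (simp add: far_def mult_ac)
  finally show ?thesis using lip_nonneg
    by (smt (verit) mult_nonneg_nonneg near_nonneg)
next
  case False
  have far0: "far \<delta> (logtest g) (x, y) = 0" using False by (simp add: far_def)
  show ?thesis
  proof (cases "x \<in> ball x0 r2 \<and> y \<in> ball x0 r2")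
    case True
    define a b c where "a = \<bar>f x - f y\<bar>" and "b = \<bar>g x - g y\<bar>" and "c = \<bar>\<psi> x - \<psi> y\<bar>"
    have "\<bar>flux f x y\<bar> * \<bar>logtest g x - logtest g y\<bar> \<le> a powr (p-1) * (lip * (b + c))"
      unfolding abs_flux a_def b_def c_def using logtest_diff[OF g] by (intro mult_left_mono) auto
    also have "\<dots> = lip * (a powr (p-1) * b + a powr (p-1) * c)" by (simp add: algebra_simps)
    also have "\<dots> \<le> lip * ((a powr p + b powr p) + (a powr p + c powr p))"
      using p by (intro mult_left_mono add_mono powr_mult_le_sum lip_nonneg) (auto simp: a_def b_def c_def)
    also have "\<dots> \<le> lip * (2 * ((a powr p + c powr p) + (b powr p + c powr p)))"
      by (intro mult_left_mono lip_nonneg) (smt (verit) powr_ge_zero)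
    finally have "\<bar>flux f x y\<bar> * \<bar>logtest g x - logtest g y\<bar> * kern x y
       \<le> lip * (2 * ((a powr p + c powr p) + (b powr p + c powr p))) * kern x y"
      by (intro mult_right_mono) auto
    then show ?thesis using True False far0 by (simp add: near_def a_def b_def c_def algebra_simps)
  next
    case F: False
    then have "logtest g x = 0" "logtest g y = 0" using logtest_close[of x y g] False \<delta> by auto
    then show ?thesis using lip_nonneg far0 by simp
  qed
qed

text \<open>The cancellation between the two test functions is used far from the diagonal only,
  where it produces the distance of the slices. Near the diagonal the two differences are estimated
  separately: the pairs (f, g) and (f, f) give \<open>near\<close> of \<open>f\<close> three times
  and \<open>near\<close> of \<open>g\<close> once.\<close>

lemma flux_logtest_diff_le:
  assumes f: "admissible f" and g: "admissible g" and \<delta>: "\<delta> \<le> r2 - r1"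
  shows "\<bar>flux f x y\<bar> * \<bar>(logtest g x - logtest g y) - (logtest f x - logtest f y)\<bar> * kern x y
    \<le> 2 * lip * (3 * near \<delta> f (x, y) + near \<delta> g (x, y))
      + M powr (p - 1) * lip * far \<delta> (\<lambda>x. indicator (ball x0 r2) x * \<bar>g x - f x\<bar>) (x, y)"
proof (cases "\<delta> \<le> norm (x - y)")
  case True
  have "\<bar>flux f x y\<bar> * \<bar>(logtest g x - logtest g y) - (logtest f x - logtest f y)\<bar> * kern x y
    \<le> M powr (p - 1) * (lip * (indicator (ball x0 r2) x * \<bar>g x - f x\<bar>) + lip * (indicator (ball x0 r2) y * \<bar>g y - f y\<bar>)) * kern x y"
  proof (intro mult_right_mono mult_mono flux_le[OF f])
    show "\<bar>(logtest g x - logtest g y) - (logtest f x - logtest f y)\<bar>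
      \<le> lip * (indicator (ball x0 r2) x * \<bar>g x - f x\<bar>) + lip * (indicator (ball x0 r2) y * \<bar>g y - f y\<bar>)"
      using logtest_diff'[OF g f, of x] logtest_diff'[OF g f, of y] by linarith
  qed auto
  also have "\<dots> = M powr (p - 1) * lip * far \<delta> (\<lambda>x. indicator (ball x0 r2) x * \<bar>g x - f x\<bar>) (x, y)"
    using True by (simp add: far_def algebra_simps)
  finally show ?thesis using lip_nonneg
    by (smt (verit) mult_nonneg_nonneg near_nonneg)
next
  case False
  have far0: "far \<delta> h (x, y) = 0" for h using False by (simp add: far_def)
  have "\<bar>flux f x y\<bar> * \<bar>(logtest g x - logtest g y) - (logtest f x - logtest f y)\<bar> * kern x y
    \<le> \<bar>flux f x y\<bar> * (\<bar>logtest g x - logtest g y\<bar> + \<bar>logtest f x - logtest f y\<bar>) * kern x y"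
    by (intro mult_right_mono mult_left_mono) auto
  also have "\<dots> = \<bar>flux f x y\<bar> * \<bar>logtest g x - logtest g y\<bar> * kern x y + \<bar>flux f x y\<bar> * \<bar>logtest f x - logtest f y\<bar> * kern x y"
    by (simp add: algebra_simps)
  finally show ?thesis using flux_logtest_le[OF f g \<delta>, of x y] flux_logtest_le[OF f f \<delta>, of x y] far0
    by (simp add: algebra_simps)
qed


section \<open>Measurability and integrability of the energy densities\<close>

lemma near_measurable [measurable]:
  assumes [measurable]: "f \<in> borel_measurable borel"
  shows "near \<delta> f \<in> borel_measurable borel"
  unfolding near_def kern_def borel_prod[symmetric] by measurable

lemma far_measurable [measurable]:
  assumes [measurable]: "h \<in> borel_measurable borel"
  shows "far \<delta> h \<in> borel_measurable borel"
  unfolding far_def kern_def borel_prod[symmetric] by measurable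

lemma logenergy_measurable [measurable]:
  assumes [measurable]: "f \<in> borel_measurable borel"
  shows "logenergy f \<in> borel_measurable borel"
  unfolding logenergy_def borel_prod[symmetric] by measurable

lemma cutenergy_measurable [measurable]: "cutenergy \<in> borel_measurable borel"
  unfolding cutenergy_def kern_def borel_prod[symmetric] by measurable

text \<open>Tonelli with the tail of the kernel beyond \<delta>. The factor
  \<open>\<delta> powr - (p * s)\<close> is unbounded for small \<delta>, so \<delta> has to be
  fixed before the slices are brought close together in time.\<close>

lemma far_integral:
  "\<exists>A>0. \<forall>\<delta>>0. \<forall>h. integrable lborel h \<longrightarrow> (\<forall>x. 0 \<le> h x) \<longrightarrow>
     integrable lborel (far \<delta> h) \<and> integral\<^sup>L lborel (far \<delta> h) \<le> A * \<delta> powr - (p * s) * integral\<^sup>L lborel h"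
proof -
  have "p * s > 0" using p s by simp
  then obtain A where A: "A > 0" "\<And>d. d > 0 \<Longrightarrow>
     (\<integral>\<^sup>+z. ennreal (1 / norm z powr (real DIM('a) + p * s)) * indicator {z. d \<le> norm z} z
      \<partial>(lborel :: 'a measure)) \<le> ennreal (A * d powr - (p * s))"
    using nn_integral_kernel_tail[of "p * s", where 'a='a] by blast
  have "integrable lborel (far \<delta> h) \<and> integral\<^sup>L lborel (far \<delta> h) \<le> (2 * A) * \<delta> powr - (p * s) * integral\<^sup>L lborel h"
    if \<delta>: "\<delta> > 0" and h: "integrable lborel h" "\<And>x. 0 \<le> h x" for \<delta> h
  proof -
    have [measurable]: "h \<in> borel_measurable borel" using h by simp
    have h0: "integral\<^sup>L lborel h \<ge> 0" using h(2) by simp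
    have far0: "0 \<le> far \<delta> h z" for z using h(2) by (auto simp: far_def split: prod.split)
    have "(\<integral>\<^sup>+z. ennreal (far \<delta> h z) \<partial>lborel) =
      (\<integral>\<^sup>+z. (ennreal (h (fst z)) + ennreal (h (snd z))) * (ennreal (1 / norm (fst z - snd z) powr (real DIM('a) + p * s)) * indicator {z. \<delta> \<le> norm z} (fst z - snd z)) \<partial>lborel)"
      using h(2) by (intro nn_integral_cong)
        (auto simp: far_def kern_def ennreal_mult[symmetric] ennreal_plus[symmetric] mult.commute simp del: ennreal_plus split: split_indicator)
    also have "\<dots> = 2 * (\<integral>\<^sup>+z. ennreal (1 / norm z powr (real DIM('a) + p * s)) * indicator {z. \<delta> \<le> norm z} z \<partial>(lborel :: 'a measure)) * (\<integral>\<^sup>+x. h x \<partial>lborel)"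
      by (rule nn_integral_difference_kernel) auto
    also have "\<dots> \<le> 2 * ennreal (A * \<delta> powr - (p * s)) * (\<integral>\<^sup>+x. h x \<partial>lborel)"
      using A(2)[OF \<delta>] by (intro mult_right_mono mult_left_mono) auto
    also have "\<dots> = ennreal ((2 * A) * \<delta> powr - (p * s) * integral\<^sup>L lborel h)"
      using A h h0 by (simp add: nn_integral_eq_integral ennreal_mult mult.assoc)
    finally have *: "(\<integral>\<^sup>+z. ennreal (far \<delta> h z) \<partial>lborel) \<le> ennreal ((2 * A) * \<delta> powr - (p * s) * integral\<^sup>L lborel h)" .
    have "0 \<le> (2 * A) * \<delta> powr - (p * s) * integral\<^sup>L lborel h" using A h0 by simp
    with integral_le_of_nn_integral_le[OF _ far0 this *] show ?thesis by simp
  qed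
  then show ?thesis using A(1) by (intro exI[of _ "2 * A"]) auto
qed

text \<open>A pair contributes only if one of its points lies in the support ball, and the Lipschitz
  bound replaces the integrand by the truncated kernel of the difference. The factor 2 counts which
  of the two points it is.\<close>

lemma cutenergy_bound:
  assumes A: "(\<integral>\<^sup>+z. ennreal (min 1 ((C0 * norm z / r) powr p) / norm z powr (real DIM('a) + p * s))
      \<partial>(lborel :: 'a measure)) \<le> ennreal (A * r powr - (p * s))" and A0: "A > 0"
  shows "integrable lborel cutenergy"
    "integral\<^sup>L lborel cutenergy \<le> 2 * A * r powr - (p * s) * measure lborel (ball x0 (3 * r / 2))"
proof -
  define B where "B = ball x0 (3 * r / 2)"
  define q where "q z = min 1 ((C0 * norm z / r) powr p) / norm z powr (real DIM('a) + p * s)" for z :: 'a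
  have [measurable]: "q \<in> borel_measurable borel" unfolding q_def[abs_def] by measurable
  have [measurable]: "B \<in> sets borel" by (simp add: B_def)
  have q0: "0 \<le> q z" for z by (simp add: q_def)
  have le: "cutenergy (x, y) \<le> (indicator B x + indicator B y) * q (x - y)" for x y
  proof (cases "x \<in> B \<or> y \<in> B")
    case True
    have d: "\<bar>\<psi> x - \<psi> y\<bar> powr p \<le> min 1 ((C0 * norm (x - y) / r) powr p)"
    proof -
      have "\<bar>\<psi> x - \<psi> y\<bar> powr p \<le> (C0 * norm (x - y) / r) powr p" "\<bar>\<psi> x - \<psi> y\<bar> powr p \<le> 1 powr p"
        using \<psi>_lipschitz[of x y] p by (intro powr_mono2; simp)+
      then show ?thesis by simp
    qed
    have "cutenergy (x, y) \<le> 1 * q (x - y)"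
      using d by (simp add: cutenergy_def kern_def q_def divide_right_mono)
    also have "\<dots> \<le> (indicator B x + indicator B y) * q (x - y)"
      using True q0 by (intro mult_right_mono) (auto split: split_indicator)
    finally show ?thesis .
  next
    case False
    then have "x \<notin> ball x0 r1" "y \<notin> ball x0 r1" using r by (auto simp: B_def)
    then show ?thesis using \<psi>_support q0 p by (simp add: cutenergy_def)
  qed
  have emB: "emeasure lborel B = ennreal (measure lborel B)"
    unfolding B_def by (intro emeasure_eq_ennreal_measure) (use emeasure_lborel_ball_finite[of x0 "3 * r / 2"] in auto)
  have "(\<integral>\<^sup>+z. ennreal (cutenergy z) \<partial>lborel) \<le>
      (\<integral>\<^sup>+z. (indicator B (fst z) + indicator B (snd z)) * ennreal (q (fst z - snd z)) \<partial>lborel)"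
  proof (intro nn_integral_mono)
    fix z :: "'a \<times> 'a"
    have "ennreal (cutenergy z) \<le> ennreal ((indicator B (fst z) + indicator B (snd z)) * q (fst z - snd z))"
      using le[of "fst z" "snd z"] by (intro ennreal_leI) simp
    also have "\<dots> = (indicator B (fst z) + indicator B (snd z)) * ennreal (q (fst z - snd z))"
      using q0 by (auto simp: ennreal_mult' split: split_indicator)
    finally show "ennreal (cutenergy z) \<le> (indicator B (fst z) + indicator B (snd z)) * ennreal (q (fst z - snd z))" .
  qed
  also have "\<dots> = 2 * (\<integral>\<^sup>+z. ennreal (q z) \<partial>lborel) * (\<integral>\<^sup>+x. indicator B x \<partial>lborel)"
    by (rule nn_integral_difference_kernel) auto
  also have "\<dots> \<le> 2 * ennreal (A * r powr - (p * s)) * (\<integral>\<^sup>+x. indicator B x \<partial>lborel)"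
    using A unfolding q_def by (intro mult_right_mono mult_left_mono) auto
  also have "\<dots> = ennreal (2 * A * r powr - (p * s) * measure lborel B)"
    using A0 emB by (simp add: ennreal_mult mult.assoc)
  finally have *: "(\<integral>\<^sup>+z. ennreal (cutenergy z) \<partial>lborel) \<le> ennreal (2 * A * r powr - (p * s) * measure lborel B)" .
  have c0: "0 \<le> cutenergy z" for z by (auto simp: cutenergy_def split: prod.split)
  have "0 \<le> 2 * A * r powr - (p * s) * measure lborel B" using A0 by simp
  note integral_le_of_nn_integral_le[OF _ c0 this *]
  then show "integrable lborel cutenergy"
    "integral\<^sup>L lborel cutenergy \<le> 2 * A * r powr - (p * s) * measure lborel (ball x0 (3 * r / 2))"
    by (auto simp: B_def)
qed

lemma cutenergy_integrable: "integrable lborel cutenergy"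
proof -
  have "0 < p * s" "p * s < p" using p s by auto
  then obtain A where "A > 0" "\<forall>r>0. (\<integral>\<^sup>+z. ennreal (min 1 ((C0 * norm z / r) powr p) / norm z powr (real DIM('a) + p * s))
      \<partial>(lborel :: 'a measure)) \<le> ennreal (A * r powr - (p * s))"
    using nn_integral_kernel_truncated[of "p * s" p C0, where 'a='a] C0 by blast
  then show ?thesis using cutenergy_bound(1) r by blast
qed

lemma indicator_ball_integrable: "integrable lborel (\<lambda>x. indicator (ball x0 r2) x * c :: real)"
  using emeasure_lborel_ball_finite[of x0 r2] by (intro integrable_mult_left integrable_real_indicator) auto

lemma diff_integrable:
  assumes "admissible f" "admissible g"
  shows "integrable lborel (\<lambda>x. indicator (ball x0 r2) x * \<bar>g x - f x\<bar>)"
proof (rule Bochner_Integration.integrable_bound[OF indicator_ball_integrable[of M]])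
  show "(\<lambda>x. indicator (ball x0 r2) x * \<bar>g x - f x\<bar>) \<in> borel_measurable lborel"
  proof -
    note [measurable] = admissibleD(1)[OF assms(1)] admissibleD(1)[OF assms(2)]
    show ?thesis by measurable
  qed
  have "\<bar>g x - f x\<bar> \<le> M" for x
    using admissibleD(2-4)[OF assms(1), of x] admissibleD(2-4)[OF assms(2), of x] by (auto simp: abs_le_iff)
  then show "AE x in lborel. norm (indicator (ball x0 r2) x * \<bar>g x - f x\<bar>) \<le> norm (indicator (ball x0 r2) x * M)"
    using \<rho> by (auto split: split_indicator)
qed

lemma logtest_integrable:
  assumes "admissible g"
  shows "integrable lborel (logtest g)"
proof (rule Bochner_Integration.integrable_bound[OF indicator_ball_integrable[of "\<rho> powr (1 - p)"]])
  show "AE x in lborel. norm (logtest g x) \<le> norm (indicator (ball x0 r2) x * \<rho> powr (1 - p))"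
    using logtest_le[OF assms] by (auto simp: mult.commute)
qed (use admissibleD(1)[OF assms] in simp)

lemma ln_admissible:
  assumes "admissible f"
  shows "\<bar>ln (f x)\<bar> \<le> \<bar>ln \<rho>\<bar> + \<bar>ln M\<bar>" "\<bar>ln (f x) - ln (f y)\<bar> \<le> ln M - ln \<rho>"
proof -
  have "ln \<rho> \<le> ln (f x)" "ln (f x) \<le> ln M" for x
    using admissibleD(2-4)[OF assms, of x] \<rho> by (auto simp: ln_le_cancel_iff)
  from this[of x] this[of y] show "\<bar>ln (f x)\<bar> \<le> \<bar>ln \<rho>\<bar> + \<bar>ln M\<bar>" "\<bar>ln (f x) - ln (f y)\<bar> \<le> ln M - ln \<rho>"
    by linarith+
qed

lemma \<psi>_powr_le: "\<psi> x powr p \<le> indicator (ball x0 r2) x"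
proof (cases "x \<in> ball x0 r1")
  case True
  then show ?thesis using \<psi> p r by (simp add: powr_le1)
qed (use \<psi>_support p in simp)

lemma logenergy_bound:
  assumes "admissible f"
  shows "0 \<le> logenergy f z" "logenergy f z \<le> (ln M - ln \<rho>) powr p * indicator (ball x0 r2 \<times> ball x0 r2) z"
proof -
  show "0 \<le> logenergy f z" by (auto simp: logenergy_def split: prod.split)
  obtain x y where z: "z = (x, y)" by force
  have "logenergy f z \<le> (ln M - ln \<rho>) powr p * (indicator (ball x0 r2) x * indicator (ball x0 r2) y)"
    unfolding z logenergy_def prod.case using ln_admissible(2)[OF assms, of x y] p
    by (intro mult_mono powr_mono2 \<psi>_powr_le) auto
  then show "logenergy f z \<le> (ln M - ln \<rho>) powr p * indicator (ball x0 r2 \<times> ball x0 r2) z"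
    by (simp add: z indicator_times)
qed

lemma ball_prod_finite: "emeasure lborel (ball x0 r2 \<times> ball x0 r2) < \<infinity>"
  unfolding lborel_prod[symmetric]
  using emeasure_lborel_ball_finite[of x0 r2]
  by (subst lborel.emeasure_pair_measure_Times) (auto simp: ennreal_mult_less_top)

lemma logenergy_integrable:
  assumes "admissible f"
  shows "integrable lborel (logenergy f)"
proof (rule Bochner_Integration.integrable_bound)
  have "ball x0 r2 \<times> ball x0 r2 \<in> sets borel" by (intro borel_open open_Times) auto
  then show "integrable lborel (\<lambda>z. (ln M - ln \<rho>) powr p * indicator (ball x0 r2 \<times> ball x0 r2) z)"
    using ball_prod_finite by (intro integrable_mult_right integrable_real_indicator) auto
  show "AE z in lborel. norm (logenergy f z) \<le> norm ((ln M - ln \<rho>) powr p * indicator (ball x0 r2 \<times> ball x0 r2) z)"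
    using logenergy_bound[OF assms] by auto
qed (use admissibleD(1)[OF assms] in simp)

lemma near_integrable:
  assumes "f \<in> borel_measurable borel" "(\<integral>\<^sup>+z. near \<delta> f z \<partial>lborel) < \<infinity>"
  shows "integrable lborel (near \<delta> f)"
  using assms by (intro integrableI_nonneg) auto

text \<open>Bounds are asked off the diagonal only. At x = y the flux vanishes, and with it the
  form.\<close>

definition admissible_weight :: "('a \<Rightarrow> 'a \<Rightarrow> real) \<Rightarrow> bool" where
  "admissible_weight \<kappa> \<longleftrightarrow> (\<lambda>(x, y). \<kappa> x y) \<in> borel_measurable borel \<and>
     (\<forall>x y. x \<noteq> y \<longrightarrow> inverse \<Lambda> * kern x y \<le> \<kappa> x y \<and> \<kappa> x y \<le> \<Lambda> * kern x y)"

lemma admissible_weight_abs: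
  assumes "admissible_weight \<kappa>" "x \<noteq> y"
  shows "0 \<le> \<kappa> x y" "\<kappa> x y \<le> \<Lambda> * kern x y" "inverse \<Lambda> * kern x y \<le> \<kappa> x y"
proof -
  have "0 \<le> inverse \<Lambda> * kern x y" using \<Lambda> by simp
  also show "inverse \<Lambda> * kern x y \<le> \<kappa> x y" using assms by (simp add: admissible_weight_def)
  finally show "0 \<le> \<kappa> x y" .
  show "\<kappa> x y \<le> \<Lambda> * kern x y" using assms by (simp add: admissible_weight_def)
qed

lemma far_nonneg: "(\<And>x. 0 \<le> h x) \<Longrightarrow> 0 \<le> far \<delta> h z"
  by (auto simp: far_def split: prod.split)

lemma form_measurable:
  assumes "admissible f" "admissible g" "admissible_weight \<kappa>"
  shows "form f g \<kappa> \<in> borel_measurable lborel"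
proof -
  note [measurable] = admissibleD(1)[OF assms(1)] admissibleD(1)[OF assms(2)]
  have [measurable]: "(\<lambda>(x, y). \<kappa> x y) \<in> borel_measurable (borel \<Otimes>\<^sub>M borel)"
    using assms(3) by (simp add: admissible_weight_def borel_prod)
  have "form f g \<kappa> \<in> borel_measurable (borel \<Otimes>\<^sub>M borel)"
    unfolding flux_def logtest_def by measurable
  then show ?thesis by (simp add: borel_prod)
qed

text \<open>Integrability over pairs lets the iterated integral of the weak formulation be read as a
  double integral. The bound is affine in the near energies and uniform in the weight, which makes
  the form integrable in time.\<close>

lemma form_integrable:
  "\<exists>A\<ge>0. \<forall>f g \<kappa>. admissible f \<longrightarrow> admissible g \<longrightarrow> admissible_weight \<kappa> \<longrightarrow>
      integrable lborel (near (r2 - r1) f) \<longrightarrow> integrable lborel (near (r2 - r1) g) \<longrightarrow>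
      integrable lborel (form f g \<kappa>) \<and>
      \<bar>integral\<^sup>L lborel (form f g \<kappa>)\<bar>
        \<le> A * (integral\<^sup>L lborel (near (r2 - r1) f) + integral\<^sup>L lborel (near (r2 - r1) g) + 1)"
proof -
  obtain A0 where A0: "A0 > 0" "\<And>\<delta> h. \<delta> > 0 \<Longrightarrow> integrable lborel h \<Longrightarrow> (\<And>x. 0 \<le> h x) \<Longrightarrow>
     integrable lborel (far \<delta> h) \<and> integral\<^sup>L lborel (far \<delta> h) \<le> A0 * \<delta> powr - (p * s) * integral\<^sup>L lborel h"
    using far_integral by blast
  define \<delta> where "\<delta> = r2 - r1"
  have \<delta>: "\<delta> > 0" "\<delta> \<le> r2 - r1" using r by (auto simp: \<delta>_def)
  define I where "I = integral\<^sup>L lborel (\<lambda>x. indicator (ball x0 r2) x * \<rho> powr (1 - p))"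
  have I0: "0 \<le> I" unfolding I_def by (intro Bochner_Integration.integral_nonneg) auto
  define A where "A = \<Lambda> * (2 * lip + M powr (p - 1) * (A0 * \<delta> powr - (p * s) * I))"
  have A: "0 \<le> A" "\<Lambda> * (2 * lip) \<le> A" "\<Lambda> * (M powr (p - 1) * (A0 * \<delta> powr - (p * s) * I)) \<le> A"
    using \<Lambda> lip_nonneg A0 I0 by (auto simp: A_def intro!: mult_left_mono)
  have "integrable lborel (form f g \<kappa>) \<and>
      \<bar>integral\<^sup>L lborel (form f g \<kappa>)\<bar>
        \<le> A * (integral\<^sup>L lborel (near \<delta> f) + integral\<^sup>L lborel (near \<delta> g) + 1)"
    if f: "admissible f" and g: "admissible g" and \<kappa>: "admissible_weight \<kappa>"
      and nf: "integrable lborel (near \<delta> f)" and ng: "integrable lborel (near \<delta> g)" for f g \<kappa>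
  proof -
    define F where "F = form f g \<kappa>"
    define D where "D z = \<Lambda> * (2 * lip * (near \<delta> f z + near \<delta> g z) + M powr (p - 1) * far \<delta> (logtest g) z)" for z
    have far: "integrable lborel (far \<delta> (logtest g))"
        "integral\<^sup>L lborel (far \<delta> (logtest g)) \<le> A0 * \<delta> powr - (p * s) * integral\<^sup>L lborel (logtest g)"
      using A0(2)[OF \<delta>(1) logtest_integrable[OF g]] by auto
    have Di: "integrable lborel D" unfolding D_def using nf ng far by auto
    have D0: "0 \<le> D z" for z unfolding D_def using \<Lambda> lip_nonneg far_nonneg[of "logtest g"]
      by (intro mult_nonneg_nonneg add_nonneg_nonneg) auto
    have FD: "\<bar>F z\<bar> \<le> D z" for z
    proof -
      obtain x y where z: "z = (x, y)" by force
      show ?thesis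
      proof (cases "x = y")
        case True
        then show ?thesis using D0 by (simp add: F_def z)
      next
        case False
        have "\<bar>F z\<bar> = \<bar>flux f x y\<bar> * \<bar>logtest g x - logtest g y\<bar> * \<kappa> x y"
          using admissible_weight_abs(1)[OF \<kappa> False] by (simp add: F_def z abs_mult)
        also have "\<dots> \<le> \<bar>flux f x y\<bar> * \<bar>logtest g x - logtest g y\<bar> * (\<Lambda> * kern x y)"
          by (intro mult_left_mono admissible_weight_abs[OF \<kappa> False]) auto
        also have "\<dots> = \<Lambda> * (\<bar>flux f x y\<bar> * \<bar>logtest g x - logtest g y\<bar> * kern x y)" by simp
        also have "\<dots> \<le> D z"
          unfolding D_def z using flux_logtest_le[OF f g \<delta>(2)] \<Lambda> by (intro mult_left_mono) auto
        finally show ?thesis .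
      qed
    qed
    have "norm (F z) \<le> norm (D z)" for z using FD[of z] D0[of z] by simp
    then have Fi: "integrable lborel F"
      using form_measurable[OF f g \<kappa>]
      by (intro Bochner_Integration.integrable_bound[OF Di]) (auto simp: F_def[symmetric])
    have "\<bar>integral\<^sup>L lborel F\<bar> \<le> integral\<^sup>L lborel D"
      using integral_abs_bound[of lborel F] Bochner_Integration.integral_mono[OF integrable_abs[OF Fi] Di FD] by linarith
    also have "\<dots> = \<Lambda> * (2 * lip * (integral\<^sup>L lborel (near \<delta> f) + integral\<^sup>L lborel (near \<delta> g)) + M powr (p - 1) * integral\<^sup>L lborel (far \<delta> (logtest g)))"
      unfolding D_def using nf ng far(1) by (simp add: Bochner_Integration.integral_add)
    also have "\<dots> \<le> \<Lambda> * (2 * lip * (integral\<^sup>L lborel (near \<delta> f) + integral\<^sup>L lborel (near \<delta> g)) + M powr (p - 1) * (A0 * \<delta> powr - (p * s) * I))"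
    proof (intro mult_left_mono add_left_mono order_trans[OF far(2)])
      show "integral\<^sup>L lborel (logtest g) \<le> I"
        unfolding I_def using logtest_le[OF g]
        by (intro Bochner_Integration.integral_mono logtest_integrable[OF g] indicator_ball_integrable) (auto simp: mult.commute)
    qed (use A0 \<Lambda> in auto)
    also have "\<dots> = \<Lambda> * (2 * lip) * (integral\<^sup>L lborel (near \<delta> f) + integral\<^sup>L lborel (near \<delta> g)) + \<Lambda> * (M powr (p - 1) * (A0 * \<delta> powr - (p * s) * I)) * 1"
      by (simp add: algebra_simps)
    also have "\<dots> \<le> A * (integral\<^sup>L lborel (near \<delta> f) + integral\<^sup>L lborel (near \<delta> g)) + A * 1"
      by (intro add_mono mult_right_mono A) auto
    finally show ?thesis using Fi by (simp add: F_def distrib_left)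
  qed
  then show ?thesis using A(1) unfolding \<delta>_def by blast
qed

text \<open>The form is split into its diagonal part, where the logarithmic inequality applies, and the
  error from testing the flux of \<open>f\<close> with the logarithmic test function of a different time slice \<open>g\<close>.\<close>

lemma form_le:
  "\<exists>A>0. \<forall>\<delta> f g \<kappa>. 0 < \<delta> \<longrightarrow> \<delta> \<le> r2 - r1 \<longrightarrow> admissible f \<longrightarrow> admissible g \<longrightarrow> admissible_weight \<kappa> \<longrightarrow>
      integrable lborel (near \<delta> f) \<longrightarrow> integrable lborel (near \<delta> g) \<longrightarrow>
      integrable lborel (form f g \<kappa>) \<longrightarrow>
      integral\<^sup>L lborel (form f g \<kappa>)
        \<le> - (inverse \<Lambda> / (2 * (3 * r) powr (real DIM('a) + p * s))) * integral\<^sup>L lborel (logenergy f)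
          + (4 * (p - 1)) powr (p - 1) * \<Lambda> * integral\<^sup>L lborel cutenergy
          + A * (integral\<^sup>L lborel (near \<delta> f) + integral\<^sup>L lborel (near \<delta> g)
             + \<delta> powr - (p * s) * (LINT x|lborel. indicator (ball x0 r2) x * \<bar>g x - f x\<bar>))"
proof -
  obtain A0 where A0: "A0 > 0" "\<And>\<delta> h. \<delta> > 0 \<Longrightarrow> integrable lborel h \<Longrightarrow> (\<And>x. 0 \<le> h x) \<Longrightarrow>
     integrable lborel (far \<delta> h) \<and> integral\<^sup>L lborel (far \<delta> h) \<le> A0 * \<delta> powr - (p * s) * integral\<^sup>L lborel h"
    using far_integral by blast
  define Cp where "Cp = (4 * (p - 1)) powr (p - 1)"
  \<comment> \<open>The 2 is the factor 1/2 of \<open>log_inequality\<close>; \<open>3 * r\<close>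
    bounds the distance of any two points of the support.\<close>
  define c where "c = inverse \<Lambda> / (2 * (3 * r) powr (real DIM('a) + p * s))"
  define A where "A = \<Lambda> * (6 * lip + M powr (p - 1) * lip * A0) + 1"
  have A1: "A > 0" "\<Lambda> * (6 * lip) \<le> A" "\<Lambda> * (2 * lip) \<le> A" "\<Lambda> * (M powr (p - 1) * lip * A0) \<le> A"
  proof -
    have "0 \<le> \<Lambda> * lip" "0 \<le> \<Lambda> * (M powr (p - 1) * lip * A0)" using \<Lambda> lip_nonneg A0 by auto
    then show "A > 0" "\<Lambda> * (6 * lip) \<le> A" "\<Lambda> * (2 * lip) \<le> A" "\<Lambda> * (M powr (p - 1) * lip * A0) \<le> A"
      by (auto simp: A_def algebra_simps)
  qed
  have c0: "c \<ge> 0" using \<Lambda> by (simp add: c_def)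
  have "integral\<^sup>L lborel (form f g \<kappa>)
        \<le> - c * integral\<^sup>L lborel (logenergy f) + Cp * \<Lambda> * integral\<^sup>L lborel cutenergy
          + A * (integral\<^sup>L lborel (near \<delta> f) + integral\<^sup>L lborel (near \<delta> g)
             + \<delta> powr - (p * s) * (LINT x|lborel. indicator (ball x0 r2) x * \<bar>g x - f x\<bar>))"
    if \<delta>: "0 < \<delta>" "\<delta> \<le> r2 - r1" and f: "admissible f" and g: "admissible g" and \<kappa>: "admissible_weight \<kappa>"
      and nf: "integrable lborel (near \<delta> f)" and ng: "integrable lborel (near \<delta> g)"
      and Fi: "integrable lborel (form f g \<kappa>)" for \<delta> f g \<kappa>
  proof -
    define h where "h x = indicator (ball x0 r2) x * \<bar>g x - f x\<bar>" for x
    have h: "integrable lborel h" "\<And>x. 0 \<le> h x" unfolding h_def using diff_integrable[OF f g] by auto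
    note far = A0(2)[OF \<delta>(1) h]
    define D where "D z = - c * logenergy f z + Cp * \<Lambda> * cutenergy z
       + \<Lambda> * (2 * lip * (3 * near \<delta> f z + near \<delta> g z) + M powr (p - 1) * lip * far \<delta> h z)" for z
    have le: "form f g \<kappa> z \<le> D z" for z
    proof -
      obtain x y where z: "z = (x, y)" by force
      define E where "E = 2 * lip * (3 * near \<delta> f z + near \<delta> g z) + M powr (p - 1) * lip * far \<delta> h z"
      have E0: "0 \<le> E" unfolding E_def using lip_nonneg far_nonneg[OF h(2)]
        by (intro mult_nonneg_nonneg add_nonneg_nonneg) auto
      show ?thesis
      proof (cases "x = y")
        case True
        then show ?thesis using E0 \<Lambda> p by (simp add: z D_def flux_def logenergy_def cutenergy_def E_def[unfolded z])
      next
        case False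
        note \<kappa>b = admissible_weight_abs[OF \<kappa> False]
        have "(flux f x y * (logtest f x - logtest f y)) * \<kappa> x y
           \<le> (- (1/2) * logenergy f z + Cp * \<bar>\<psi> x - \<psi> y\<bar> powr p) * \<kappa> x y"
          using log_inequality[of p "f x" "f y" "\<psi> x" "\<psi> y"] p \<psi> admissibleD(4)[OF f] \<kappa>b
          by (intro mult_right_mono) (auto simp: flux_def logtest_def z logenergy_def Cp_def)
        also have "\<dots> = - (1/2 * logenergy f z * \<kappa> x y) + Cp * (\<bar>\<psi> x - \<psi> y\<bar> powr p * \<kappa> x y)"
          by (simp add: algebra_simps)
        also have "\<dots> \<le> - (c * logenergy f z) + Cp * (\<Lambda> * cutenergy z)"
        proof (intro add_mono le_imp_neg_le mult_left_mono)
          show "\<bar>\<psi> x - \<psi> y\<bar> powr p * \<kappa> x y \<le> \<Lambda> * cutenergy z"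
            using mult_left_mono[OF \<kappa>b(2), of "\<bar>\<psi> x - \<psi> y\<bar> powr p"] by (simp add: cutenergy_def z mult_ac)
          show "0 \<le> Cp" by (simp add: Cp_def)
          show "c * logenergy f z \<le> 1/2 * logenergy f z * \<kappa> x y"
          proof (cases "x \<in> ball x0 r1 \<and> y \<in> ball x0 r1")
            case True
            then have "norm (x - y) \<le> 3 * r"
              using r dist_triangle[of x y x0] by (auto simp: dist_norm norm_minus_commute)
            then have "norm (x - y) powr (real DIM('a) + p * s) \<le> (3 * r) powr (real DIM('a) + p * s)"
              using p s by (intro powr_mono2) auto
            then have "1 / (3 * r) powr (real DIM('a) + p * s) \<le> kern x y"
              unfolding kern_def using False r by (intro divide_left_mono mult_pos_pos) auto
            then have "inverse \<Lambda> * (1 / (3 * r) powr (real DIM('a) + p * s)) \<le> inverse \<Lambda> * kern x y"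
              using \<Lambda> by (intro mult_left_mono) auto
            then have "2 * c \<le> \<kappa> x y" using \<kappa>b(3) by (simp add: c_def)
            then have "logenergy f z * (2 * c) \<le> logenergy f z * \<kappa> x y"
              using logenergy_bound(1)[OF f] by (intro mult_left_mono) auto
            then show ?thesis by (simp add: mult_ac)
          next
            case F: False
            then have "logenergy f z = 0" using \<psi>_support p by (auto simp: logenergy_def z)
            then show ?thesis by simp
          qed
        qed
        finally have 1: "flux f x y * (logtest f x - logtest f y) * \<kappa> x y
           \<le> - (c * logenergy f z) + Cp * (\<Lambda> * cutenergy z)" .
        have "flux f x y * ((logtest g x - logtest g y) - (logtest f x - logtest f y)) * \<kappa> x y
          \<le> \<bar>flux f x y * ((logtest g x - logtest g y) - (logtest f x - logtest f y))\<bar> * \<kappa> x y"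
          by (intro mult_right_mono \<kappa>b) auto
        also have "\<dots> \<le> \<bar>flux f x y * ((logtest g x - logtest g y) - (logtest f x - logtest f y))\<bar> * (\<Lambda> * kern x y)"
          by (intro mult_left_mono \<kappa>b) auto
        also have "\<dots> = \<Lambda> * (\<bar>flux f x y\<bar> * \<bar>(logtest g x - logtest g y) - (logtest f x - logtest f y)\<bar> * kern x y)"
          by (simp add: abs_mult)
        also have "\<dots> \<le> \<Lambda> * E"
          using flux_logtest_diff_le[OF f g \<delta>(2), of x y] \<Lambda>
          unfolding E_def z h_def by (intro mult_left_mono) auto
        finally have 2: "flux f x y * ((logtest g x - logtest g y) - (logtest f x - logtest f y)) * \<kappa> x y \<le> \<Lambda> * E" .
        have "flux f x y * (logtest g x - logtest g y) * \<kappa> x y = flux f x y * (logtest f x - logtest f y) * \<kappa> x y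
           + flux f x y * ((logtest g x - logtest g y) - (logtest f x - logtest f y)) * \<kappa> x y"
          by (simp add: algebra_simps)
        then show ?thesis using 1 2 unfolding D_def E_def[symmetric] by (simp add: z mult.assoc)
      qed
    qed
    have Di: "integrable lborel D"
      unfolding D_def using logenergy_integrable[OF f] cutenergy_integrable nf ng far by auto
    have "integral\<^sup>L lborel (form f g \<kappa>) \<le> integral\<^sup>L lborel D"
      by (intro Bochner_Integration.integral_mono Fi Di le)
    also have "\<dots> = - c * integral\<^sup>L lborel (logenergy f) + Cp * \<Lambda> * integral\<^sup>L lborel cutenergy +
       \<Lambda> * (2 * lip * (3 * integral\<^sup>L lborel (near \<delta> f) + integral\<^sup>L lborel (near \<delta> g)) + M powr (p - 1) * lip * integral\<^sup>L lborel (far \<delta> h))"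
      unfolding D_def using logenergy_integrable[OF f] cutenergy_integrable nf ng far by simp
    also have "\<dots> \<le> - c * integral\<^sup>L lborel (logenergy f) + Cp * \<Lambda> * integral\<^sup>L lborel cutenergy +
       A * (integral\<^sup>L lborel (near \<delta> f) + integral\<^sup>L lborel (near \<delta> g) + \<delta> powr - (p * s) * integral\<^sup>L lborel h)"
    proof (intro add_left_mono)
      have "\<Lambda> * (2 * lip * (3 * integral\<^sup>L lborel (near \<delta> f) + integral\<^sup>L lborel (near \<delta> g)) + M powr (p - 1) * lip * integral\<^sup>L lborel (far \<delta> h))
        \<le> \<Lambda> * (2 * lip * (3 * integral\<^sup>L lborel (near \<delta> f) + integral\<^sup>L lborel (near \<delta> g)) + M powr (p - 1) * lip * (A0 * \<delta> powr - (p * s) * integral\<^sup>L lborel h))"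
        using far \<Lambda> lip_nonneg by (intro mult_left_mono add_left_mono) auto
      also have "\<dots> = \<Lambda> * (6 * lip) * integral\<^sup>L lborel (near \<delta> f) + \<Lambda> * (2 * lip) * integral\<^sup>L lborel (near \<delta> g)
         + \<Lambda> * (M powr (p - 1) * lip * A0) * (\<delta> powr - (p * s) * integral\<^sup>L lborel h)"
        by (simp add: algebra_simps)
      also have "\<dots> \<le> A * integral\<^sup>L lborel (near \<delta> f) + A * integral\<^sup>L lborel (near \<delta> g) + A * (\<delta> powr - (p * s) * integral\<^sup>L lborel h)"
        using h(2) by (intro add_mono mult_right_mono A1 mult_nonneg_nonneg) auto
      finally show "\<Lambda> * (2 * lip * (3 * integral\<^sup>L lborel (near \<delta> f) + integral\<^sup>L lborel (near \<delta> g)) + M powr (p - 1) * lip * integral\<^sup>L lborel (far \<delta> h))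
        \<le> A * (integral\<^sup>L lborel (near \<delta> f) + integral\<^sup>L lborel (near \<delta> g) + \<delta> powr - (p * s) * integral\<^sup>L lborel h)"
        by (simp add: distrib_left)
    qed
    finally show ?thesis unfolding h_def .
  qed
  then show ?thesis using A1(1) unfolding c_def Cp_def by blast
qed

end

lemma set_integrable_bounded:
  fixes f :: "real \<Rightarrow> real"
  assumes [measurable]: "f \<in> borel_measurable borel" and B: "\<And>x. \<bar>f x\<bar> \<le> B"
  shows "set_integrable lborel {a..b} f"
  unfolding set_integrable_def
proof (rule Bochner_Integration.integrable_bound)
  show "integrable lborel (\<lambda>x. indicator {a..b} x * B :: real)"
    by (intro integrable_mult_left integrable_real_indicator) (auto simp: emeasure_lborel_Icc_eq)
  show "AE x in lborel. norm (indicator {a..b} x *\<^sub>R f x) \<le> norm (indicator {a..b} x * B)"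
    using B by (intro AE_I2) (auto split: split_indicator intro: order_trans[OF B])
qed simp

lemma borel_measurable_uncurry2:
  assumes "(\<lambda>(x, t). u x t) \<in> borel_measurable (borel :: ('a::second_countable_topology \<times> 'b::second_countable_topology) measure)"
    and "f \<in> N \<rightarrow>\<^sub>M borel" "g \<in> N \<rightarrow>\<^sub>M borel"
  shows "(\<lambda>z. u (f z) (g z)) \<in> N \<rightarrow>\<^sub>M borel"
proof -
  have "(\<lambda>(x, t). u x t) \<in> borel_measurable (borel \<Otimes>\<^sub>M borel)" using assms(1) by (simp add: borel_prod)
  from measurable_compose[OF measurable_Pair[OF assms(2,3)] this] show ?thesis by simp
qed

lemma borel_measurable_uncurry3:
  assumes "(\<lambda>(x, y, t). K x y t) \<in> borel_measurable (borel :: ('a::second_countable_topology \<times> 'b::second_countable_topology \<times> 'c::second_countable_topology) measure)"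
    and "f \<in> N \<rightarrow>\<^sub>M borel" "g \<in> N \<rightarrow>\<^sub>M borel" "h \<in> N \<rightarrow>\<^sub>M borel"
  shows "(\<lambda>z. K (f z) (g z) (h z)) \<in> N \<rightarrow>\<^sub>M borel"
proof -
  have "(\<lambda>(x, y, t). K x y t) \<in> borel_measurable (borel \<Otimes>\<^sub>M (borel \<Otimes>\<^sub>M borel))"
    using assms(1) by (simp add: borel_prod)
  from measurable_compose[OF measurable_Pair[OF assms(2) measurable_Pair[OF assms(3,4)]] this]
  show ?thesis by simp
qed

lemma negligible_of_AE:
  fixes a b :: real
  assumes "AE t in lborel. t \<in> {a..b} \<longrightarrow> t \<in> G"
  shows "negligible ({a..b} - G)"
proof -
  have "AE t in lborel. \<not> (t \<in> {a..b} - G)" using assms by eventually_elim auto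
  then have "AE t in lebesgue. \<not> (t \<in> {a..b} - G)" by (simp only: AE_completion_iff)
  then have "{t. t \<le> b \<and> a \<le> t \<and> t \<notin> G} \<in> null_sets lebesgue" by (simp add: completion.AE_iff_null_sets)
  also have "{t. t \<le> b \<and> a \<le> t \<and> t \<notin> G} = {a..b} - G" by auto
  finally show ?thesis by (simp add: negligible_iff_null_sets)
qed

section \<open>Growth of the logarithmic mean\<close>

text \<open>\<open>u\<close> and \<open>K\<close> are Borel representatives; \<open>G\<close> is a set of full measure of times at which the slice of
  \<open>u\<close> represents the slice of the given supersolution.\<close>

locale log_supersolution = cutoff_region p s \<Lambda> C0 r r1 r2 \<rho> M x0 \<psi>
  for p s \<Lambda> C0 r r1 r2 \<rho> M :: real and x0 :: "'a::euclidean_space" and \<psi> :: "'a \<Rightarrow> real" +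
  fixes u :: "'a \<Rightarrow> real \<Rightarrow> real" and K :: "'a \<Rightarrow> 'a \<Rightarrow> real \<Rightarrow> real" and G :: "real set" and ta tb :: real
  assumes u_measurable: "(\<lambda>(x, t). u x t) \<in> borel_measurable borel"
    and u_bounds: "\<And>x t. \<rho> \<le> u x t" "\<And>x t. u x t \<le> M"
    and K_measurable: "(\<lambda>(x, y, t). K x y t) \<in> borel_measurable borel"
    and K_bounds: "\<And>x y t. x \<noteq> y \<Longrightarrow> inverse \<Lambda> * kern x y \<le> K x y t"
      "\<And>x y t. x \<noteq> y \<Longrightarrow> K x y t \<le> \<Lambda> * kern x y"
    and G: "G \<subseteq> {ta..tb}" "negligible ({ta..tb} - G)"
    and energy: "(\<integral>\<^sup>+\<tau>\<in>{ta..tb}. (\<integral>\<^sup>+z. near (r2 - r1) (\<lambda>x. u x \<tau>) z \<partial>lborel) \<partial>lborel) < \<infinity>"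
    and time_continuous: "\<And>e. 0 < e \<Longrightarrow> \<exists>\<eta>>0. \<forall>t\<in>G. \<forall>t'\<in>G. \<bar>t' - t\<bar> < \<eta> \<longrightarrow>
        (LINT x|lborel. indicator (ball x0 r2) x * \<bar>u x t' - u x t\<bar>) \<le> e"
    and tested: "\<And>t t'. t \<in> G \<Longrightarrow> t' \<in> G \<Longrightarrow> t < t' \<Longrightarrow> (\<integral>\<^sup>+z. near (r2 - r1) (\<lambda>x. u x t') z \<partial>lborel) < \<infinity> \<Longrightarrow>
        0 \<le> (LINT x|lborel. u x t' powr (p - 1) * logtest (\<lambda>x. u x t') x)
          - (LINT x|lborel. u x t powr (p - 1) * logtest (\<lambda>x. u x t') x)
          + (LINT \<tau>:{t..t'}|lborel. (LINT y|lborel. (LINT x|lborel.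
               flux (\<lambda>x. u x \<tau>) x y * (logtest (\<lambda>x. u x t') x - logtest (\<lambda>x. u x t') y) * K x y \<tau>)))"
begin

definition slice :: "real \<Rightarrow> 'a \<Rightarrow> real" where "slice t = (\<lambda>x. u x t)"

definition nearint :: "real \<Rightarrow> real \<Rightarrow> real" where
  "nearint \<delta> t = integral\<^sup>L lborel (near \<delta> (slice t))"

text \<open>The extended-valued companion of \<open>nearint\<close>: a Bochner integral takes the
  default value 0 when the energy is infinite, so finiteness has to be expressed here.\<close>

definition Nearint :: "real \<Rightarrow> real \<Rightarrow> ennreal" where
  "Nearint \<delta> t = (\<integral>\<^sup>+z. near \<delta> (slice t) z \<partial>lborel)"

definition tdist :: "real \<Rightarrow> real \<Rightarrow> real" where
  "tdist t t' = (LINT x|lborel. indicator (ball x0 r2) x * \<bar>u x t' - u x t\<bar>)"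

definition logmean :: "real \<Rightarrow> real" where
  "logmean t = (LINT x|lborel. \<psi> x powr p * ln (u x t))"

text \<open>What the formal computation gives as a lower bound for the time derivative of
  \<open>(p - 1) * logmean t\<close>: energy of the logarithm minus the price of the
  cut-off.\<close>

definition gain :: "real \<Rightarrow> real" where
  "gain t = inverse \<Lambda> / (2 * (3 * r) powr (real DIM('a) + p * s)) * integral\<^sup>L lborel (logenergy (slice t))
     - (4 * (p - 1)) powr (p - 1) * \<Lambda> * integral\<^sup>L lborel cutenergy"

lemmas u_meas [measurable (raw)] = borel_measurable_uncurry2[OF u_measurable]
  and K_meas [measurable (raw)] = borel_measurable_uncurry3[OF K_measurable]

lemma slice_admissible: "admissible (slice t)"
  unfolding admissible_def slice_def using u_bounds by auto

lemma slice_measurable [measurable]: "slice t \<in> borel_measurable borel"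
  using slice_admissible by (simp add: admissible_def)

lemma weight_admissible: "admissible_weight (\<lambda>x y. K x y t)"
  unfolding admissible_weight_def borel_prod[symmetric] using K_bounds by auto

lemma near_slice_measurable [measurable]:
  "(\<lambda>(t, z). near \<delta> (slice t) z) \<in> borel_measurable (borel \<Otimes>\<^sub>M borel)"
  unfolding near_def slice_def kern_def borel_prod[symmetric] split_beta' by measurable

lemma logenergy_slice_measurable [measurable]:
  "(\<lambda>(t, z). logenergy (slice t) z) \<in> borel_measurable (borel \<Otimes>\<^sub>M borel)"
  unfolding logenergy_def slice_def borel_prod[symmetric] split_beta' by measurable

lemma Nearint_measurable [measurable]: "Nearint \<delta> \<in> borel_measurable borel"
  unfolding Nearint_def[abs_def] by measurable

lemma nearint_measurable [measurable]: "nearint \<delta> \<in> borel_measurable borel"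
  unfolding nearint_def[abs_def] by measurable

lemma gain_measurable [measurable]: "gain \<in> borel_measurable borel"
  unfolding gain_def[abs_def] by measurable

lemma nearint_nonneg [simp]: "0 \<le> nearint \<delta> t"
  by (simp add: nearint_def)

lemma near_mono: "\<delta> \<le> \<delta>' \<Longrightarrow> near \<delta> f z \<le> near \<delta>' f z"
  by (auto simp: near_def split: prod.split)

lemma Nearint_mono: "\<delta> \<le> \<delta>' \<Longrightarrow> Nearint \<delta> t \<le> Nearint \<delta>' t"
  unfolding Nearint_def by (intro nn_integral_mono ennreal_leI near_mono)

lemma nearint_finite:
  assumes "Nearint (r2 - r1) t < \<infinity>" "\<delta> \<le> r2 - r1"
  shows "integrable lborel (near \<delta> (slice t))" "Nearint \<delta> t = ennreal (nearint \<delta> t)"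
proof -
  have "Nearint \<delta> t < \<infinity>" using assms Nearint_mono[of \<delta> "r2 - r1" t] by (metis le_less_trans)
  then show i: "integrable lborel (near \<delta> (slice t))" unfolding Nearint_def by (intro near_integrable) auto
  show "Nearint \<delta> t = ennreal (nearint \<delta> t)"
    unfolding Nearint_def nearint_def by (rule nn_integral_eq_integral[OF i]) simp
qed

lemma AE_Nearint_finite: "AE \<tau> in lborel. \<tau> \<in> {ta..tb} \<longrightarrow> Nearint (r2 - r1) \<tau> < \<infinity>"
proof -
  have "(\<integral>\<^sup>+\<tau>. Nearint (r2 - r1) \<tau> * indicator {ta..tb} \<tau> \<partial>lborel) \<noteq> \<infinity>"
    using energy unfolding Nearint_def slice_def by simp
  then have "AE \<tau> in lborel. Nearint (r2 - r1) \<tau> * indicator {ta..tb} \<tau> \<noteq> \<infinity>"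
    by (intro nn_integral_noteq_infinite) auto
  then show ?thesis by eventually_elim (auto simp: less_top)
qed

lemma AE_G: "AE \<tau> in lborel. \<tau> \<in> {ta..tb} \<longrightarrow> \<tau> \<in> G"
proof -
  have "{ta..tb} - G \<in> null_sets lebesgue" using G(2) by (simp add: negligible_iff_null_sets)
  then have "AE \<tau> in lebesgue. \<tau> \<notin> {ta..tb} - G" by (rule AE_not_in)
  then have "AE \<tau> in lborel. \<tau> \<notin> {ta..tb} - G" by (simp only: AE_completion_iff)
  then show ?thesis by eventually_elim auto
qed

lemma nearint_integrable:
  assumes "\<delta> \<le> r2 - r1" "ta \<le> t" "t' \<le> tb"
  shows "set_integrable lborel {t..t'} (nearint \<delta>)"
  unfolding set_integrable_def
proof (rule integrableI_nonneg)
  have "(\<integral>\<^sup>+\<tau>. ennreal (indicator {t..t'} \<tau> *\<^sub>R nearint \<delta> \<tau>) \<partial>lborel)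
    \<le> (\<integral>\<^sup>+\<tau>. Nearint (r2 - r1) \<tau> * indicator {ta..tb} \<tau> \<partial>lborel)"
  proof (rule nn_integral_mono_AE)
    show "AE \<tau> in lborel. ennreal (indicator {t..t'} \<tau> *\<^sub>R nearint \<delta> \<tau>) \<le> Nearint (r2 - r1) \<tau> * indicator {ta..tb} \<tau>"
      using AE_Nearint_finite
    proof eventually_elim
      case (elim \<tau>)
      show ?case
      proof (cases "\<tau> \<in> {t..t'}")
        case True
        then have "\<tau> \<in> {ta..tb}" using assms by auto
        then show ?thesis
          using elim True nearint_finite(2)[of \<tau> \<delta>] assms(1) Nearint_mono[OF assms(1), of \<tau>] by simp
      qed simp
    qed
  qed
  also have "\<dots> < \<infinity>" using energy by (simp add: Nearint_def slice_def)
  finally show "(\<integral>\<^sup>+\<tau>. ennreal (indicator {t..t'} \<tau> *\<^sub>R nearint \<delta> \<tau>) \<partial>lborel) < \<infinity>" .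
qed auto

text \<open>Dominated convergence twice, in space at almost every time and then in time, with the
  energy below distance \<open>r2 - r1\<close> as majorant. A shrinking cut eventually excludes
  every pair off the diagonal, and the diagonal contributes 0.\<close>

lemma ex_small_nearint:
  assumes "0 < e"
  obtains \<delta> where "0 < \<delta>" "\<delta> \<le> r2 - r1" "\<And>t t'. ta \<le> t \<Longrightarrow> t' \<le> tb \<Longrightarrow> integral {t..t'} (nearint \<delta>) \<le> e"
proof -
  define \<delta> where "\<delta> k = (r2 - r1) / real (Suc k)" for k
  have \<delta>0: "\<delta> k > 0" "\<delta> k \<le> r2 - r1" for k using r mult_left_mono[of 1 "1 + real k" "r2 - r1"] by (auto simp: \<delta>_def divide_le_eq)
  have \<delta>lim: "\<delta> \<longlonglongrightarrow> 0" unfolding \<delta>_def by (intro tendsto_divide_0[OF tendsto_const]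
     filterlim_compose[OF filterlim_real_at_infinity_sequentially filterlim_Suc])
  have near0: "(\<lambda>k. ennreal (near (\<delta> k) f z)) \<longlonglongrightarrow> 0" for f z
  proof (cases z)
    case (Pair x y)
    show ?thesis
    proof (cases "x = y")
      case True
      then show ?thesis by (simp add: near_def Pair cong: if_cong)
    next
      case False
      then have "eventually (\<lambda>k. \<delta> k < norm (x - y)) sequentially"
        using \<delta>lim by (intro order_tendstoD) auto
      then have "eventually (\<lambda>k. ennreal (near (\<delta> k) f z) = 0) sequentially"
        by eventually_elim (auto simp: near_def Pair)
      then show ?thesis by (rule tendsto_eventually)
    qed
  qed
  have inner: "(\<lambda>k. Nearint (\<delta> k) \<tau>) \<longlonglongrightarrow> 0" if "Nearint (r2 - r1) \<tau> < \<infinity>" for \<tau>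
  proof -
    have "(\<lambda>k. \<integral>\<^sup>+z. near (\<delta> k) (slice \<tau>) z \<partial>lborel) \<longlonglongrightarrow> (\<integral>\<^sup>+z. 0 \<partial>(lborel :: ('a \<times> 'a) measure))"
    proof (rule nn_integral_dominated_convergence[where w = "\<lambda>z. near (r2 - r1) (slice \<tau>) z"])
      show "AE x in lborel. ennreal (near (\<delta> j) (slice \<tau>) x) \<le> ennreal (near (r2 - r1) (slice \<tau>) x)" for j
        using \<delta>0(2) by (intro AE_I2 ennreal_leI near_mono)
      show "(\<integral>\<^sup>+x. ennreal (near (r2 - r1) (slice \<tau>) x) \<partial>lborel) < \<infinity>" using that by (simp add: Nearint_def)
    qed (use near0 in auto)
    then show ?thesis by (simp add: Nearint_def)
  qed
  have "(\<lambda>k. \<integral>\<^sup>+\<tau>. Nearint (\<delta> k) \<tau> * indicator {ta..tb} \<tau> \<partial>lborel) \<longlonglongrightarrow> (\<integral>\<^sup>+\<tau>. 0 \<partial>(lborel :: real measure))"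
  proof (rule nn_integral_dominated_convergence[where w = "\<lambda>\<tau>. Nearint (r2 - r1) \<tau> * indicator {ta..tb} \<tau>"])
    show "AE x in lborel. Nearint (\<delta> j) x * indicator {ta..tb} x \<le> Nearint (r2 - r1) x * indicator {ta..tb} x" for j
      using \<delta>0(2) by (intro AE_I2 mult_right_mono Nearint_mono) auto
    show "(\<integral>\<^sup>+x. Nearint (r2 - r1) x * indicator {ta..tb} x \<partial>lborel) < \<infinity>"
      using energy by (simp add: Nearint_def slice_def)
    show "AE x in lborel. (\<lambda>i. Nearint (\<delta> i) x * indicator {ta..tb} x) \<longlonglongrightarrow> 0"
      using AE_Nearint_finite by eventually_elim (auto split: split_indicator intro: inner)
  qed auto
  then have "eventually (\<lambda>k. (\<integral>\<^sup>+\<tau>. Nearint (\<delta> k) \<tau> * indicator {ta..tb} \<tau> \<partial>lborel) < ennreal e) sequentially"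
    using assms by (intro order_tendstoD) auto
  then obtain k where k: "(\<integral>\<^sup>+\<tau>. Nearint (\<delta> k) \<tau> * indicator {ta..tb} \<tau> \<partial>lborel) < ennreal e"
    using eventually_happens trivial_limit_sequentially by blast
  have "integral {t..t'} (nearint (\<delta> k)) \<le> e" if "ta \<le> t" "t' \<le> tb" for t t'
  proof -
    have "integral {t..t'} (nearint (\<delta> k)) = (LINT \<tau>|lborel. indicator {t..t'} \<tau> *\<^sub>R nearint (\<delta> k) \<tau>)"
      using set_borel_integral_eq_integral(2)[OF nearint_integrable[OF \<delta>0(2) that]]
      by (simp add: set_lebesgue_integral_def)
    also have "\<dots> \<le> e"
    proof (rule integral_le_of_nn_integral_le(2))
      have "(\<integral>\<^sup>+\<tau>. ennreal (indicator {t..t'} \<tau> *\<^sub>R nearint (\<delta> k) \<tau>) \<partial>lborel)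
         \<le> (\<integral>\<^sup>+\<tau>. Nearint (\<delta> k) \<tau> * indicator {ta..tb} \<tau> \<partial>lborel)"
      proof (rule nn_integral_mono_AE)
        show "AE \<tau> in lborel. ennreal (indicator {t..t'} \<tau> *\<^sub>R nearint (\<delta> k) \<tau>) \<le> Nearint (\<delta> k) \<tau> * indicator {ta..tb} \<tau>"
          using AE_Nearint_finite
        proof eventually_elim
          case (elim \<tau>)
          show ?case
          proof (cases "\<tau> \<in> {t..t'}")
            case True
            then have "\<tau> \<in> {ta..tb}" using that by auto
            then show ?thesis using elim True nearint_finite(2)[of \<tau> "\<delta> k"] \<delta>0(2) by simp
          qed simp
        qed
      qed
      then show "(\<integral>\<^sup>+\<tau>. ennreal (indicator {t..t'} \<tau> *\<^sub>R nearint (\<delta> k) \<tau>) \<partial>lborel) \<le> ennreal e" using k by simp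
    qed (use assms in auto)
    finally show ?thesis .
  qed
  then show ?thesis using that[of "\<delta> k"] \<delta>0 by blast
qed

lemma ln_integrable: "integrable lborel (\<lambda>x. \<psi> x powr p * ln (u x t))"
proof (rule Bochner_Integration.integrable_bound[OF indicator_ball_integrable[of "\<bar>ln \<rho>\<bar> + \<bar>ln M\<bar>"]])
  show "AE x in lborel. norm (\<psi> x powr p * ln (u x t)) \<le> norm (indicator (ball x0 r2) x * (\<bar>ln \<rho>\<bar> + \<bar>ln M\<bar>))"
    using mult_mono[OF \<psi>_powr_le ln_admissible(1)[OF slice_admissible[of t]]]
    by (auto simp: slice_def abs_mult)
qed measurable

text \<open>Above \<open>\<rho>\<close> the logarithm has Lipschitz constant 1/\<rho>, so continuity
  of the slices in L^1 passes to the logarithmic mean.\<close>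

lemma logmean_lipschitz: "\<bar>logmean t' - logmean t\<bar> \<le> tdist t t' / \<rho>"
proof -
  have "logmean t' - logmean t = (LINT x|lborel. \<psi> x powr p * ln (u x t') - \<psi> x powr p * ln (u x t))"
    unfolding logmean_def by (intro Bochner_Integration.integral_diff[symmetric] ln_integrable)
  also have "\<bar>\<dots>\<bar> \<le> (LINT x|lborel. \<bar>\<psi> x powr p * ln (u x t') - \<psi> x powr p * ln (u x t)\<bar>)"
    by (rule integral_abs_bound)
  also have "\<dots> \<le> (LINT x|lborel. indicator (ball x0 r2) x * \<bar>u x t' - u x t\<bar> / \<rho>)"
  proof (intro Bochner_Integration.integral_mono)
    show "integrable lborel (\<lambda>x. indicator (ball x0 r2) x * \<bar>u x t' - u x t\<bar> / \<rho>)"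
      using diff_integrable[OF slice_admissible[of t] slice_admissible[of t']]
      unfolding slice_def by (intro integrable_divide) auto
    have lnlip: "\<bar>ln a - ln b\<bar> \<le> \<bar>a - b\<bar> / \<rho>" if "\<rho> \<le> a" "\<rho> \<le> b" for a b
    proof -
      have *: "ln a - ln b \<le> \<bar>a - b\<bar> / \<rho>" if "\<rho> \<le> a" "\<rho> \<le> b" for a b
      proof -
        have "ln a - ln b = ln (a / b)" using that \<rho> by (simp add: ln_div)
        also have "\<dots> \<le> a / b - 1" using that \<rho> by (intro ln_le_minus_one) auto
        also have "\<dots> = (a - b) / b" using that \<rho> by (simp add: field_simps)
        also have "\<dots> \<le> \<bar>a - b\<bar> / b" using that \<rho> by (intro divide_right_mono) auto
        also have "\<dots> \<le> \<bar>a - b\<bar> / \<rho>" using that \<rho> by (intro divide_left_mono) auto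
        finally show ?thesis .
      qed
      show ?thesis using *[of a b] *[of b a] that by (simp add: abs_le_iff abs_minus_commute)
    qed
    show "\<bar>\<psi> x powr p * ln (u x t') - \<psi> x powr p * ln (u x t)\<bar> \<le> indicator (ball x0 r2) x * \<bar>u x t' - u x t\<bar> / \<rho>" for x
    proof -
      have "\<bar>\<psi> x powr p * ln (u x t') - \<psi> x powr p * ln (u x t)\<bar> = \<psi> x powr p * \<bar>ln (u x t') - ln (u x t)\<bar>"
        by (simp add: right_diff_distrib[symmetric] abs_mult)
      also have "\<dots> \<le> indicator (ball x0 r2) x * (\<bar>u x t' - u x t\<bar> / \<rho>)"
        using u_bounds by (intro mult_mono \<psi>_powr_le lnlip) auto
      finally show ?thesis by simp
    qed
  qed (auto intro!: ln_integrable)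
  also have "\<dots> = tdist t t' / \<rho>" unfolding tdist_def by simp
  finally show ?thesis .
qed

text \<open>Concavity of the logarithm: with \<open>v = u powr (p - 1)\<close> one has
  \<open>ln (v t') - ln (v t) \<ge> (v t' - v t) / v t'\<close>.\<close>

lemma logmean_increment:
  "(LINT x|lborel. u x t' powr (p - 1) * logtest (slice t') x) - (LINT x|lborel. u x t powr (p - 1) * logtest (slice t') x)
    \<le> (p - 1) * (logmean t' - logmean t)"
proof -
  have i: "integrable lborel (\<lambda>x. u x \<tau> powr (p - 1) * logtest (slice t') x)" for \<tau>
  proof (rule Bochner_Integration.integrable_bound[OF indicator_ball_integrable[of "M powr (p - 1) * \<rho> powr (1 - p)"]])
    show "AE x in lborel. norm (u x \<tau> powr (p - 1) * logtest (slice t') x) \<le> norm (indicator (ball x0 r2) x * (M powr (p - 1) * \<rho> powr (1 - p)))"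
    proof (intro AE_I2)
      fix x
      have "u x \<tau> powr (p - 1) * logtest (slice t') x \<le> M powr (p - 1) * (\<rho> powr (1 - p) * indicator (ball x0 r2) x)"
        using u_bounds[of x \<tau>] \<rho> p by (intro mult_mono logtest_le slice_admissible powr_mono2) auto
      then show "norm (u x \<tau> powr (p - 1) * logtest (slice t') x) \<le> norm (indicator (ball x0 r2) x * (M powr (p - 1) * \<rho> powr (1 - p)))"
        by (simp add: mult_ac)
    qed
  qed measurable
  have "(LINT x|lborel. u x t' powr (p - 1) * logtest (slice t') x) - (LINT x|lborel. u x t powr (p - 1) * logtest (slice t') x)
    = (LINT x|lborel. u x t' powr (p - 1) * logtest (slice t') x - u x t powr (p - 1) * logtest (slice t') x)"
    by (intro Bochner_Integration.integral_diff[symmetric] i)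
  also have "\<dots> \<le> (LINT x|lborel. (p - 1) * (\<psi> x powr p * ln (u x t') - \<psi> x powr p * ln (u x t)))"
  proof (intro Bochner_Integration.integral_mono)
    fix x
    define a b where "a = u x t powr (p - 1)" and "b = u x t' powr (p - 1)"
    have pos: "u x t > 0" "u x t' > 0" using u_bounds \<rho> by (auto intro: less_le_trans)
    then have ab: "a > 0" "b > 0" by (auto simp: a_def b_def)
    have inv: "u x t' powr (1 - p) = 1 / b" unfolding b_def using powr_minus_divide[of "u x t'" "p - 1"] by simp
    have "1 - a / b \<le> ln b - ln a" using ln_le_minus_one[of "a / b"] ab by (simp add: ln_div)
    then have "\<psi> x powr p * (1 - a / b) \<le> \<psi> x powr p * (ln b - ln a)" by (intro mult_left_mono) auto
    moreover have "ln b - ln a = (p - 1) * (ln (u x t') - ln (u x t))" by (simp add: a_def b_def algebra_simps)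
    moreover have "u x t' powr (p - 1) * logtest (slice t') x - u x t powr (p - 1) * logtest (slice t') x = \<psi> x powr p * (1 - a / b)"
      unfolding logtest_def slice_def inv a_def[symmetric] b_def[symmetric] using ab by (simp add: field_simps)
    ultimately show "u x t' powr (p - 1) * logtest (slice t') x - u x t powr (p - 1) * logtest (slice t') x
       \<le> (p - 1) * (\<psi> x powr p * ln (u x t') - \<psi> x powr p * ln (u x t))"
      by (simp add: algebra_simps)
  qed (auto intro!: i ln_integrable)
  also have "\<dots> = (p - 1) * (logmean t' - logmean t)"
    unfolding logmean_def using ln_integrable by simp
  finally show ?thesis .
qed

lemma gain_bounded: "\<exists>B. \<forall>t. \<bar>gain t\<bar> \<le> B"
proof -
  define L where "L = (LINT z|lborel. (ln M - ln \<rho>) powr p * indicator (ball x0 r2 \<times> ball x0 r2) z)"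
  have meas: "ball x0 r2 \<times> ball x0 r2 \<in> sets borel" by (intro borel_open open_Times) auto
  have "0 \<le> integral\<^sup>L lborel (logenergy (slice t))" "integral\<^sup>L lborel (logenergy (slice t)) \<le> L" for t
  proof -
    show "0 \<le> integral\<^sup>L lborel (logenergy (slice t))"
      using logenergy_bound(1)[OF slice_admissible] by simp
    show "integral\<^sup>L lborel (logenergy (slice t)) \<le> L"
      unfolding L_def using ball_prod_finite meas
      by (intro Bochner_Integration.integral_mono logenergy_integrable slice_admissible logenergy_bound(2)
          integrable_mult_right integrable_real_indicator) auto
  qed note L = this
  define c d where "c = inverse \<Lambda> / (2 * (3 * r) powr (real DIM('a) + p * s))"
    and "d = (4 * (p - 1)) powr (p - 1) * \<Lambda> * integral\<^sup>L lborel cutenergy"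
  have "\<bar>gain t\<bar> \<le> c * L + \<bar>d\<bar>" for t
  proof -
    have "0 \<le> c * integral\<^sup>L lborel (logenergy (slice t))" "c * integral\<^sup>L lborel (logenergy (slice t)) \<le> c * L"
      using L[of t] \<Lambda> by (intro mult_nonneg_nonneg mult_left_mono; simp add: c_def)+
    then show ?thesis unfolding gain_def c_def[symmetric] d_def[symmetric] by linarith
  qed
  then show ?thesis by blast
qed

lemma gain_integrable: "set_integrable lborel {t..t'} gain"
  using gain_bounded set_integrable_bounded[OF gain_measurable] by blast

lemma one_step:
  "\<exists>A>0. \<forall>\<delta> e t t'. 0 < \<delta> \<longrightarrow> \<delta> \<le> r2 - r1 \<longrightarrow> t \<in> G \<longrightarrow> t' \<in> G \<longrightarrow> t < t' \<longrightarrow> Nearint (r2 - r1) t' < \<infinity> \<longrightarrow>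
     (\<forall>\<tau>\<in>G. t \<le> \<tau> \<and> \<tau> \<le> t' \<longrightarrow> tdist \<tau> t' \<le> e) \<longrightarrow>
     (p - 1) * (logmean t' - logmean t) \<ge> integral {t..t'} gain - integral {t..t'} (\<lambda>\<tau>. A * nearint \<delta> \<tau>)
        - (t' - t) * (A * nearint \<delta> t' + A * \<delta> powr - (p * s) * e)"
proof -
  obtain A where A0: "A > 0" and A: "\<And>\<delta> f g \<kappa>. 0 < \<delta> \<Longrightarrow> \<delta> \<le> r2 - r1 \<Longrightarrow> admissible f \<Longrightarrow> admissible g \<Longrightarrow> admissible_weight \<kappa> \<Longrightarrow>
      integrable lborel (near \<delta> f) \<Longrightarrow> integrable lborel (near \<delta> g) \<Longrightarrow>
      integrable lborel (form f g \<kappa>) \<Longrightarrow>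
      integral\<^sup>L lborel (form f g \<kappa>)
        \<le> - (inverse \<Lambda> / (2 * (3 * r) powr (real DIM('a) + p * s))) * integral\<^sup>L lborel (logenergy f)
          + (4 * (p - 1)) powr (p - 1) * \<Lambda> * integral\<^sup>L lborel cutenergy
          + A * (integral\<^sup>L lborel (near \<delta> f) + integral\<^sup>L lborel (near \<delta> g)
             + \<delta> powr - (p * s) * (LINT x|lborel. indicator (ball x0 r2) x * \<bar>g x - f x\<bar>))"
    using form_le by blast
  obtain A' where A'0: "A' \<ge> 0" and A': "\<And>f g \<kappa>. admissible f \<Longrightarrow> admissible g \<Longrightarrow> admissible_weight \<kappa> \<Longrightarrow>
      integrable lborel (near (r2 - r1) f) \<Longrightarrow> integrable lborel (near (r2 - r1) g) \<Longrightarrow>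
      integrable lborel (form f g \<kappa>) \<and>
      \<bar>integral\<^sup>L lborel (form f g \<kappa>)\<bar>
        \<le> A' * (integral\<^sup>L lborel (near (r2 - r1) f) + integral\<^sup>L lborel (near (r2 - r1) g) + 1)"
    using form_integrable by blast
  have "(p - 1) * (logmean t' - logmean t) \<ge> integral {t..t'} gain - integral {t..t'} (\<lambda>\<tau>. A * nearint \<delta> \<tau>)
        - (t' - t) * (A * nearint \<delta> t' + A * \<delta> powr - (p * s) * e)"
    if \<delta>: "0 < \<delta>" "\<delta> \<le> r2 - r1" and t: "t \<in> G" "t' \<in> G" "t < t'" and fin: "Nearint (r2 - r1) t' < \<infinity>"
      and e: "\<And>\<tau>. \<tau> \<in> G \<Longrightarrow> t \<le> \<tau> \<Longrightarrow> \<tau> \<le> t' \<Longrightarrow> tdist \<tau> t' \<le> e" for \<delta> e t t'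
  proof -
    define E where "E \<tau> = (LINT y|lborel. (LINT x|lborel.
               flux (slice \<tau>) x y * (logtest (slice t') x - logtest (slice t') y) * K x y \<tau>))" for \<tau>
    have [measurable]: "E \<in> borel_measurable borel"
      unfolding E_def[abs_def] flux_def logtest_def slice_def by measurable
    have tt: "ta \<le> t" "t' \<le> tb" using t G by auto
    have good: "AE \<tau> in lborel. \<tau> \<in> {t..t'} \<longrightarrow> \<tau> \<in> G \<and> Nearint (r2 - r1) \<tau> < \<infinity>"
      using AE_G AE_Nearint_finite by eventually_elim (use tt in auto)
    \<comment> \<open>Only at times of finite near energy does Fubini identify the iterated
      integral, with y as outer variable, with the integral over pairs; almost every time is of this
      kind.\<close>
    have E_eq: "E \<tau> = integral\<^sup>L lborel (form (slice \<tau>) (slice t') (\<lambda>x y. K x y \<tau>))"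
      and E_int: "integrable lborel (form (slice \<tau>) (slice t') (\<lambda>x y. K x y \<tau>))"
      and E_abs: "\<bar>E \<tau>\<bar> \<le> A' * (nearint (r2 - r1) \<tau> + (nearint (r2 - r1) t' + 1))"
      if N: "Nearint (r2 - r1) \<tau> < \<infinity>" for \<tau>
    proof -
      note * = A'[OF slice_admissible[of \<tau>] slice_admissible[of t'] weight_admissible[of \<tau>] nearint_finite(1)[OF N order_refl] nearint_finite(1)[OF fin order_refl]]
      show i: "integrable lborel (form (slice \<tau>) (slice t') (\<lambda>x y. K x y \<tau>))"
        using * by blast
      show eq: "E \<tau> = integral\<^sup>L lborel (form (slice \<tau>) (slice t') (\<lambda>x y. K x y \<tau>))"
        unfolding E_def lborel_prod[symmetric]
        by (rule lborel_pair.integral_snd) (use i in \<open>simp add: lborel_prod\<close>)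
      show "\<bar>E \<tau>\<bar> \<le> A' * (nearint (r2 - r1) \<tau> + (nearint (r2 - r1) t' + 1))"
        using * unfolding eq nearint_def by (simp add: add.assoc)
    qed
    have const_int: "set_integrable lborel {t..t'} (\<lambda>_. c)" for c :: real
      by (rule set_integrable_bounded[where B = "\<bar>c\<bar>"]) auto
    \<comment> \<open>Without integrability the time integral of \<open>E\<close> would be the
      default 0, and it could not be compared with a majorant.\<close>
    have Ei: "set_integrable lborel {t..t'} E"
    proof (rule set_integrable_bound)
      show "set_integrable lborel {t..t'} (\<lambda>\<tau>. A' * (nearint (r2 - r1) \<tau> + (nearint (r2 - r1) t' + 1)))"
        by (intro set_integrable_mult_right set_integral_add const_int nearint_integrable tt order_refl)
      show "AE x in lborel. x \<in> {t..t'} \<longrightarrow> norm (E x) \<le> norm (A' * (nearint (r2 - r1) x + (nearint (r2 - r1) t' + 1)))"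
        using good by eventually_elim (use E_abs in \<open>auto intro: order_trans[OF _ abs_ge_self]\<close>)
    qed (simp add: set_borel_measurable_def)
    define c where "c = A * nearint \<delta> t' + A * \<delta> powr - (p * s) * e"
    have Di: "set_integrable lborel {t..t'} (\<lambda>\<tau>. A * nearint \<delta> \<tau> - gain \<tau> + c)"
      by (intro set_integral_add set_integral_diff set_integrable_mult_right const_int nearint_integrable gain_integrable tt \<delta>)
    have "(LINT \<tau>:{t..t'}|lborel. E \<tau>) \<le> (LINT \<tau>:{t..t'}|lborel. A * nearint \<delta> \<tau> - gain \<tau> + c)"
    proof (rule set_integral_mono_AE[OF Ei Di])
      show "AE \<tau>\<in>{t..t'} in lborel. E \<tau> \<le> A * nearint \<delta> \<tau> - gain \<tau> + c"
        using good
      proof eventually_elim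
        case (elim \<tau>)
        show ?case
        proof
          assume \<tau>: "\<tau> \<in> {t..t'}"
          then have N: "\<tau> \<in> G" "Nearint (r2 - r1) \<tau> < \<infinity>" using elim by auto
          have "E \<tau> \<le> - gain \<tau> + A * (nearint \<delta> \<tau> + nearint \<delta> t' + \<delta> powr - (p * s) * tdist \<tau> t')"
            using A[OF \<delta> slice_admissible[of \<tau>] slice_admissible[of t'] weight_admissible[of \<tau>]
              nearint_finite(1)[OF N(2) \<delta>(2)] nearint_finite(1)[OF fin \<delta>(2)] E_int[OF N(2)]]
            unfolding E_eq[OF N(2)] gain_def nearint_def tdist_def by (simp add: slice_def)
          also have "\<dots> \<le> - gain \<tau> + A * (nearint \<delta> \<tau> + nearint \<delta> t' + \<delta> powr - (p * s) * e)"
            using e[OF N(1)] \<tau> A0 by (intro add_left_mono mult_left_mono) auto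
          finally show "E \<tau> \<le> A * nearint \<delta> \<tau> - gain \<tau> + c" by (simp add: c_def algebra_simps)
        qed
      qed
    qed
    also have "\<dots> = integral {t..t'} (\<lambda>\<tau>. A * nearint \<delta> \<tau>) - integral {t..t'} gain + (t' - t) * c"
    proof -
      have 1: "set_integrable lborel {t..t'} (\<lambda>\<tau>. A * nearint \<delta> \<tau>)"
        by (intro set_integrable_mult_right nearint_integrable tt \<delta>)
      have "(LINT \<tau>:{t..t'}|lborel. A * nearint \<delta> \<tau> - gain \<tau> + c)
        = (LINT \<tau>:{t..t'}|lborel. A * nearint \<delta> \<tau>) - (LINT \<tau>:{t..t'}|lborel. gain \<tau>) + (LINT \<tau>:{t..t'}|lborel. c)"
        using 1 gain_integrable[of t t'] const_int[of c] by (simp add: set_integral_add set_integral_diff)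
      then show ?thesis
        using set_borel_integral_eq_integral(2)[OF 1] set_borel_integral_eq_integral(2)[OF gain_integrable[of t t']]
          set_borel_integral_eq_integral(2)[OF const_int[of c]] t(3) by simp
    qed
    finally have "(LINT \<tau>:{t..t'}|lborel. E \<tau>) \<le> integral {t..t'} (\<lambda>\<tau>. A * nearint \<delta> \<tau>) - integral {t..t'} gain + (t' - t) * c" .
    moreover have "0 \<le> (LINT x|lborel. u x t' powr (p - 1) * logtest (slice t') x)
          - (LINT x|lborel. u x t powr (p - 1) * logtest (slice t') x) + (LINT \<tau>:{t..t'}|lborel. E \<tau>)"
      using tested[OF t] fin unfolding E_def slice_def Nearint_def by blast
    ultimately show ?thesis using logmean_increment[of t' t] unfolding c_def by linarith
  qed
  then show ?thesis using A0 by blast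
qed

theorem logmean_growth:
  assumes t: "t1 \<in> G" "t2 \<in> G" "t1 < t2"
  shows "integral {t1..t2} gain \<le> (p - 1) * (logmean t2 - logmean t1)"
proof -
  obtain A where A0: "A > 0" and A: "\<And>\<delta> e t t'. 0 < \<delta> \<Longrightarrow> \<delta> \<le> r2 - r1 \<Longrightarrow> t \<in> G \<Longrightarrow> t' \<in> G \<Longrightarrow> t < t' \<Longrightarrow> Nearint (r2 - r1) t' < \<infinity> \<Longrightarrow>
     (\<And>\<tau>. \<tau> \<in> G \<Longrightarrow> t \<le> \<tau> \<Longrightarrow> \<tau> \<le> t' \<Longrightarrow> tdist \<tau> t' \<le> e) \<Longrightarrow>
     (p - 1) * (logmean t' - logmean t) \<ge> integral {t..t'} gain - integral {t..t'} (\<lambda>\<tau>. A * nearint \<delta> \<tau>)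
        - (t' - t) * (A * nearint \<delta> t' + A * \<delta> powr - (p * s) * e)"
    using one_step by blast
  have tt: "ta \<le> t1" "t2 \<le> tb" using t G by auto
  define G' where "G' = {t \<in> G. Nearint (r2 - r1) t < \<infinity>} \<union> {t1}"
  have neg: "negligible ({t1..t2} - G')"
  proof -
    have "AE \<tau> in lborel. \<tau> \<in> {t1..t2} \<longrightarrow> \<tau> \<in> G'"
      using AE_G AE_Nearint_finite by eventually_elim (use tt in \<open>auto simp: G'_def\<close>)
    then show ?thesis by (rule negligible_of_AE)
  qed
  obtain B where B: "\<And>t. \<bar>gain t\<bar> \<le> B" using gain_bounded by blast
  have "integral {t1..t2} gain \<le> (p - 1) * logmean t2 - (p - 1) * logmean t1"
  proof (rule increment_ge_integral[where G = G' and B = B and V = "\<lambda>t. (p - 1) * logmean t"])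
    show "gain integrable_on {t1..t2}" by (rule set_borel_integral_eq_integral(1)[OF gain_integrable])
    show "gain t \<le> B" for t using B[of t] by linarith
    show "\<exists>\<eta>>0. \<forall>t\<in>G'. t1 \<le> t \<and> t \<le> t2 \<and> t2 - t < \<eta> \<longrightarrow> (p - 1) * logmean t \<le> (p - 1) * logmean t2 + e" if e: "e > 0" for e
    proof -
      have "0 < e * \<rho> / (p - 1)" using e \<rho> p by simp
      then obtain \<eta> where \<eta>: "\<eta> > 0" "\<And>t t'. t \<in> G \<Longrightarrow> t' \<in> G \<Longrightarrow> \<bar>t' - t\<bar> < \<eta> \<Longrightarrow> tdist t t' \<le> e * \<rho> / (p - 1)"
        using time_continuous unfolding tdist_def by blast
      have "(p - 1) * logmean t \<le> (p - 1) * logmean t2 + e" if "t \<in> G'" "t1 \<le> t" "t \<le> t2" "t2 - t < \<eta>" for t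
      proof -
        have "tdist t t2 \<le> e * \<rho> / (p - 1)" using that \<eta>(2)[of t t2] \<open>t2 \<in> G\<close> \<open>t1 \<in> G\<close> by (auto simp: G'_def)
        then have "tdist t t2 / \<rho> \<le> e / (p - 1)" using \<rho> p by (simp add: field_simps)
        then have "logmean t - logmean t2 \<le> e / (p - 1)" using logmean_lipschitz[of t2 t] by linarith
        then show ?thesis using p by (simp add: field_simps)
      qed
      then show ?thesis using \<eta>(1) by blast
    qed
    show "\<exists>n \<eta>. \<eta> > 0 \<and> (\<forall>t. n t \<ge> 0) \<and> n integrable_on {t1..t2} \<and> integral {t1..t2} n \<le> e \<and>
       (\<forall>t\<in>G'. \<forall>t'\<in>G'. t1 \<le> t \<and> t < t' \<and> t' \<le> t2 \<and> t' - t < \<eta> \<longrightarrow>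
          (p - 1) * logmean t' - (p - 1) * logmean t \<ge> integral {t..t'} gain - integral {t..t'} n - (t' - t) * (n t' + e))" if e: "e > 0" for e
    proof -
      \<comment> \<open>First \<delta> makes the near energy small in time average; then \<eta> is
        chosen in terms of the factor \<open>c\<close> that this \<delta> produces.\<close>
      obtain \<delta> where \<delta>: "0 < \<delta>" "\<delta> \<le> r2 - r1" "\<And>t t'. ta \<le> t \<Longrightarrow> t' \<le> tb \<Longrightarrow> integral {t..t'} (nearint \<delta>) \<le> e / A"
        using ex_small_nearint[of "e / A"] e A0 by auto
      define c where "c = A * \<delta> powr - (p * s)"
      have c: "c > 0" using A0 \<delta> by (simp add: c_def)
      obtain \<eta> where \<eta>: "\<eta> > 0" "\<And>t t'. t \<in> G \<Longrightarrow> t' \<in> G \<Longrightarrow> \<bar>t' - t\<bar> < \<eta> \<Longrightarrow> tdist t t' \<le> e / c"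
        using time_continuous[of "e / c"] e c unfolding tdist_def by auto
      have "(p - 1) * logmean t' - (p - 1) * logmean t \<ge> integral {t..t'} gain - integral {t..t'} (\<lambda>\<tau>. A * nearint \<delta> \<tau>)
           - (t' - t) * (A * nearint \<delta> t' + e)"
        if "t \<in> G'" "t' \<in> G'" "t1 \<le> t" "t < t'" "t' \<le> t2" "t' - t < \<eta>" for t t'
      proof -
        have "t \<in> G" "t' \<in> G" "Nearint (r2 - r1) t' < \<infinity>" using that t by (auto simp: G'_def)
        moreover have "tdist \<tau> t' \<le> e / c" if "\<tau> \<in> G" "t \<le> \<tau>" "\<tau> \<le> t'" for \<tau>
          using \<eta>(2)[OF that(1) \<open>t' \<in> G\<close>] that \<open>t' - t < \<eta>\<close> by auto
        ultimately have "(p - 1) * (logmean t' - logmean t) \<ge> integral {t..t'} gain - integral {t..t'} (\<lambda>\<tau>. A * nearint \<delta> \<tau>)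
          - (t' - t) * (A * nearint \<delta> t' + A * \<delta> powr - (p * s) * (e / c))"
          using A[OF \<delta>(1,2), of t t' "e / c"] that by blast
        moreover have "A * \<delta> powr - (p * s) * (e / c) = e" using c by (simp add: c_def[symmetric])
        ultimately show ?thesis by (simp add: right_diff_distrib)
      qed
      moreover have "(\<lambda>\<tau>. A * nearint \<delta> \<tau>) integrable_on {t1..t2}"
        by (intro set_borel_integral_eq_integral(1) set_integrable_mult_right nearint_integrable \<delta> tt)
      moreover have "integral {t1..t2} (\<lambda>\<tau>. A * nearint \<delta> \<tau>) \<le> e"
        using \<delta>(3)[OF tt] A0 by (simp add: field_simps)
      ultimately show ?thesis
        using \<eta>(1) A0 by (intro exI[of _ "\<lambda>\<tau>. A * nearint \<delta> \<tau>"] exI[of _ \<eta>]) auto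
    qed
  qed (use t neg in \<open>auto simp: G'_def\<close>)
  then show ?thesis by (simp add: right_diff_distrib)
qed

end

section \<open>Level sets of the logarithm\<close>

text \<open>A discrete form of the differential inequality \<open>H' \<ge> c e H powr p\<close>: as long as \<open>H\<close> at most
  doubles on a short interval, \<open>H powr (1 - p)\<close> changes there by at least a multiple of the integral of \<open>e\<close>.\<close>

lemma integral_le_of_power_growth:
  fixes H e :: "real \<Rightarrow> real"
  assumes p: "p > 1" and c: "c > 0" and h0: "h0 > 0" and \<sigma>: "\<sigma> = 1 \<or> \<sigma> = -1"
    and t: "t1 \<in> G" "t2 \<in> G" "t1 < t2" "negligible ({t1..t2} - G)"
    and e: "e integrable_on {t1..t2}" "\<And>t. 0 \<le> e t" "\<And>t. e t \<le> B"
    and H: "\<And>t. t \<in> G \<Longrightarrow> t1 \<le> t \<Longrightarrow> t \<le> t2 \<Longrightarrow> h0 \<le> H t"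
    and growth: "\<And>t t'. t \<in> G \<Longrightarrow> t' \<in> G \<Longrightarrow> t1 \<le> t \<Longrightarrow> t < t' \<Longrightarrow> t' \<le> t2 \<Longrightarrow>
       c * min (H t) (H t') powr p * integral {t..t'} e \<le> \<sigma> * (H t' - H t)"
    and cont: "\<exists>\<eta>>0. \<forall>t\<in>G. \<forall>t'\<in>G. t1 \<le> t \<and> t < t' \<and> t' \<le> t2 \<and> t' - t < \<eta> \<longrightarrow> \<bar>H t' - H t\<bar> \<le> h0"
  shows "integral {t1..t2} e \<le> 2 powr p / ((p - 1) * c) * h0 powr (1 - p)"
proof -
  \<comment> \<open>On a short step the larger endpoint value is at most twice the smaller one.
    Replacing it by \<open>2 * lo\<close> in the derivative of the power costs the factor
    \<open>2 powr p\<close>.\<close>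
  define d where "d = (p - 1) * c / 2 powr p"
  \<comment> \<open>The sign makes \<open>V\<close> nondecreasing on short steps whether
    \<open>H\<close> grows or decays.\<close>
  define V where "V t = - \<sigma> * H t powr (1 - p)" for t
  have d: "d > 0" using p c by (simp add: d_def)
  obtain \<eta> where \<eta>: "\<eta> > 0" "\<And>t t'. t \<in> G \<Longrightarrow> t' \<in> G \<Longrightarrow> t1 \<le> t \<Longrightarrow> t < t' \<Longrightarrow> t' \<le> t2 \<Longrightarrow> t' - t < \<eta> \<Longrightarrow> \<bar>H t' - H t\<bar> \<le> h0"
    using cont by blast
  have ei: "e integrable_on {t..t'}" if "t1 \<le> t" "t' \<le> t2" for t t'
    using integrable_on_subinterval[OF e(1), of t t'] that by auto
  have step: "integral {t..t'} (\<lambda>t. d * e t) \<le> V t' - V t"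
    if that: "t \<in> G" "t' \<in> G" "t1 \<le> t" "t < t'" "t' \<le> t2" "t' - t < \<eta>" for t t'
  proof -
    define lo hi where "lo = min (H t) (H t')" and "hi = max (H t) (H t')"
    define I where "I = integral {t..t'} e"
    have I0: "0 \<le> I" unfolding I_def using e(2) that by (intro integral_nonneg ei) auto
    have lo: "h0 \<le> lo" "lo \<le> hi" using H that by (auto simp: lo_def hi_def)
    have hi: "hi \<le> 2 * lo" using \<eta>(2)[OF that] lo H[of t] H[of t'] that by (auto simp: lo_def hi_def min_def max_def)
    have g: "c * lo powr p * I \<le> \<sigma> * (H t' - H t)" unfolding lo_def I_def using that by (intro growth) auto
    \<comment> \<open>The growth hypothesis fixes the sign of the increment, so \<open>lo\<close>
      and \<open>hi\<close> are the two endpoint values in the order prescribed by \<sigma>.\<close>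
    then have "0 \<le> \<sigma> * (H t' - H t)" using c I0 by (intro order_trans[OF _ g]) auto
    then have V: "V t' - V t = lo powr (1 - p) - hi powr (1 - p)" and HH: "\<sigma> * (H t' - H t) = hi - lo"
      using \<sigma> by (auto simp: V_def lo_def hi_def min_def max_def)
    have "(p - 1) * hi powr (- p) * (hi - lo) \<le> lo powr (1 - p) - hi powr (1 - p)"
      using powr_neg_above_tangent[of p hi lo] p lo h0 by (simp add: algebra_simps)
    moreover have "(p - 1) * (2 * lo) powr (- p) * (c * lo powr p * I) \<le> (p - 1) * hi powr (- p) * (hi - lo)"
    proof (intro mult_mono)
      show "(2 * lo) powr - p \<le> hi powr - p" using hi lo h0 p by (intro powr_mono2') auto
      show "c * lo powr p * I \<le> hi - lo" using g HH by simp
    qed (use p c I0 in auto)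
    moreover have "(p - 1) * (2 * lo) powr (- p) * (c * lo powr p * I) = d * I"
      using lo h0 by (simp add: d_def powr_mult powr_minus field_simps)
    ultimately show ?thesis unfolding V I_def by simp
  qed
  have mono: "V t \<le> V t'" if that: "t \<in> G" "t' \<in> G" "t1 \<le> t" "t < t'" "t' \<le> t2" "t' - t < \<eta>" for t t'
  proof -
    have "0 \<le> integral {t..t'} (\<lambda>t. d * e t)"
      using e(2) d that by (intro integral_nonneg integrable_on_mult_right ei) auto
    then show ?thesis using step[OF that] by linarith
  qed
  have "integral {t1..t2} (\<lambda>t. d * e t) \<le> V t2 - V t1"
  proof (rule increment_ge_integral[where G = G and B = "d * B"])
    show "(\<lambda>t. d * e t) integrable_on {t1..t2}" using e(1) by (rule integrable_on_mult_right)
    show "d * e t \<le> d * B" for t using d e(3) by (intro mult_left_mono) auto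
    show "\<exists>\<eta>>0. \<forall>t\<in>G. t1 \<le> t \<and> t \<le> t2 \<and> t2 - t < \<eta> \<longrightarrow> V t \<le> V t2 + \<epsilon>" if "\<epsilon> > 0" for \<epsilon>
    proof (intro exI[of _ \<eta>] conjI ballI impI \<eta>(1))
      fix t assume "t \<in> G" "t1 \<le> t \<and> t \<le> t2 \<and> t2 - t < \<eta>"
      then show "V t \<le> V t2 + \<epsilon>" using mono[of t t2] t(2) that by (cases "t = t2") auto
    qed
    show "\<exists>n \<eta>. \<eta> > 0 \<and> (\<forall>t. n t \<ge> 0) \<and> n integrable_on {t1..t2} \<and> integral {t1..t2} n \<le> \<epsilon> \<and>
       (\<forall>t\<in>G. \<forall>t'\<in>G. t1 \<le> t \<and> t < t' \<and> t' \<le> t2 \<and> t' - t < \<eta> \<longrightarrow>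
          V t' - V t \<ge> integral {t..t'} (\<lambda>t. d * e t) - integral {t..t'} n - (t' - t) * (n t' + \<epsilon>))" if "\<epsilon> > 0" for \<epsilon>
    proof (intro exI[of _ "\<lambda>_. 0"] exI[of _ \<eta>] conjI ballI impI \<eta>(1))
      fix t t' assume *: "t \<in> G" "t' \<in> G" "t1 \<le> t \<and> t < t' \<and> t' \<le> t2 \<and> t' - t < \<eta>"
      have "0 \<le> (t' - t) * (0 + \<epsilon>)" using * that by simp
      then show "V t' - V t \<ge> integral {t..t'} (\<lambda>t. d * e t) - integral {t..t'} (\<lambda>_. 0) - (t' - t) * (0 + \<epsilon>)"
        using step[of t t'] * by simp
    qed (use that in auto)
  qed (use t in auto)
  \<comment> \<open>Both end values are, up to a common sign, between 0 and
    \<open>h0 powr (1 - p)\<close>. The bound is therefore independent of how far \<open>H\<close>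
    travels.\<close>
  also have "V t2 - V t1 \<le> h0 powr (1 - p)"
  proof -
    have "0 \<le> H t powr (1 - p)" "H t powr (1 - p) \<le> h0 powr (1 - p)" if "t \<in> G" "t1 \<le> t" "t \<le> t2" for t
      using H[OF that] h0 p by (auto intro!: powr_mono2')
    from this[of t1] this[of t2] have "0 \<le> H t1 powr (1 - p)" "H t1 powr (1 - p) \<le> h0 powr (1 - p)"
      "0 \<le> H t2 powr (1 - p)" "H t2 powr (1 - p) \<le> h0 powr (1 - p)" using t by auto
    moreover have "V t2 - V t1 = H t1 powr (1 - p) - H t2 powr (1 - p) \<or> V t2 - V t1 = H t2 powr (1 - p) - H t1 powr (1 - p)"
      using \<sigma> by (auto simp: V_def)
    ultimately show ?thesis by linarith
  qed
  finally have "d * integral {t1..t2} e \<le> h0 powr (1 - p)" by simp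
  then have "integral {t1..t2} e \<le> h0 powr (1 - p) / d" using d by (simp add: field_simps)
  also have "\<dots> = 2 powr p / ((p - 1) * c) * h0 powr (1 - p)" by (simp add: d_def)
  finally show ?thesis .
qed

context log_supersolution
begin

definition mass :: real where "mass = (LINT x|lborel. \<psi> x powr p)"

definition vbar :: "real \<Rightarrow> real" where "vbar t = logmean t / mass"

lemma \<psi>_powr_integrable: "integrable lborel (\<lambda>x. \<psi> x powr p)"
proof (rule Bochner_Integration.integrable_bound[OF indicator_ball_integrable[of 1]])
  show "AE x in lborel. norm (\<psi> x powr p) \<le> norm (indicator (ball x0 r2) x * 1 :: real)"
    using \<psi>_powr_le by auto
qed measurable

lemma mass_ge: "measure lborel (ball x0 r) \<le> mass"
proof -
  have i: "integrable lborel (indicator (ball x0 r) :: 'a \<Rightarrow> real)"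
    using emeasure_lborel_ball_finite[of x0 r] by (intro integrable_real_indicator) auto
  have "measure lborel (ball x0 r) = (LINT x|lborel. indicator (ball x0 r) x)" by simp
  also have "\<dots> \<le> mass" unfolding mass_def
    using \<psi>_one by (intro Bochner_Integration.integral_mono i \<psi>_powr_integrable) (auto split: split_indicator)
  finally show ?thesis .
qed

lemma mass_pos: "mass > 0"
  using mass_ge content_ball_pos[OF r(1), of x0] by linarith

text \<open>Jensen's inequality in y: for x in \<open>S\<close>, where \<open>\<psi> x = 1\<close>,
  the weighted mean over y of the p-th power of ln u(x) - ln u(y) is at least
  \<open>H powr p\<close>, since ln u(x) is at distance at least \<open>H\<close> from the weighted
  mean of ln u. Integration over x in \<open>S\<close> then gives the measure of
  \<open>S\<close>.\<close>

lemma logenergy_ge_level: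
  assumes H: "H > 0" and \<sigma>: "\<sigma> = 1 \<or> \<sigma> = -1"
    and S [measurable]: "S \<in> sets borel" and Sr: "S \<subseteq> ball x0 r"
    and lev: "\<And>x. x \<in> S \<Longrightarrow> H \<le> \<sigma> * (ln (u x t) - vbar t)"
  shows "mass * H powr p * measure lborel S \<le> integral\<^sup>L lborel (logenergy (slice t))"
proof -
  define q where "q x = (LINT y|lborel. logenergy (slice t) (x, y))" for x
  have i: "integrable (lborel \<Otimes>\<^sub>M lborel) (logenergy (slice t))"
    using logenergy_integrable[OF slice_admissible] by (simp add: lborel_prod)
  have qi: "integrable lborel q" unfolding q_def by (rule lborel_pair.integrable_fst'[OF i])
  have eq: "integral\<^sup>L lborel (logenergy (slice t)) = integral\<^sup>L lborel q"
    unfolding q_def using lborel_pair.integral_fst'[OF i] by (simp add: lborel_prod)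
  have q0: "0 \<le> q x" for x
    unfolding q_def by (intro Bochner_Integration.integral_nonneg logenergy_bound slice_admissible)
  have qS: "mass * H powr p \<le> q x" if x: "x \<in> S" for x
  proof -
    have \<psi>x: "\<psi> x = 1" using x Sr \<psi>_one by auto
    have yi: "integrable lborel (\<lambda>y. logenergy (slice t) (x, y))"
    proof (rule Bochner_Integration.integrable_bound[OF indicator_ball_integrable[of "(ln M - ln \<rho>) powr p"]])
      show "AE y in lborel. norm (logenergy (slice t) (x, y)) \<le> norm (indicator (ball x0 r2) y * (ln M - ln \<rho>) powr p)"
      proof (intro AE_I2)
        fix y
        have "logenergy (slice t) (x, y) \<le> (ln M - ln \<rho>) powr p * (indicator (ball x0 r2) x * indicator (ball x0 r2) y)"
          using logenergy_bound(2)[OF slice_admissible[of t], of "(x, y)"] by (simp only: indicator_times fst_conv snd_conv)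
        also have "\<dots> \<le> (ln M - ln \<rho>) powr p * (1 * indicator (ball x0 r2) y)"
          by (intro mult_left_mono mult_right_mono) (auto split: split_indicator)
        finally show "norm (logenergy (slice t) (x, y)) \<le> norm (indicator (ball x0 r2) y * (ln M - ln \<rho>) powr p)"
          using logenergy_bound(1)[OF slice_admissible[of t], of "(x, y)"] by (simp add: mult.commute)
      qed
      show "(\<lambda>y. logenergy (slice t) (x, y)) \<in> borel_measurable lborel"
        unfolding logenergy_def slice_def prod.case by measurable
    qed
    have ti: "integrable lborel (\<lambda>y. (H powr p + p * H powr (p - 1) * (\<sigma> * ln (u x t) - H)) * \<psi> y powr p
         - p * H powr (p - 1) * \<sigma> * (\<psi> y powr p * ln (u y t)))"
      using \<psi>_powr_integrable ln_integrable[of t] by auto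
    \<comment> \<open>By \<open>lev\<close> the added tangent term is nonnegative. With it, the
      right side is the integral of an affine function of ln u(y) against
      \<open>\<psi> y powr p\<close>, ready for the pointwise tangent inequality.\<close>
    have "mass * H powr p \<le> mass * H powr p + p * H powr (p - 1) * (mass * (\<sigma> * (ln (u x t) - vbar t) - H))"
      using lev[OF x] p mass_pos by simp
    also have "\<dots> = (LINT y|lborel. (H powr p + p * H powr (p - 1) * (\<sigma> * ln (u x t) - H)) * \<psi> y powr p
         - p * H powr (p - 1) * \<sigma> * (\<psi> y powr p * ln (u y t)))"
    proof -
      have "mass * vbar t = logmean t" using mass_pos by (simp add: vbar_def)
      moreover have "(LINT y|lborel. (H powr p + p * H powr (p - 1) * (\<sigma> * ln (u x t) - H)) * \<psi> y powr p
         - p * H powr (p - 1) * \<sigma> * (\<psi> y powr p * ln (u y t)))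
        = (H powr p + p * H powr (p - 1) * (\<sigma> * ln (u x t) - H)) * mass - p * H powr (p - 1) * \<sigma> * logmean t"
        unfolding mass_def logmean_def using \<psi>_powr_integrable ln_integrable[of t] by simp
      ultimately show ?thesis by (simp add: algebra_simps)
    qed
    also have "\<dots> \<le> q x"
      unfolding q_def
    proof (intro Bochner_Integration.integral_mono ti yi)
      fix y
      have "H powr p + p * H powr (p - 1) * (\<sigma> * (ln (u x t) - ln (u y t)) - H) \<le> \<bar>\<sigma> * (ln (u x t) - ln (u y t))\<bar> powr p"
        using H p by (intro abs_powr_above_tangent) auto
      also have "\<bar>\<sigma> * (ln (u x t) - ln (u y t))\<bar> = \<bar>ln (u x t) - ln (u y t)\<bar>" using \<sigma> by (auto simp: abs_mult)
      finally have "(H powr p + p * H powr (p - 1) * (\<sigma> * (ln (u x t) - ln (u y t)) - H)) * \<psi> y powr p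
        \<le> \<bar>ln (u x t) - ln (u y t)\<bar> powr p * \<psi> y powr p" by (intro mult_right_mono) auto
      then show "(H powr p + p * H powr (p - 1) * (\<sigma> * ln (u x t) - H)) * \<psi> y powr p
         - p * H powr (p - 1) * \<sigma> * (\<psi> y powr p * ln (u y t)) \<le> logenergy (slice t) (x, y)"
        using \<psi>x by (simp add: logenergy_def slice_def algebra_simps)
    qed
    finally show ?thesis .
  qed
  have Sfin: "emeasure lborel S < \<infinity>"
    using emeasure_mono[OF Sr, of lborel] emeasure_lborel_ball_finite[of x0 r] by (auto intro: le_less_trans)
  have "mass * H powr p * measure lborel S = (LINT x|lborel. mass * H powr p * indicator S x)" by simp
  also have "\<dots> \<le> integral\<^sup>L lborel q"
  proof (intro Bochner_Integration.integral_mono qi)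
    show "integrable lborel (\<lambda>x. mass * H powr p * indicator S x)" using Sfin by (intro integrable_mult_right integrable_real_indicator) auto
  qed (use qS q0 in \<open>auto split: split_indicator\<close>)
  finally show ?thesis unfolding eq .
qed

text \<open>The coefficient of the energy in \<open>gain\<close>, divided by the p - 1 in front of
  \<open>logmean\<close>. The factor \<open>mass\<close> cancels between the level estimate and the
  normalisation of \<open>vbar\<close>, so \<open>rate\<close> does not depend on the shape of the
  cut-off.\<close>

definition rate :: real where "rate = inverse \<Lambda> / (2 * (3 * r) powr (real DIM('a) + p * s)) / (p - 1)"

lemma rate_pos: "rate > 0"
  using p \<Lambda> r by (simp add: rate_def)

text \<open>The sign \<sigma> covers superlevel and sublevel sets together. Points are taken from
  the inner ball, where \<open>\<psi>\<close> equals 1.\<close>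

definition level :: "real \<Rightarrow> real \<Rightarrow> real \<Rightarrow> real \<Rightarrow> 'a set" where
  "level \<sigma> \<mu> v \<tau> = {x \<in> ball x0 r. \<mu> < \<sigma> * (ln (u x \<tau>) - v)}"

lemma level_measurable [measurable]: "level \<sigma> \<mu> v \<tau> \<in> sets borel"
proof -
  have [measurable]: "ball x0 r \<in> sets borel" by simp
  show ?thesis unfolding level_def by measurable
qed

lemma level_set_measurable:
  "{z. fst z \<in> ball x0 r \<and> \<mu> < \<sigma> * (ln (u (fst z) (snd z)) - v)} \<in> sets (borel \<Otimes>\<^sub>M borel)"
proof -
  have [measurable]: "ball x0 r \<in> sets borel" by simp
  have "{z \<in> space (borel \<Otimes>\<^sub>M borel). fst z \<in> ball x0 r \<and> \<mu> < \<sigma> * (ln (u (fst z) (snd z)) - v)} \<in> sets (borel \<Otimes>\<^sub>M borel)"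
    by measurable
  then show ?thesis by (simp add: space_pair_measure)
qed

lemma measure_level_measurable [measurable]: "(\<lambda>\<tau>. measure lborel (level \<sigma> \<mu> v \<tau>)) \<in> borel_measurable borel"
proof -
  have "(\<lambda>\<tau>. emeasure lborel ((\<lambda>x. (x, \<tau>)) -` {z. fst z \<in> ball x0 r \<and> \<mu> < \<sigma> * (ln (u (fst z) (snd z)) - v)})) \<in> borel_measurable lborel"
    by (rule lborel_pair.measurable_emeasure_Pair2) (use level_set_measurable in simp)
  moreover have eq: "(\<lambda>x. (x, \<tau>)) -` {z. fst z \<in> ball x0 r \<and> \<mu> < \<sigma> * (ln (u (fst z) (snd z)) - v)} = level \<sigma> \<mu> v \<tau>" for \<tau>
    by (auto simp: level_def)
  ultimately have [measurable]: "(\<lambda>\<tau>. emeasure lborel (level \<sigma> \<mu> v \<tau>)) \<in> borel_measurable borel"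
    unfolding eq by simp
  show ?thesis unfolding measure_def by measurable
qed

lemma emeasure_level: "emeasure lborel (level \<sigma> \<mu> v \<tau>) = ennreal (measure lborel (level \<sigma> \<mu> v \<tau>))"
  and measure_level_le: "measure lborel (level \<sigma> \<mu> v \<tau>) \<le> measure lborel (ball x0 r)"
proof -
  have sub: "level \<sigma> \<mu> v \<tau> \<subseteq> ball x0 r" by (auto simp: level_def)
  have "emeasure lborel (level \<sigma> \<mu> v \<tau>) < \<infinity>"
    using emeasure_mono[OF sub, of lborel] emeasure_lborel_ball_finite[of x0 r] by (auto intro: le_less_trans)
  then show "emeasure lborel (level \<sigma> \<mu> v \<tau>) = ennreal (measure lborel (level \<sigma> \<mu> v \<tau>))"
    by (intro emeasure_eq_ennreal_measure) auto
  show "measure lborel (level \<sigma> \<mu> v \<tau>) \<le> measure lborel (ball x0 r)"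
    using emeasure_lborel_ball_finite[of x0 r] by (intro measure_mono_fmeasurable sub) (auto simp: fmeasurable_def)
qed

text \<open>The linear term \<open>D * t\<close> absorbs the cost of the cut-off. What remains has
  increments that dominate the integral of any \<open>e\<close> whose multiple
  \<open>mass * e\<close> stays below the energy.\<close>

lemma vbar_growth:
  assumes D: "(4 * (p - 1)) powr (p - 1) * \<Lambda> * integral\<^sup>L lborel cutenergy \<le> (p - 1) * mass * D"
    and t: "t \<in> G" "t' \<in> G" "t < t'"
    and L: "e integrable_on {t..t'}" "\<And>\<tau>. \<tau> \<in> G \<Longrightarrow> t \<le> \<tau> \<Longrightarrow> \<tau> \<le> t' \<Longrightarrow> mass * e \<tau> \<le> integral\<^sup>L lborel (logenergy (slice \<tau>))"
  shows "rate * integral {t..t'} e \<le> (vbar t' + D * t') - (vbar t + D * t)"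
proof -
  have sub: "{t..t'} \<subseteq> {ta..tb}" using t G by auto
  have neg: "negligible ({t..t'} - G)" using G(2) by (rule negligible_subset) (use sub in auto)
  \<comment> \<open>Off \<open>G\<close> the value turns the energy inequality into an equality. It
    then holds at every time, while the integral is unchanged.\<close>
  define e' where "e' \<tau> = (if \<tau> \<in> G then e \<tau> else integral\<^sup>L lborel (logenergy (slice \<tau>)) / mass)" for \<tau>
  have e': "e' integrable_on {t..t'}" "integral {t..t'} e' = integral {t..t'} e"
    using neg by (auto intro!: integrable_spike[OF L(1) neg] integral_spike[OF neg] simp: e'_def)
  have "integral {t..t'} (\<lambda>\<tau>. (p - 1) * mass * (rate * e' \<tau> - D)) \<le> integral {t..t'} gain"
  proof (rule integral_le)
    show "(\<lambda>\<tau>. (p - 1) * mass * (rate * e' \<tau> - D)) integrable_on {t..t'}"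
      using e'(1) by (intro integrable_on_mult_right integrable_diff) auto
    show "gain integrable_on {t..t'}" by (rule set_borel_integral_eq_integral(1)[OF gain_integrable])
    fix \<tau> assume \<tau>: "\<tau> \<in> {t..t'}"
    have "mass * e' \<tau> \<le> integral\<^sup>L lborel (logenergy (slice \<tau>))"
      using L(2)[of \<tau>] \<tau> mass_pos by (auto simp: e'_def)
    then have "((p - 1) * rate) * (mass * e' \<tau>) \<le> ((p - 1) * rate) * integral\<^sup>L lborel (logenergy (slice \<tau>))"
      using rate_pos p by (intro mult_left_mono) auto
    moreover have "(p - 1) * rate = inverse \<Lambda> / (2 * (3 * r) powr (real DIM('a) + p * s))"
      using p by (simp add: rate_def)
    moreover have "(p - 1) * mass * (rate * e' \<tau> - D) = ((p - 1) * rate) * (mass * e' \<tau>) - (p - 1) * mass * D"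
      by (simp add: algebra_simps)
    ultimately show "(p - 1) * mass * (rate * e' \<tau> - D) \<le> gain \<tau>"
      unfolding gain_def using D by (simp only:)
  qed
  also have "\<dots> \<le> (p - 1) * (logmean t' - logmean t)" by (rule logmean_growth[OF t])
  also have "\<dots> = (p - 1) * mass * (vbar t' - vbar t)" using mass_pos by (simp add: vbar_def right_diff_distrib)
  finally have "(p - 1) * mass * integral {t..t'} (\<lambda>\<tau>. rate * e' \<tau> - D) \<le> (p - 1) * mass * (vbar t' - vbar t)" by simp
  then have "integral {t..t'} (\<lambda>\<tau>. rate * e' \<tau> - D) \<le> vbar t' - vbar t" using p mass_pos by simp
  moreover have "integral {t..t'} (\<lambda>\<tau>. rate * e' \<tau> - D) = rate * integral {t..t'} e - D * (t' - t)"
  proof -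
    have "integral {t..t'} (\<lambda>\<tau>. rate * e' \<tau> - D) = integral {t..t'} (\<lambda>\<tau>. rate * e' \<tau>) - integral {t..t'} (\<lambda>\<tau>. D)"
      using e'(1) by (intro Henstock_Kurzweil_Integration.integral_diff integrable_on_mult_right) auto
    then show ?thesis using e' t by simp
  qed
  ultimately show ?thesis by (simp add: algebra_simps)
qed

lemma vbar_uniform:
  assumes "0 < e"
  shows "\<exists>\<eta>>0. \<forall>t\<in>G. \<forall>t'\<in>G. \<bar>t' - t\<bar> < \<eta> \<longrightarrow> \<bar>vbar t' - vbar t\<bar> \<le> e"
proof -
  obtain \<eta> where \<eta>: "\<eta> > 0" "\<And>t t'. t \<in> G \<Longrightarrow> t' \<in> G \<Longrightarrow> \<bar>t' - t\<bar> < \<eta> \<Longrightarrow> tdist t t' \<le> e * mass * \<rho>"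
    using time_continuous[of "e * mass * \<rho>"] assms mass_pos \<rho> unfolding tdist_def by auto
  have "\<bar>vbar t' - vbar t\<bar> \<le> e" if "t \<in> G" "t' \<in> G" "\<bar>t' - t\<bar> < \<eta>" for t t'
  proof -
    have "\<bar>logmean t' - logmean t\<bar> \<le> tdist t t' / \<rho>" by (rule logmean_lipschitz)
    also have "\<dots> \<le> e * mass" using \<eta>(2)[OF that] \<rho> by (simp add: field_simps)
    finally have "\<bar>logmean t' - logmean t\<bar> / mass \<le> e" using mass_pos by (simp add: field_simps)
    moreover have "\<bar>vbar t' - vbar t\<bar> = \<bar>logmean t' - logmean t\<bar> / mass"
      using mass_pos by (simp add: vbar_def diff_divide_distrib[symmetric])
    ultimately show ?thesis by simp
  qed
  then show ?thesis using \<eta>(1) by blast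
qed

text \<open>\<open>\<sigma> = 1\<close> is used for times before \<open>t0\<close> and \<open>\<sigma> = -1\<close> for times after \<open>t0\<close>. By the drift bound the
  distance of the level to the current mean is at least \<open>H\<close>, which grows away from \<open>t0\<close>.\<close>

lemma level_time_integral:
  assumes D: "(4 * (p - 1)) powr (p - 1) * \<Lambda> * integral\<^sup>L lborel cutenergy \<le> (p - 1) * mass * D" "0 \<le> D"
    and t0: "t0 \<in> G" and \<sigma>: "\<sigma> = 1 \<or> \<sigma> = -1"
    and ab: "a < b" "ta \<le> a" "b \<le> tb" and side: "\<And>t. a \<le> t \<Longrightarrow> t \<le> b \<Longrightarrow> 0 \<le> \<sigma> * (t0 - t) \<and> D * (\<sigma> * (t0 - t)) \<le> \<mu> / 2"
    and \<mu>: "\<mu> > 0"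
  shows "integral {a..b} (\<lambda>\<tau>. measure lborel (level \<sigma> \<mu> (vbar t0) \<tau>)) \<le> 2 powr p / ((p - 1) * rate) * (\<mu> / 2) powr (1 - p)"
proof -
  define e where "e \<tau> = measure lborel (level \<sigma> \<mu> (vbar t0) \<tau>)" for \<tau>
  \<comment> \<open>The drift-corrected mean is nondecreasing on \<open>G\<close> (fact
    \<open>Wmono\<close>), so its values at intermediate times lie between those at the
    ends.\<close>
  define W where "W t = vbar t + D * t" for t
  \<comment> \<open>Half of \<mu> is reserved for the drift accumulated between t and
    \<open>t0\<close>; the other half is the initial value of \<open>H\<close>.\<close>
  define H where "H t = \<mu> / 2 + \<sigma> * (W t0 - W t)" for t
  define Bd where "Bd = measure lborel (ball x0 r)"
  have e: "0 \<le> e \<tau>" "e \<tau> \<le> Bd" for \<tau> unfolding e_def Bd_def by (auto intro: measure_level_le)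
  have [measurable]: "e \<in> borel_measurable borel" unfolding e_def[abs_def] by measurable
  have ei: "e integrable_on {t..t'}" for t t'
    by (rule set_borel_integral_eq_integral(1)[OF set_integrable_bounded[where B = Bd]]) (use e in auto)
  have Wmono: "W t \<le> W t'" if "t \<in> G" "t' \<in> G" "t < t'" for t t'
    using vbar_growth[OF D(1) that, of "\<lambda>_. 0"] logenergy_bound(1)[OF slice_admissible] unfolding W_def by (simp add: integrable_0)
  have main: "integral {t1..t2} e \<le> 2 powr p / ((p - 1) * rate) * (\<mu> / 2) powr (1 - p)"
    if t12: "t1 \<in> G" "t2 \<in> G" "t1 < t2" "a \<le> t1" "t2 \<le> b" for t1 t2
  proof (rule integral_le_of_power_growth[where H = H and G = G and \<sigma> = "- \<sigma>" and B = Bd])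
    show "negligible ({t1..t2} - G)" using G(2) by (rule negligible_subset) (use t12 ab in auto)
    have Hge: "\<mu> / 2 \<le> H t" if "t \<in> G" "a \<le> t" "t \<le> b" for t
    proof -
      have "0 \<le> \<sigma> * (t0 - t)" using side that by blast
      then have "0 \<le> \<sigma> * (W t0 - W t)" using Wmono[of t t0] Wmono[of t0 t] that t0 \<sigma>
        by (cases "t = t0"; cases "t < t0") auto
      then show ?thesis by (simp add: H_def)
    qed
    then show "\<mu> / 2 \<le> H t" if "t \<in> G" "t1 \<le> t" "t \<le> t2" for t using that t12 by auto
    show "rate * min (H t) (H t') powr p * integral {t..t'} e \<le> - \<sigma> * (H t' - H t)"
      if t: "t \<in> G" "t' \<in> G" "t1 \<le> t" "t < t'" "t' \<le> t2" for t t'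
    proof -
      \<comment> \<open>As \<open>W\<close> is monotone, the smaller endpoint value bounds
        \<open>H\<close> from below at all good times between, so a single height serves in Jensen's
        inequality.\<close>
      define m where "m = min (H t) (H t')"
      have mpos: "m > 0" unfolding m_def using Hge[of t] Hge[of t'] t t12 \<mu> by auto
      have "rate * integral {t..t'} (\<lambda>\<tau>. m powr p * e \<tau>) \<le> W t' - W t"
        unfolding W_def
      proof (rule vbar_growth[OF D(1)])
        fix \<tau> assume \<tau>: "\<tau> \<in> G" "t \<le> \<tau>" "\<tau> \<le> t'"
        have mH: "m \<le> H \<tau>"
        proof -
          have "W t \<le> W \<tau>" "W \<tau> \<le> W t'"
            using Wmono[of t \<tau>] Wmono[of \<tau> t'] \<tau> t by (cases "t = \<tau>"; cases "\<tau> = t'"; auto)+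
          then show ?thesis using \<sigma> by (auto simp: m_def H_def)
        qed
        have "mass * m powr p * measure lborel (level \<sigma> \<mu> (vbar t0) \<tau>) \<le> integral\<^sup>L lborel (logenergy (slice \<tau>))"
        proof (rule logenergy_ge_level[OF mpos \<sigma> level_measurable])
          show "level \<sigma> \<mu> (vbar t0) \<tau> \<subseteq> ball x0 r" by (auto simp: level_def)
          fix x assume "x \<in> level \<sigma> \<mu> (vbar t0) \<tau>"
          then have x: "\<mu> < \<sigma> * (ln (u x \<tau>) - vbar t0)" by (simp add: level_def)
          have "D * (\<sigma> * (t0 - \<tau>)) \<le> \<mu> / 2" using side[of \<tau>] \<tau> t t12 by auto
          moreover have "\<sigma> * (ln (u x \<tau>) - vbar \<tau>) = \<sigma> * (ln (u x \<tau>) - vbar t0) + \<sigma> * (W t0 - W \<tau>) - D * (\<sigma> * (t0 - \<tau>))"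
            by (simp add: W_def algebra_simps)
          ultimately have "H \<tau> \<le> \<sigma> * (ln (u x \<tau>) - vbar \<tau>)" using x unfolding H_def by linarith
          then show "m \<le> \<sigma> * (ln (u x \<tau>) - vbar \<tau>)" using mH by simp
        qed
        then show "mass * (m powr p * e \<tau>) \<le> integral\<^sup>L lborel (logenergy (slice \<tau>))" by (simp add: e_def mult.assoc)
      qed (use t ei in \<open>auto intro: integrable_on_mult_right\<close>)
      moreover have "- \<sigma> * (H t' - H t) = W t' - W t" using \<sigma> by (auto simp: H_def)
      ultimately show ?thesis by (simp add: m_def mult.assoc)
    qed
    show "\<exists>\<eta>>0. \<forall>t\<in>G. \<forall>t'\<in>G. t1 \<le> t \<and> t < t' \<and> t' \<le> t2 \<and> t' - t < \<eta> \<longrightarrow> \<bar>H t' - H t\<bar> \<le> \<mu> / 2"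
    proof -
      obtain \<eta> where \<eta>: "\<eta> > 0" "\<And>t t'. t \<in> G \<Longrightarrow> t' \<in> G \<Longrightarrow> \<bar>t' - t\<bar> < \<eta> \<Longrightarrow> \<bar>vbar t' - vbar t\<bar> \<le> \<mu> / 4"
        using vbar_uniform[of "\<mu> / 4"] \<mu> by auto
      define \<eta>' where "\<eta>' = min \<eta> (\<mu> / 4 / (D + 1))"
      have "\<eta>' > 0" using \<eta>(1) \<mu> D(2) by (simp add: \<eta>'_def)
      moreover have "\<bar>H t' - H t\<bar> \<le> \<mu> / 2" if "t \<in> G" "t' \<in> G" "t < t'" "t' - t < \<eta>'" for t t'
      proof -
        have 1: "\<bar>vbar t' - vbar t\<bar> \<le> \<mu> / 4" using \<eta>(2)[of t t'] that by (auto simp: \<eta>'_def)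
        have "D * (t' - t) \<le> (D + 1) * (\<mu> / 4 / (D + 1))" using that D(2) by (intro mult_mono) (auto simp: \<eta>'_def)
        also have "(D + 1) * (k / (D + 1)) = k" for k using D(2) by simp
        finally have "D * (t' - t) \<le> \<mu> / 4" .
        moreover have "0 \<le> D * (t' - t)" using D(2) that by simp
        moreover have "\<bar>H t' - H t\<bar> = \<bar>(vbar t' - vbar t) + D * (t' - t)\<bar>"
          using \<sigma> by (auto simp: H_def W_def algebra_simps abs_if)
        ultimately show ?thesis using 1 by linarith
      qed
      ultimately show ?thesis by blast
    qed
  qed (use p rate_pos \<mu> \<sigma> t12 ei e in auto)
  \<comment> \<open>\<open>a\<close> and \<open>b\<close> may fail to be in \<open>G\<close>, so
    they are replaced by nearby good times. The two short end intervals cost at most \<epsilon>/2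
    each because \<open>e\<close> is bounded.\<close>
  have "integral {a..b} e \<le> 2 powr p / ((p - 1) * rate) * (\<mu> / 2) powr (1 - p) + \<epsilon>" if \<epsilon>: "\<epsilon> > 0" for \<epsilon>
  proof -
    have Bd0: "0 \<le> Bd" by (simp add: Bd_def)
    define \<eta> where "\<eta> = min ((b - a) / 2) (\<epsilon> / 2 / (Bd + 1))"
    have "\<eta> > 0" using ab \<epsilon> Bd0 by (simp add: \<eta>_def)
    moreover have "\<eta> \<le> (b - a) / 2" "\<eta> \<le> \<epsilon> / 2 / (Bd + 1)" unfolding \<eta>_def by (rule min.cobounded1 min.cobounded2)+
    ultimately have \<eta>: "\<eta> > 0" "\<eta> \<le> (b - a) / 2" "\<eta> \<le> \<epsilon> / 2 / (Bd + 1)" by blast+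
    have Bd\<eta>: "Bd * \<eta> \<le> \<epsilon> / 2"
    proof -
      have "Bd * \<eta> \<le> (Bd + 1) * (\<epsilon> / 2 / (Bd + 1))" using \<eta> Bd0 \<epsilon> by (intro mult_mono) auto
      also have "(Bd + 1) * (k / (Bd + 1)) = k" for k using Bd0 by simp
      finally show ?thesis .
    qed
    have neg: "negligible ({c..d} - G)" if "ta \<le> c" "d \<le> tb" for c d
      using G(2) by (rule negligible_subset) (use that in auto)
    obtain t1 where t1: "t1 \<in> G" "a \<le> t1" "t1 < a + \<eta>"
      using ex_le_average[of "\<lambda>_. 0" a "a + \<eta>" G 1] neg[of a "a + \<eta>"] \<eta> ab by (auto simp: integrable_0)
    obtain t2 where t2: "t2 \<in> G" "b - \<eta> \<le> t2" "t2 < b"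
      using ex_le_average[of "\<lambda>_. 0" "b - \<eta>" b G 1] neg[of "b - \<eta>" b] \<eta> ab by (auto simp: integrable_0)
    have "2 * \<eta> \<le> b - a" using \<eta>(2) by simp
    then have lt: "t1 < t2" using t1(3) t2(2) by linarith
    have sm: "integral {c..d} e \<le> \<epsilon> / 2" if "c \<le> d" "d - c \<le> \<eta>" for c d
    proof -
      have "integral {c..d} e \<le> integral {c..d} (\<lambda>_. Bd)"
        using e by (intro integral_le ei integrable_const_ivl) auto
      also have "\<dots> = Bd * (d - c)" using that by simp
      also have "\<dots> \<le> Bd * \<eta>" using that Bd0 by (intro mult_left_mono) auto
      finally show ?thesis using Bd\<eta> by linarith
    qed
    have "integral {a..b} e = integral {a..t1} e + integral {t1..b} e"
      using t1 t2 lt by (intro Henstock_Kurzweil_Integration.integral_combine[symmetric] ei) auto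
    also have "integral {t1..b} e = integral {t1..t2} e + integral {t2..b} e"
      using t2 lt by (intro Henstock_Kurzweil_Integration.integral_combine[symmetric] ei) auto
    finally show ?thesis using main[OF t1(1) t2(1) lt t1(2)] t2 sm[of a t1] sm[of t2 b] t1 by linarith
  qed
  then show ?thesis unfolding e_def[symmetric] by (rule field_le_epsilon)
qed

text \<open>The drift accumulated in the time \<open>r powr (p * s)\<close>. Here \<open>A\<close>
  is the constant of the truncated kernel, the 2 beside it counts the two points of a pair, and the
  power of 3/2 compares the volumes of the support ball and the inner ball.\<close>

definition drift :: "real \<Rightarrow> real" where
  "drift A = (4 * (p - 1)) powr (p - 1) * \<Lambda> * (2 * A) * (3 / 2) ^ DIM('a) / (p - 1)"

text \<open>The first summand serves the levels from twice the drift upwards, the second those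
  below.\<close>

definition level_const :: "real \<Rightarrow> real" where
  "level_const A = 2 powr (p + 1) * \<Lambda> * 3 powr (real DIM('a) + p * s) * 2 powr (p - 1)
     + unit_ball_vol (real DIM('a)) * (2 * drift A) powr (p - 1)"

text \<open>The power of \<open>r\<close> has two sources that agree: the reciprocal of
  \<open>rate\<close> is a multiple of r^(n+ps), and so is the volume of the cylinder. Slicing in
  time turns the bound for the integral of the level measures into a bound in space-time.\<close>

lemma level_set_bound:
  assumes A: "(\<integral>\<^sup>+z. ennreal (min 1 ((C0 * norm z / r) powr p) / norm z powr (real DIM('a) + p * s))
      \<partial>(lborel :: 'a measure)) \<le> ennreal (A * r powr - (p * s))" and A0: "A > 0"
    and t0: "t0 \<in> G" and \<sigma>: "\<sigma> = 1 \<or> \<sigma> = -1" and \<mu>: "\<mu> > 0"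
    and ab: "b = a + r powr (p * s)" "ta \<le> a" "b \<le> tb" and side: "\<sigma> = 1 \<Longrightarrow> b = t0" "\<sigma> = -1 \<Longrightarrow> a = t0"
  shows "{(x, t). x \<in> ball x0 r \<and> a < t \<and> t < b \<and> \<mu> < \<sigma> * (ln (u x t) - vbar t0)} \<in> sets borel"
    and "emeasure lborel {(x, t). x \<in> ball x0 r \<and> a < t \<and> t < b \<and> \<mu> < \<sigma> * (ln (u x t) - vbar t0)}
    \<le> ennreal (level_const A * r powr (real DIM('a) + p * s) / \<mu> powr (p - 1))"
proof -
  define R where "R = r powr (p * s)"
  define n where "n = real DIM('a)"
  define Bd where "Bd = measure lborel (ball x0 r)"
  define \<omega> where "\<omega> = unit_ball_vol n"
  define e where "e \<tau> = measure lborel (level \<sigma> \<mu> (vbar t0) \<tau>)" for \<tau>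
  have R: "R > 0" "b = a + R" using r ab by (auto simp: R_def)
  have \<omega>: "\<omega> > 0" by (simp add: \<omega>_def n_def)
  have Bd: "Bd = \<omega> * r powr n" using r by (simp add: Bd_def content_ball \<omega>_def n_def powr_realpow)
  have dr: "drift A > 0" using p \<Lambda> A0 by (simp add: drift_def)
  have e: "0 \<le> e \<tau>" "e \<tau> \<le> Bd" for \<tau> unfolding e_def Bd_def by (auto intro: measure_level_le)
  have [measurable]: "e \<in> borel_measurable borel" unfolding e_def[abs_def] by measurable
  have sei: "set_integrable lborel {a..b} e" by (rule set_integrable_bounded[where B = Bd]) (use e in auto)
  have ei: "e integrable_on {a..b}" by (rule set_borel_integral_eq_integral(1)[OF sei])
  have rn: "r powr (n + p * s) = r powr n * R" by (simp add: R_def powr_add)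
  have int: "integral {a..b} e \<le> level_const A * r powr (n + p * s) / \<mu> powr (p - 1)"
  proof (cases "\<mu> < 2 * drift A")
    case True
    have "integral {a..b} e \<le> integral {a..b} (\<lambda>_. Bd)"
      using e by (intro integral_le ei integrable_const_ivl) auto
    also have "\<dots> = \<omega> * r powr (n + p * s) * 1" using R by (simp add: Bd rn)
    also have "\<dots> \<le> \<omega> * r powr (n + p * s) * ((2 * drift A) powr (p - 1) / \<mu> powr (p - 1))"
    proof (intro mult_left_mono)
      show "1 \<le> (2 * drift A) powr (p - 1) / \<mu> powr (p - 1)"
        using True \<mu> p by (subst pos_le_divide_eq) (auto intro!: powr_mono2)
    qed (use \<omega> in auto)
    also have "\<dots> = (\<omega> * (2 * drift A) powr (p - 1)) * r powr (n + p * s) / \<mu> powr (p - 1)" by simp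
    also have "\<dots> \<le> level_const A * r powr (n + p * s) / \<mu> powr (p - 1)"
      using \<Lambda> by (intro divide_right_mono mult_right_mono) (auto simp: level_const_def \<omega>_def n_def)
    finally show ?thesis .
  next
    case False
    define D where "D = drift A * r powr - (p * s)"
    have D0: "0 \<le> D" using dr by (simp add: D_def)
    have DR: "D * R = drift A" using r by (simp add: D_def R_def powr_minus)
    have "integral {a..b} e \<le> 2 powr p / ((p - 1) * rate) * (\<mu> / 2) powr (1 - p)"
      unfolding e_def
    proof (rule level_time_integral[OF _ D0 t0 \<sigma> _ ab(2,3) _ \<mu>])
      \<comment> \<open>\<open>mass\<close> is at least the volume of the inner ball. Dividing the
        cut-off energy by it leaves a number in which the particular cut-off no longer
        appears.\<close>
      have "measure lborel (ball x0 (3 * r / 2)) = (3 / 2) ^ DIM('a) * Bd"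
        using r by (simp add: Bd_def content_ball power_mult_distrib power_divide field_simps)
      also have "\<dots> \<le> (3 / 2) ^ DIM('a) * mass" using mass_ge by (intro mult_left_mono) (auto simp: Bd_def)
      finally have mb: "measure lborel (ball x0 (3 * r / 2)) \<le> (3 / 2) ^ DIM('a) * mass" .
      have "integral\<^sup>L lborel cutenergy \<le> 2 * A * r powr - (p * s) * measure lborel (ball x0 (3 * r / 2))"
        by (rule cutenergy_bound(2)[OF A A0])
      also have "\<dots> \<le> 2 * A * r powr - (p * s) * ((3 / 2) ^ DIM('a) * mass)"
        using A0 by (intro mult_left_mono mb) auto
      finally have "(4 * (p - 1)) powr (p - 1) * \<Lambda> * integral\<^sup>L lborel cutenergy
        \<le> (4 * (p - 1)) powr (p - 1) * \<Lambda> * (2 * A * r powr - (p * s) * ((3 / 2) ^ DIM('a) * mass))"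
        using \<Lambda> by (intro mult_left_mono) auto
      also have "\<dots> = (p - 1) * mass * D" using p by (simp add: D_def drift_def)
      finally show "(4 * (p - 1)) powr (p - 1) * \<Lambda> * integral\<^sup>L lborel cutenergy \<le> (p - 1) * mass * D" .
      show "a < b" using R by simp
      fix t assume t: "a \<le> t" "t \<le> b"
      have *: "0 \<le> \<sigma> * (t0 - t)" "\<sigma> * (t0 - t) \<le> R" using \<sigma> side t R by auto
      have "D * (\<sigma> * (t0 - t)) \<le> D * R" by (intro mult_left_mono * D0)
      then show "0 \<le> \<sigma> * (t0 - t) \<and> D * (\<sigma> * (t0 - t)) \<le> \<mu> / 2" using * False DR by auto
    qed
    also have "\<dots> = (2 powr (p + 1) * \<Lambda> * 3 powr (n + p * s) * 2 powr (p - 1)) * r powr (n + p * s) / \<mu> powr (p - 1)"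
    proof -
      have "1 / ((p - 1) * rate) = 2 * \<Lambda> * (3 * r) powr (n + p * s)"
        using p \<Lambda> by (simp add: rate_def n_def field_simps)
      then have 1: "2 powr p / ((p - 1) * rate) = 2 powr p * (2 * \<Lambda> * (3 * r) powr (n + p * s))"
        by (metis mult.right_neutral times_divide_eq_right)
      have 2: "(\<mu> / 2) powr (1 - p) = 2 powr (p - 1) / \<mu> powr (p - 1)"
        using powr_minus_divide[of "\<mu> / 2" "p - 1"] by (simp add: powr_divide)
      show ?thesis unfolding 1 2 by (simp add: powr_mult powr_add mult_ac)
    qed
    also have "\<dots> \<le> level_const A * r powr (n + p * s) / \<mu> powr (p - 1)"
      using \<omega> by (intro divide_right_mono mult_right_mono) (auto simp: level_const_def \<omega>_def n_def)
    finally show ?thesis .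
  qed
  define Z where "Z = {(x, t). x \<in> ball x0 r \<and> a < t \<and> t < b \<and> \<mu> < \<sigma> * (ln (u x t) - vbar t0)}"
  have Zm: "Z \<in> sets (lborel \<Otimes>\<^sub>M lborel)"
  proof -
    have [measurable]: "ball x0 r \<in> sets borel" by simp
    have "{z \<in> space (borel \<Otimes>\<^sub>M borel). fst z \<in> ball x0 r \<and> a < snd z \<and> snd z < b \<and> \<mu> < \<sigma> * (ln (u (fst z) (snd z)) - vbar t0)}
      \<in> sets (borel \<Otimes>\<^sub>M borel)" by measurable
    also have "{z \<in> space (borel \<Otimes>\<^sub>M borel). fst z \<in> ball x0 r \<and> a < snd z \<and> snd z < b \<and> \<mu> < \<sigma> * (ln (u (fst z) (snd z)) - vbar t0)} = Z"
      by (auto simp: Z_def space_pair_measure)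
    finally show ?thesis by simp
  qed
  have "emeasure lborel Z = emeasure (lborel \<Otimes>\<^sub>M lborel) Z" by (simp add: lborel_prod)
  also have "\<dots> = (\<integral>\<^sup>+\<tau>. emeasure lborel ((\<lambda>x. (x, \<tau>)) -` Z) \<partial>lborel)"
    by (rule lborel_pair.emeasure_pair_measure_alt2[OF Zm])
  also have "\<dots> \<le> (\<integral>\<^sup>+\<tau>. ennreal (indicator {a..b} \<tau> *\<^sub>R e \<tau>) \<partial>lborel)"
  proof (rule nn_integral_mono)
    fix \<tau>
    show "emeasure lborel ((\<lambda>x. (x, \<tau>)) -` Z) \<le> ennreal (indicator {a..b} \<tau> *\<^sub>R e \<tau>)"
    proof (cases "\<tau> \<in> {a..b}")
      case True
      have "emeasure lborel ((\<lambda>x. (x, \<tau>)) -` Z) \<le> emeasure lborel (level \<sigma> \<mu> (vbar t0) \<tau>)"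
        by (intro emeasure_mono) (auto simp: Z_def level_def)
      then show ?thesis using True by (simp add: e_def emeasure_level)
    next
      case False
      then have "(\<lambda>x. (x, \<tau>)) -` Z = {}" by (auto simp: Z_def)
      then show ?thesis by simp
    qed
  qed
  also have "\<dots> = ennreal (LINT \<tau>|lborel. indicator {a..b} \<tau> *\<^sub>R e \<tau>)"
    using sei e by (intro nn_integral_eq_integral) (auto simp: set_integrable_def)
  also have "(LINT \<tau>|lborel. indicator {a..b} \<tau> *\<^sub>R e \<tau>) = integral {a..b} e"
    using set_borel_integral_eq_integral(2)[OF sei] by (simp add: set_lebesgue_integral_def)
  also have "ennreal (integral {a..b} e) \<le> ennreal (level_const A * r powr (n + p * s) / \<mu> powr (p - 1))"
    by (intro ennreal_leI int)
  finally show "emeasure lborel {(x, t). x \<in> ball x0 r \<and> a < t \<and> t < b \<and> \<mu> < \<sigma> * (ln (u x t) - vbar t0)}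
    \<le> ennreal (level_const A * r powr (real DIM('a) + p * s) / \<mu> powr (p - 1))" by (simp add: Z_def n_def)
  show "{(x, t). x \<in> ball x0 r \<and> a < t \<and> t < b \<and> \<mu> < \<sigma> * (ln (u x t) - vbar t0)} \<in> sets borel"
    using Zm unfolding Z_def lborel_prod by simp
qed

end

section \<open>Reduction to Borel representatives\<close>

lemma borel_measurable_completion_AE:
  assumes g: "g \<in> borel_measurable M" and ae: "AE x in M. f x = g x"
  shows "f \<in> borel_measurable (completion M)"
proof -
  obtain N where N: "N \<in> null_sets M" "{x \<in> space M. \<not> f x = g x} \<subseteq> N"
    using ae by (auto elim!: AE_E intro: null_setsI)
  show ?thesis
  proof (rule measurableI)
    fix A :: "'b set" assume A: "A \<in> sets borel"
    have "f -` A \<inter> space M \<inter> N \<in> null_sets (completion M)"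
      using N(1) by (intro null_sets_completion_subset[OF _ null_sets_completionI[OF N(1)]]) auto
    moreover have "g -` A \<inter> space M - N \<in> sets (completion M)"
      using measurable_sets[OF g A] N(1) by auto
    moreover have "f -` A \<inter> space M = (g -` A \<inter> space M - N) \<union> (f -` A \<inter> space M \<inter> N)"
      using N(2) by auto
    ultimately show "f -` A \<inter> space (completion M) \<in> sets (completion M)"
      by (metis null_setsD2 sets.Un space_completion)
  qed simp
qed

text \<open>Measurability is known for the representative \<open>g\<close>; completeness of the
  measure transfers it to \<open>f\<close>. Lebesgue integrals of the given data become Borel
  integrals in this way throughout.\<close>

lemma integral_completion_AE:
  fixes f g :: "'a \<Rightarrow> real"
  assumes g: "g \<in> borel_measurable M" and ae: "AE x in M. f x = g x"
  shows "integral\<^sup>L (completion M) f = integral\<^sup>L M g"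
proof -
  have "integral\<^sup>L (completion M) f = integral\<^sup>L (completion M) g"
    using borel_measurable_completion_AE[OF g ae] measurable_completion[OF g] AE_completion[OF ae]
    by (intro integral_cong_AE) auto
  then show ?thesis using integral_completion[OF g] by simp
qed

lemma ex_borel_representative:
  fixes f :: "'a::euclidean_space \<Rightarrow> real"
  assumes "f \<in> borel_measurable (lebesgue_on S)" "S \<in> sets lebesgue"
  obtains g where "g \<in> borel_measurable borel" "AE x in lborel. x \<in> S \<longrightarrow> f x = g x"
proof -
  have "(\<lambda>x. indicator S x *\<^sub>R f x) \<in> borel_measurable lebesgue"
    using assms by (subst (asm) borel_measurable_restrict_space_iff) auto
  then obtain g where g: "g \<in> borel_measurable lborel" "AE x in lborel. indicator S x *\<^sub>R f x = g x"
    using completion_ex_borel_measurable_real by blast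
  from g(2) have "AE x in lborel. x \<in> S \<longrightarrow> f x = g x" by eventually_elim auto
  then show ?thesis using that g(1) by simp
qed

lemma AE_lebesgue_on_iff:
  "S \<in> sets lebesgue \<Longrightarrow> (AE x in lebesgue_on S. P x) \<longleftrightarrow> (AE x in lborel. x \<in> S \<longrightarrow> P x)"
  by (subst AE_restrict_space_iff) (auto simp: AE_completion_iff)

text \<open>\<open>P\<close> is arbitrary, so its exceptional set is first enlarged to a Borel null
  set, to which Tonelli applies.\<close>

lemma AE_lborel_swap:
  assumes "AE z in (lborel :: ('a::euclidean_space \<times> 'b::euclidean_space) measure). P z"
  shows "AE t in lborel. AE x in lborel. P (x, t)"
proof -
  obtain N where N: "N \<in> null_sets (lborel :: ('a \<times> 'b) measure)" "{z. \<not> P z} \<subseteq> N"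
    using assms by (auto elim!: AE_E simp: null_sets_def)
  have "AE z in lborel \<Otimes>\<^sub>M lborel. (fst z, snd z) \<notin> N"
    unfolding lborel_prod prod.collapse using N(1) by (rule AE_not_in)
  moreover have "N \<in> sets (lborel \<Otimes>\<^sub>M lborel)" unfolding lborel_prod using N(1) by (rule null_setsD2)
  then have "{z \<in> space (lborel \<Otimes>\<^sub>M lborel). (fst z, snd z) \<notin> N} \<in> sets (lborel \<Otimes>\<^sub>M lborel)"
    by (simp only: prod.collapse set_diff_eq[symmetric] sets.compl_sets)
  ultimately have "AE t in lborel. AE x in lborel. (x, t) \<notin> N"
    using lborel_pair.AE_commute[where P = "\<lambda>x t. (x, t) \<notin> N"] lborel_pair.AE_pair_iff[where P = "\<lambda>x t. (x, t) \<notin> N"]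
    by blast
  then show ?thesis
  proof eventually_elim
    case (elim t)
    then show ?case by eventually_elim (use N(2) in auto)
  qed
qed

text \<open>In this direction a Borel set is required: null sections alone do not determine the
  measure of a set that may be nonmeasurable.\<close>

lemma AE_lborel_unswap:
  fixes P :: "'a::euclidean_space \<times> 'b::euclidean_space \<Rightarrow> bool"
  assumes P: "{z. P z} \<in> sets borel" and ae: "AE t in lborel. AE x in lborel. P (x, t)"
  shows "AE z in lborel. P z"
proof -
  have m: "{z \<in> space (lborel \<Otimes>\<^sub>M lborel). P (fst z, snd z)} \<in> sets (lborel \<Otimes>\<^sub>M lborel)"
    unfolding lborel_prod using P by simp
  then have "AE z in lborel \<Otimes>\<^sub>M lborel. P (fst z, snd z)"
    using ae lborel_pair.AE_commute[where P = "\<lambda>x t. P (x, t)"] lborel_pair.AE_pair_iff[where P = "\<lambda>x t. P (x, t)"]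
    by blast
  then show ?thesis unfolding lborel_prod by simp
qed

text \<open>The gradient bound is given on the ball only, but the function vanishes near every point
  off its support. A gradient bounded by \<open>C0 / r\<close> thus exists on the whole space, which
  is convex, and the mean value inequality applies to any two points.\<close>

lemma cutoff_lipschitz:
  fixes x0 :: "'a::euclidean_space"
  assumes c: "cutoff C0 x0 r \<psi>" and r: "r > 0" and C0: "C0 > 0"
  shows "\<bar>\<psi> x - \<psi> y\<bar> \<le> C0 / r * norm (x - y)" "continuous_on UNIV \<psi>" "x \<notin> ball x0 (3 * r / 2) \<Longrightarrow> \<psi> x = 0"
proof -
  define S where "S = closure {x. \<psi> x \<noteq> 0}"
  have S: "closed S" "S \<subseteq> ball x0 (3 * r / 2)" using c by (auto simp: S_def cutoff_def test_function_def)
  have zero: "\<psi> x = 0" if "x \<notin> S" for x using that closure_subset[of "{x. \<psi> x \<noteq> 0}"] by (auto simp: S_def)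
  then show "\<psi> x = 0" if "x \<notin> ball x0 (3 * r / 2)" using that S by blast
  have "\<exists>g. (\<psi> has_derivative (\<lambda>h. h \<bullet> g)) (at x) \<and> norm g \<le> C0 / r" for x
  proof (cases "x \<in> ball x0 (3 * r / 2)")
    case True
    then show ?thesis using c unfolding cutoff_def gderiv_def by blast
  next
    case False
    then have "x \<in> - S" using S by auto
    have "(\<psi> has_derivative (\<lambda>h. 0)) (at x)"
      by (rule has_derivative_transform_within_open[OF has_derivative_const[of 0], of "- S"])
         (use \<open>x \<in> - S\<close> S zero in auto)
    then show ?thesis using r C0 by (intro exI[of _ 0]) simp
  qed
  then obtain g where g: "\<And>x. (\<psi> has_derivative (\<lambda>h. h \<bullet> g x)) (at x)" "\<And>x. norm (g x) \<le> C0 / r" by metis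
  show "continuous_on UNIV \<psi>"
    by (intro continuous_at_imp_continuous_on ballI has_derivative_continuous[OF g(1)])
  have "norm (\<psi> x - \<psi> y) \<le> C0 / r * norm (x - y)"
  proof (rule differentiable_bound[of UNIV \<psi> "\<lambda>x h. h \<bullet> g x"])
    fix z
    show "(\<psi> has_derivative (\<lambda>h. h \<bullet> g z)) (at z within UNIV)" using g(1) by simp
    show "onorm (\<lambda>h. h \<bullet> g z) \<le> C0 / r"
    proof (rule onorm_le)
      fix h
      have "norm (h \<bullet> g z) \<le> norm h * norm (g z)" by (simp add: Cauchy_Schwarz_ineq2)
      also have "\<dots> \<le> norm h * (C0 / r)" by (intro mult_left_mono g) auto
      finally show "norm (h \<bullet> g z) \<le> C0 / r * norm h" by (simp add: mult.commute)
    qed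
  qed auto
  then show "\<bar>\<psi> x - \<psi> y\<bar> \<le> C0 / r * norm (x - y)" by simp
qed

text \<open>The compact support has a point farthest from the centre; the midpoint between its
  distance and 3r/2 is the radius.\<close>

lemma cutoff_support:
  fixes x0 :: "'a::euclidean_space"
  assumes c: "cutoff C0 x0 r \<psi>" and r: "r > 0"
  obtains r1 where "0 < r1" "r1 < 3 * r / 2" "\<And>x. x \<notin> ball x0 r1 \<Longrightarrow> \<psi> x = 0"
proof -
  define S where "S = closure {x. \<psi> x \<noteq> 0}"
  have S: "compact S" "S \<subseteq> ball x0 (3 * r / 2)" using c by (auto simp: S_def cutoff_def test_function_def)
  have zero: "\<psi> x = 0" if "x \<notin> S" for x using that closure_subset[of "{x. \<psi> x \<noteq> 0}"] by (auto simp: S_def)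
  have "\<psi> x0 = 1" using c r by (auto simp: cutoff_def)
  then have "S \<noteq> {}" using zero by force
  moreover have "continuous_on S (dist x0)" by (intro continuous_intros)
  ultimately obtain z where z: "z \<in> S" "\<And>y. y \<in> S \<Longrightarrow> dist x0 y \<le> dist x0 z"
    using continuous_attains_sup[OF S(1)] by blast
  have dz: "dist x0 z < 3 * r / 2" using z S by auto
  show ?thesis
  proof (rule that[of "(dist x0 z + 3 * r / 2) / 2"])
    show "0 < (dist x0 z + 3 * r / 2) / 2" using r by (simp add: add_nonneg_pos)
    show "(dist x0 z + 3 * r / 2) / 2 < 3 * r / 2" using dz by simp
    fix x assume "x \<notin> ball x0 ((dist x0 z + 3 * r / 2) / 2)"
    then have "dist x0 z < dist x0 x" using dz by simp
    then have "x \<notin> S" using z(2) by force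
    then show "\<psi> x = 0" by (rule zero)
  qed
qed

lemma cutoff_regionI:
  fixes x0 :: "'a::euclidean_space"
  assumes c: "cutoff C0 x0 r \<psi>" and "r > 0" "C0 > 0" "2 < p" "0 < s" "s < 1" "1 \<le> \<Lambda>" "0 < \<rho>" "\<rho> \<le> M"
  obtains r1 r2 where "cutoff_region p s \<Lambda> C0 r r1 r2 \<rho> M x0 \<psi>" "r2 < 3 * r / 2"
proof -
  obtain r1 where r1: "0 < r1" "r1 < 3 * r / 2" "\<And>x. x \<notin> ball x0 r1 \<Longrightarrow> \<psi> x = 0"
    using cutoff_support[OF c \<open>r > 0\<close>] by blast
  note L = cutoff_lipschitz[OF c \<open>r > 0\<close> \<open>C0 > 0\<close>]
  have range: "0 \<le> \<psi> x \<and> \<psi> x \<le> 1" for x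
    using L(3)[of x] c by (cases "x \<in> ball x0 (3 * r / 2)") (auto simp: cutoff_def)
  have lip: "\<bar>\<psi> x - \<psi> y\<bar> \<le> min 1 (C0 * norm (x - y) / r)" for x y
    using L(1)[of x y] range[of x] range[of y] by (auto simp: abs_le_iff)
  \<comment> \<open>\<open>r2\<close> is again a midpoint. Being strictly below 3r/2, it keeps the
    closed ball inside the larger ball that lies in the domain.\<close>
  have "cutoff_region p s \<Lambda> C0 r r1 ((r1 + 3 * r / 2) / 2) \<rho> M x0 \<psi>"
    using assms r1 range lip borel_measurable_continuous_onI[OF L(2)]
    by unfold_locales (auto simp: cutoff_def)
  moreover have "(r1 + 3 * r / 2) / 2 < 3 * r / 2" using r1 by simp
  ultimately show ?thesis by (rule that)
qed

text \<open>The fundamental theorem of calculus for a function vanishing at both ends. It expresses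
  that a function constant in time has weak time derivative 0.\<close>

lemma deriv_test_function_integral:
  assumes \<eta>: "test_function {0<..<T} \<eta>" and T: "T > 0"
  shows "(LINT t:{0<..<T}|lebesgue. c * deriv \<eta> t) = 0"
proof -
  have "Ck_on (Suc (Suc 0)) UNIV \<eta>" using \<eta> unfolding test_function_def smooth_on_def by blast
  then have "\<exists>f'. (\<forall>x\<in>UNIV. (\<eta> has_derivative f' x) (at x)) \<and> (\<forall>v. Ck_on (Suc 0) UNIV (\<lambda>x. f' x v))"
    by (simp only: Ck_on.simps(2))
  then obtain f' where f': "\<And>x. (\<eta> has_derivative f' x) (at x)" "Ck_on (Suc 0) UNIV (\<lambda>x. f' x 1)"
    by blast
  have d: "(\<eta> has_real_derivative f' t 1) (at t)" for t
  proof -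
    have "bounded_linear (f' t)" using f'(1) has_derivative_bounded_linear by blast
    then have "f' t h = f' t 1 * h" for h
      using linear_scale[OF bounded_linear.linear, of "f' t" h 1] by (simp add: mult.commute)
    then have "f' t = (*) (f' t 1)" by (rule ext)
    with f'(1)[of t] show ?thesis unfolding has_field_derivative_def by simp
  qed
  have cont: "continuous_on UNIV (\<lambda>t. f' t 1)"
  proof -
    obtain g where "\<And>x. ((\<lambda>x. f' x 1) has_derivative g x) (at x)" using f'(2) by auto
    then show ?thesis by (intro continuous_at_imp_continuous_on ballI has_derivative_continuous)
  qed
  have zero: "\<eta> t = 0" if "t \<notin> {0<..<T}" for t
    using \<eta> that closure_subset[of "{x. \<eta> x \<noteq> 0}"] unfolding test_function_def by blast
  have meas: "(\<lambda>t. f' t 1) \<in> borel_measurable borel" by (rule borel_measurable_continuous_onI[OF cont])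
  have hi: "((\<lambda>t. f' t 1) has_integral (\<eta> T - \<eta> 0)) {0..T}"
    using T d by (intro fundamental_theorem_of_calculus)
      (auto simp: has_real_derivative_iff_has_vector_derivative[symmetric] intro: has_field_derivative_at_within)
  have si: "set_integrable lborel {0..T} (\<lambda>t. f' t 1)"
    by (rule borel_integrable_atLeastAtMost') (rule continuous_on_subset[OF cont], simp)
  have "(LINT t:{0<..<T}|lebesgue. c * deriv \<eta> t) = (LINT t|lborel. c * (indicator {0..T} t *\<^sub>R f' t 1))"
    unfolding set_lebesgue_integral_def
  proof (rule integral_completion_AE)
    have "AE t in lborel. t \<noteq> 0 \<and> t \<noteq> T" using AE_lborel_singleton[of 0] AE_lborel_singleton[of T] by eventually_elim auto
    then show "AE t in lborel. indicator {0<..<T} t *\<^sub>R (c * deriv \<eta> t) = c * (indicator {0..T} t *\<^sub>R f' t 1)"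
      by eventually_elim (auto simp: DERIV_imp_deriv[OF d] split: split_indicator)
  qed (use meas in measurable)
  also have "\<dots> = c * integral {0..T} (\<lambda>t. f' t 1)"
    using set_borel_integral_eq_integral(2)[OF si] by (simp add: set_lebesgue_integral_def)
  also have "\<dots> = 0" using hi zero[of 0] zero[of T] by (simp add: integral_unique)
  finally show ?thesis .
qed

lemma compactly_inside_ball:
  assumes "r2 < R" "ball x0 R \<subseteq> \<Omega>"
  shows "compactly_inside (ball x0 r2) \<Omega>"
proof -
  have "closure (ball x0 r2) \<subseteq> cball x0 r2" by (rule closure_minimal) auto
  also have "\<dots> \<subseteq> ball x0 R" using assms by auto
  finally show ?thesis using assms by (auto simp: compactly_inside_def compact_closure)
qed

text \<open>For a test function that does not depend on time the parabolic regularity requirements reduce to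
  membership in \<open>W\<^sub>0\<^sup>s\<^sup>,\<^sup>p\<close>.\<close>

lemma weak_supersolution_stationary_test:
  fixes \<phi> :: "'a::euclidean_space \<Rightarrow> real"
  assumes u: "weak_supersolution s p T \<Omega> K u" and U: "compactly_inside U \<Omega>"
    and t: "0 < t1" "t1 < t2" "t2 < T"
    and \<phi>: "\<phi> \<in> borel_measurable borel" "\<And>x. 0 \<le> \<phi> x" "\<phi> \<in> Wsp0 s p U"
  shows "(LINT x:U|lebesgue. u x t2 powr (p - 1) * \<phi> x) - (LINT x:U|lebesgue. u x t1 powr (p - 1) * \<phi> x)
        + (LINT t:{t1..t2}|lebesgue. (LINT y|lebesgue. (LINT x|lebesgue.
             \<bar>u x t - u y t\<bar> powr (p - 2) * (u x t - u y t) * (\<phi> x - \<phi> y) * K x y t))) \<ge> 0"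
proof -
  have T: "T > 0" using t by simp
  have Uo: "open U" using U by (simp add: compactly_inside_def)
  have W: "\<phi> \<in> Lp p UNIV" "Wsp_pow s p UNIV \<phi> < \<infinity>" using \<phi>(3) by (auto simp: Wsp0_def Wsp_def)
  have mono: "Lp_pow p U \<phi> \<le> Lp_pow p UNIV \<phi>"
    unfolding Lp_pow_def by (intro nn_integral_mono mult_left_mono) (auto split: split_indicator)
  have fin: "Lp_pow p U \<phi> < \<infinity>" using W(1) mono by (auto simp: Lp_def intro: le_less_trans)
  have mu: "\<phi> \<in> borel_measurable (lebesgue_on U)"
    using \<phi>(1) by (intro measurable_restrict_space1 measurable_completion) simp
  have joint: "(\<lambda>(x, t). \<phi> x) \<in> borel_measurable (lebesgue_on (D \<times> {0<..<T}))" for D :: "'a set"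
  proof (intro measurable_restrict_space1 measurable_completion)
    have "(\<lambda>z::'a \<times> real. \<phi> (fst z)) \<in> borel_measurable (borel \<Otimes>\<^sub>M borel)" using \<phi>(1) by measurable
    then show "(\<lambda>(x, t). \<phi> x) \<in> borel_measurable (lborel :: ('a \<times> real) measure)"
      by (simp add: borel_prod split_beta')
  qed
  have \<phi>U: "\<phi> \<in> Lp p U" using fin mu by (simp add: Lp_def)
  have 0: "(\<lambda>_. 0) \<in> Lp p U" by (simp add: Lp_def Lp_pow_def)
  have const_fin: "(\<integral>\<^sup>+t\<in>{a..b}. c \<partial>lebesgue) < \<infinity>" if "c < \<infinity>" for a b :: real and c :: ennreal
    using that by (simp add: nn_integral_completion nn_integral_cmult_indicator ennreal_mult_less_top emeasure_lborel_Icc_eq)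
  have 1: "W1p_loc_time T p U (\<lambda>x t. \<phi> x) (\<lambda>x t. 0)"
    unfolding W1p_loc_time_def
  proof (intro conjI)
    show "(\<lambda>x t. \<phi> x) \<in> Lp_loc_time T U (Lp p U) (Lp_pow p U)"
      using joint const_fin[OF fin] \<phi>U by (simp add: Lp_loc_time_def)
    show "(\<lambda>x t. 0) \<in> Lp_loc_time T U (Lp p U) (Lp_pow p U)"
      using 0 by (simp add: Lp_loc_time_def Lp_pow_def)
    show "weak_time_derivative T U (\<lambda>x t. \<phi> x) (\<lambda>x t. 0)"
      using T by (simp add: weak_time_derivative_def deriv_test_function_integral[where c = 1, simplified] set_lebesgue_integral_def[of _ _ "\<lambda>_. 0"])
    show "(\<lambda>x t. \<phi> x) \<in> Cont_time_Lp T p U"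
      using \<phi>U by (simp add: Cont_time_Lp_def Lp_pow_def)
  qed
  have 2: "(\<lambda>x t. \<phi> x) \<in> Lp_loc_time T UNIV (Wsp0 s p U) (Wsp_pow s p UNIV)"
    using joint[of UNIV] const_fin[OF W(2)] \<phi>(3) by (simp add: Lp_loc_time_def)
  have "(LINT x:U|lebesgue. u x t2 powr (p - 1) * \<phi> x)
        - (LINT x:U|lebesgue. u x t1 powr (p - 1) * \<phi> x)
        - (LINT t:{t1..t2}|lebesgue. (LINT x:U|lebesgue. u x t powr (p - 1) * 0))
        + (LINT t:{t1..t2}|lebesgue. (LINT y|lebesgue. (LINT x|lebesgue.
             \<bar>u x t - u y t\<bar> powr (p - 2) * (u x t - u y t) * (\<phi> x - \<phi> y) * K x y t))) \<ge> 0"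
    using u U t 1 2 \<phi>(2) unfolding weak_supersolution_def by (elim conjE) (drule spec, drule spec, drule spec, drule spec, drule spec, auto)
  then show ?thesis by (simp add: set_lebesgue_integral_def)
qed

section \<open>Continuity in time with values in L^p\<close>

lemma Lp_pow_triangle:
  fixes f g h :: "'a::euclidean_space \<Rightarrow> real"
  assumes "p \<ge> 0" and U: "U \<in> sets lebesgue"
    and [measurable]: "f \<in> borel_measurable (lebesgue_on U)" "g \<in> borel_measurable (lebesgue_on U)" "h \<in> borel_measurable (lebesgue_on U)"
  shows "Lp_pow p U (\<lambda>x. f x - g x) \<le> ennreal (2 powr p) * (Lp_pow p U (\<lambda>x. f x - h x) + Lp_pow p U (\<lambda>x. g x - h x))"
proof -
  have eq: "Lp_pow p U k = (\<integral>\<^sup>+x. ennreal (\<bar>k x\<bar> powr p) \<partial>lebesgue_on U)" for k :: "'a \<Rightarrow> real"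
    unfolding Lp_pow_def using U by (simp add: nn_integral_restrict_space)
  have "Lp_pow p U (\<lambda>x. f x - g x) \<le> (\<integral>\<^sup>+x. ennreal (2 powr p) * (ennreal (\<bar>f x - h x\<bar> powr p) + ennreal (\<bar>g x - h x\<bar> powr p)) \<partial>lebesgue_on U)"
    unfolding eq
  proof (rule nn_integral_mono)
    fix x
    have "\<bar>f x - g x\<bar> powr p \<le> (\<bar>f x - h x\<bar> + \<bar>g x - h x\<bar>) powr p" using assms(1) by (intro powr_mono2) auto
    also have "\<dots> \<le> 2 powr p * (\<bar>f x - h x\<bar> powr p + \<bar>g x - h x\<bar> powr p)" using assms(1) by (intro powr_sum_le) auto
    finally show "ennreal (\<bar>f x - g x\<bar> powr p) \<le> ennreal (2 powr p) * (ennreal (\<bar>f x - h x\<bar> powr p) + ennreal (\<bar>g x - h x\<bar> powr p))"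
      by (simp add: ennreal_mult[symmetric] ennreal_plus[symmetric] ennreal_leI del: ennreal_plus)
  qed
  also have "\<dots> = ennreal (2 powr p) * (Lp_pow p U (\<lambda>x. f x - h x) + Lp_pow p U (\<lambda>x. g x - h x))"
    unfolding eq by (subst nn_integral_cmult, measurable) (subst nn_integral_add, auto)
  finally show ?thesis .
qed

text \<open>The Heine-Cantor argument: a Lebesgue number of the cover by balls of continuity puts
  two nearby times into one ball, and both slices are compared with the one at its centre.\<close>

lemma Cont_time_Lp_uniform:
  fixes u :: "'a::euclidean_space \<Rightarrow> real \<Rightarrow> real"
  assumes u: "u \<in> Cont_time_Lp T p U" and "p \<ge> 0" and U: "U \<in> sets lebesgue"
    and ab: "0 < ta" "tb < T" and \<kappa>: "\<kappa> > 0"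
  shows "\<exists>\<eta>>0. \<forall>t\<in>{ta..tb}. \<forall>t'\<in>{ta..tb}. \<bar>t' - t\<bar> < \<eta> \<longrightarrow> Lp_pow p U (\<lambda>x. u x t' - u x t) \<le> ennreal \<kappa>"
proof -
  \<comment> \<open>Halved for the two comparisons and divided by the constant of the quasi-triangle
    inequality for p-th powers.\<close>
  define \<kappa>' where "\<kappa>' = \<kappa> / (2 * 2 powr p)"
  have \<kappa>': "\<kappa>' > 0" "2 powr p * (\<kappa>' + \<kappa>') = \<kappa>" using \<kappa> by (auto simp: \<kappa>'_def)
  have meas: "(\<lambda>x. u x t) \<in> borel_measurable (lebesgue_on U)" if "t \<in> {ta..tb}" for t
    using u that ab by (auto simp: Cont_time_Lp_def Lp_def)
  have "\<exists>d>0. \<forall>\<tau>. dist \<tau> t < d \<longrightarrow> Lp_pow p U (\<lambda>x. u x \<tau> - u x t) < ennreal \<kappa>'" if "t \<in> {ta..tb}" for t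
  proof -
    have "((\<lambda>\<tau>. Lp_pow p U (\<lambda>x. u x \<tau> - u x t)) \<longlongrightarrow> 0) (at t)"
      using u that ab by (auto simp: Cont_time_Lp_def)
    then have "eventually (\<lambda>\<tau>. Lp_pow p U (\<lambda>x. u x \<tau> - u x t) < ennreal \<kappa>') (at t)"
      using \<kappa>'(1) by (intro order_tendstoD) auto
    then obtain d where d: "d > 0" "\<And>\<tau>. \<tau> \<noteq> t \<Longrightarrow> dist \<tau> t < d \<Longrightarrow> Lp_pow p U (\<lambda>x. u x \<tau> - u x t) < ennreal \<kappa>'"
      unfolding eventually_at by auto
    have "Lp_pow p U (\<lambda>x. u x t - u x t) < ennreal \<kappa>'" using \<kappa>' by (simp add: Lp_pow_def)
    then show ?thesis using d by metis
  qed
  then have "\<forall>t\<in>{ta..tb}. \<exists>d. d > 0 \<and> (\<forall>\<tau>. dist \<tau> t < d \<longrightarrow> Lp_pow p U (\<lambda>x. u x \<tau> - u x t) < ennreal \<kappa>')" by blast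
  from bchoice[OF this] obtain d where d': "\<forall>t\<in>{ta..tb}. d t > 0 \<and> (\<forall>\<tau>. dist \<tau> t < d t \<longrightarrow> Lp_pow p U (\<lambda>x. u x \<tau> - u x t) < ennreal \<kappa>')" ..
  have d: "d t > 0" "dist \<tau> t < d t \<Longrightarrow> Lp_pow p U (\<lambda>x. u x \<tau> - u x t) < ennreal \<kappa>'" if "t \<in> {ta..tb}" for t \<tau>
    using bspec[OF d' that] by auto
  obtain \<eta> where \<eta>: "\<eta> > 0" "\<And>t. t \<in> {ta..tb} \<Longrightarrow> \<exists>B\<in>(\<lambda>t. ball t (d t)) ` {ta..tb}. ball t \<eta> \<subseteq> B"
  proof (rule Heine_Borel_lemma[of "{ta..tb}" "(\<lambda>t. ball t (d t)) ` {ta..tb}"])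
    show "{ta..tb} \<subseteq> \<Union> ((\<lambda>t. ball t (d t)) ` {ta..tb})"
    proof
      fix t assume "t \<in> {ta..tb}"
      then show "t \<in> \<Union> ((\<lambda>t. ball t (d t)) ` {ta..tb})" using d(1) by (intro UN_I[of t]) simp_all
    qed
  qed (use that in auto)
  have "Lp_pow p U (\<lambda>x. u x t' - u x t) \<le> ennreal \<kappa>" if t: "t \<in> {ta..tb}" "t' \<in> {ta..tb}" "\<bar>t' - t\<bar> < \<eta>" for t t'
  proof -
    obtain c where c: "c \<in> {ta..tb}" "ball t \<eta> \<subseteq> ball c (d c)" using \<eta>(2)[OF t(1)] by auto
    have "t \<in> ball t \<eta>" "t' \<in> ball t \<eta>" using \<eta>(1) t(3) by (auto simp: dist_real_def)
    then have "t \<in> ball c (d c)" "t' \<in> ball c (d c)" using c(2) by (blast intro: subsetD)+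
    then have "dist t c < d c" "dist t' c < d c" by (simp_all add: dist_commute)
    then have le: "Lp_pow p U (\<lambda>x. u x t' - u x c) \<le> ennreal \<kappa>'" "Lp_pow p U (\<lambda>x. u x t - u x c) \<le> ennreal \<kappa>'"
      using d(2)[OF c(1)] by (auto intro: less_imp_le)
    have "Lp_pow p U (\<lambda>x. u x t' - u x t) \<le> ennreal (2 powr p) * (Lp_pow p U (\<lambda>x. u x t' - u x c) + Lp_pow p U (\<lambda>x. u x t - u x c))"
      by (rule Lp_pow_triangle[OF assms(2) U meas[OF t(2)] meas[OF t(1)] meas[OF c(1)]])
    also have "\<dots> \<le> ennreal (2 powr p) * (ennreal \<kappa>' + ennreal \<kappa>')" by (intro mult_left_mono add_mono le) auto
    also have "\<dots> = ennreal \<kappa>" using \<kappa>' by (simp add: ennreal_mult[symmetric] ennreal_plus[symmetric] del: ennreal_plus)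
    finally show ?thesis .
  qed
  then show ?thesis using \<eta>(1) by blast
qed

lemma Lp_pow_cong_AE:
  "(AE x in lborel. x \<in> U \<longrightarrow> f x = g x) \<Longrightarrow> Lp_pow p U f = (\<integral>\<^sup>+x. ennreal (\<bar>g x\<bar> powr p) * indicator U x \<partial>lborel)"
  unfolding Lp_pow_def nn_integral_completion
  by (intro nn_integral_cong_AE) (auto elim!: eventually_mono split: split_indicator)

lemma AE_lborel_ex_in_interval:
  fixes a b :: real
  assumes "AE t in lborel. P t" "a < b"
  obtains t where "a < t" "t < b" "P t"
proof (rule ccontr)
  assume *: "\<not> thesis"
  have "AE t in lborel. t \<notin> {a<..<b}" using assms(1) by eventually_elim (use that * in auto)
  then have "{a<..<b} \<in> null_sets lborel" using AE_iff_null_sets[of "{a<..<b}" lborel] by (simp del: greaterThanLessThan_iff)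
  then have "emeasure lborel {a<..<b} = 0" by (rule null_setsD1)
  then show False using assms(2) by simp
qed

text \<open>A single time is a null set, so bounds at almost every time say nothing about
  \<open>t0\<close> directly. But the distance of u(t0) from [\<rho>, M] is pointwise at most its
  distance from any slice with values there, and such slices converge to u(t0) in L^p.\<close>

lemma Cont_time_Lp_bounds:
  fixes u :: "'a::euclidean_space \<Rightarrow> real \<Rightarrow> real"
  assumes u: "u \<in> Cont_time_Lp T p U" and "p > 0" "U \<in> sets borel"
    and t0: "ta < t0" "t0 < tb" "0 < ta" "tb < T"
    and b: "AE \<tau> in lborel. \<tau> \<in> {ta<..<tb} \<longrightarrow> (AE x in lborel. x \<in> U \<longrightarrow> \<rho> \<le> u x \<tau> \<and> u x \<tau> \<le> M)"
  shows "AE x in lborel. x \<in> U \<longrightarrow> \<rho> \<le> u x t0 \<and> u x t0 \<le> M"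
proof -
  have Ul: "U \<in> sets lebesgue" using assms(3) by auto
  have "(\<lambda>x. u x t0) \<in> borel_measurable (lebesgue_on U)" using u t0 by (auto simp: Cont_time_Lp_def Lp_def)
  then obtain c where [measurable]: "c \<in> borel_measurable borel" and c: "AE x in lborel. x \<in> U \<longrightarrow> u x t0 = c x"
    using ex_borel_representative[OF _ Ul] by blast
  define e where "e x = max 0 (max (\<rho> - c x) (c x - M))" for x
  have [measurable]: "e \<in> borel_measurable borel" unfolding e_def[abs_def] by measurable
  define J where "J = (\<integral>\<^sup>+x. ennreal (e x powr p) * indicator U x \<partial>lborel)"
  have J: "J \<le> ennreal \<epsilon>" if \<epsilon>: "\<epsilon> > 0" for \<epsilon>
  proof -
    have "((\<lambda>\<tau>. Lp_pow p U (\<lambda>x. u x \<tau> - u x t0)) \<longlongrightarrow> 0) (at t0)"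
      using u t0 by (auto simp: Cont_time_Lp_def)
    then have "eventually (\<lambda>\<tau>. Lp_pow p U (\<lambda>x. u x \<tau> - u x t0) < ennreal \<epsilon>) (at t0)"
      using \<epsilon> by (intro order_tendstoD) auto
    then obtain d where d: "d > 0" "\<And>\<tau>. \<tau> \<noteq> t0 \<Longrightarrow> dist \<tau> t0 < d \<Longrightarrow> Lp_pow p U (\<lambda>x. u x \<tau> - u x t0) < ennreal \<epsilon>"
      unfolding eventually_at by auto
    obtain \<tau> where \<tau>: "t0 < \<tau>" "\<tau> < min tb (t0 + d)" "\<tau> \<in> {ta<..<tb} \<longrightarrow> (AE x in lborel. x \<in> U \<longrightarrow> \<rho> \<le> u x \<tau> \<and> u x \<tau> \<le> M)"
      using AE_lborel_ex_in_interval[OF b, of t0 "min tb (t0 + d)"] t0 d(1) by auto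
    have b\<tau>: "AE x in lborel. x \<in> U \<longrightarrow> \<rho> \<le> u x \<tau> \<and> u x \<tau> \<le> M" using \<tau> t0 by auto
    have "J \<le> Lp_pow p U (\<lambda>x. u x \<tau> - u x t0)"
      unfolding J_def Lp_pow_def nn_integral_completion
    proof (rule nn_integral_mono_AE)
      show "AE x in lborel. ennreal (e x powr p) * indicator U x \<le> ennreal (\<bar>u x \<tau> - u x t0\<bar> powr p) * indicator U x"
        using b\<tau> c
      proof eventually_elim
        case (elim x)
        show ?case
        proof (cases "x \<in> U")
          case True
          then have "e x \<le> \<bar>u x \<tau> - u x t0\<bar>" using elim by (auto simp: e_def)
          moreover have "0 \<le> e x" by (simp add: e_def)
          ultimately have "e x powr p \<le> \<bar>u x \<tau> - u x t0\<bar> powr p" using assms(2) by (intro powr_mono2) auto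
          then show ?thesis by (simp add: ennreal_leI mult_right_mono)
        qed simp
      qed
    qed
    also have "\<dots> < ennreal \<epsilon>" using \<tau> by (intro d(2)) (auto simp: dist_real_def)
    finally show ?thesis by simp
  qed
  have "J \<le> 0"
  proof (rule ennreal_le_epsilon)
    fix e :: real assume "0 < e"
    then show "J \<le> 0 + ennreal e" using J[of e] by simp
  qed
  then have "J = 0" by simp
  moreover have "(\<lambda>x. ennreal (e x powr p) * indicator U x) \<in> borel_measurable lborel" using assms(3) by measurable
  ultimately have "AE x in lborel. ennreal (e x powr p) * indicator U x = 0"
    unfolding J_def by (simp add: nn_integral_0_iff_AE)
  then show ?thesis using c
  proof eventually_elim
    case (elim x)
    show ?case
    proof
      assume x: "x \<in> U"
      then have "e x = 0" using elim by (simp add: ennreal_eq_0_iff)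
      then have "\<rho> - c x \<le> 0" "c x - M \<le> 0" unfolding e_def by linarith+
      then show "\<rho> \<le> u x t0 \<and> u x t0 \<le> M" using elim x by simp
    qed
  qed
qed

text \<open>Where |d| is at most \<epsilon> it is bounded by \<epsilon>; elsewhere |d| is at most
  \<epsilon>^(1-p) |d|^p. This splitting takes the place of Hoelder's inequality.\<close>

lemma integral_le_Lp_pow:
  fixes d :: "'a \<Rightarrow> real"
  assumes [measurable]: "d \<in> borel_measurable M" "U \<in> sets M" and "p \<ge> 1" and \<epsilon>: "\<epsilon> > 0" and "\<kappa> \<ge> 0" and U: "emeasure M U < \<infinity>"
    and le: "(\<integral>\<^sup>+x. ennreal (\<bar>d x\<bar> powr p) * indicator U x \<partial>M) \<le> ennreal \<kappa>"
  shows "(LINT x|M. indicator U x * \<bar>d x\<bar>) \<le> \<epsilon> * measure M U + \<epsilon> powr (1 - p) * \<kappa>"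
proof (rule integral_le_of_nn_integral_le(2))
  have pw: "indicator U x * \<bar>d x\<bar> \<le> \<epsilon> * indicator U x + \<epsilon> powr (1 - p) * (\<bar>d x\<bar> powr p * indicator U x)" for x
  proof (cases "x \<in> U \<and> \<epsilon> < \<bar>d x\<bar>")
    case True
    have "\<bar>d x\<bar> = \<bar>d x\<bar> powr (1 - p) * \<bar>d x\<bar> powr p" using True \<epsilon> by (simp add: powr_add[symmetric])
    also have "\<dots> \<le> \<epsilon> powr (1 - p) * \<bar>d x\<bar> powr p" using True \<epsilon> \<open>p \<ge> 1\<close> by (intro mult_right_mono powr_mono2') auto
    finally show ?thesis using True \<epsilon> by simp
  next
    case False
    then show ?thesis using \<epsilon> by (auto split: split_indicator simp: add_increasing2)
  qed
  have "(\<integral>\<^sup>+x. ennreal (indicator U x * \<bar>d x\<bar>) \<partial>M) \<le> (\<integral>\<^sup>+x. ennreal \<epsilon> * indicator U x + ennreal (\<epsilon> powr (1 - p)) * (ennreal (\<bar>d x\<bar> powr p) * indicator U x) \<partial>M)"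
  proof (rule nn_integral_mono)
    fix x
    have "ennreal (\<epsilon> * indicator U x + \<epsilon> powr (1 - p) * (\<bar>d x\<bar> powr p * indicator U x))
      = ennreal \<epsilon> * indicator U x + ennreal (\<epsilon> powr (1 - p)) * (ennreal (\<bar>d x\<bar> powr p) * indicator U x)"
      using \<epsilon> by (cases "x \<in> U") (simp_all add: ennreal_mult)
    then show "ennreal (indicator U x * \<bar>d x\<bar>) \<le> ennreal \<epsilon> * indicator U x + ennreal (\<epsilon> powr (1 - p)) * (ennreal (\<bar>d x\<bar> powr p) * indicator U x)"
      using ennreal_leI[OF pw[of x]] by simp
  qed
  also have "\<dots> = ennreal \<epsilon> * emeasure M U + ennreal (\<epsilon> powr (1 - p)) * (\<integral>\<^sup>+x. ennreal (\<bar>d x\<bar> powr p) * indicator U x \<partial>M)"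
    by (subst nn_integral_add) (auto simp: nn_integral_cmult nn_integral_cmult_indicator)
  also have "\<dots> \<le> ennreal \<epsilon> * ennreal (measure M U) + ennreal (\<epsilon> powr (1 - p)) * ennreal \<kappa>"
    using le U by (intro add_mono mult_left_mono) (auto simp: emeasure_eq_ennreal_measure)
  also have "\<dots> = ennreal (\<epsilon> * measure M U + \<epsilon> powr (1 - p) * \<kappa>)"
    using \<epsilon> \<open>\<kappa> \<ge> 0\<close> by (simp add: ennreal_mult)
  finally show "(\<integral>\<^sup>+x. ennreal (indicator U x * \<bar>d x\<bar>) \<partial>M) \<le> ennreal (\<epsilon> * measure M U + \<epsilon> powr (1 - p) * \<kappa>)" .
qed (use assms in auto)

section \<open>The test function and the near energy in terms of fractional Sobolev norms\<close>

context cutoff_region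
begin

lemma double_integral_lborel:
  fixes q :: "'a \<Rightarrow> 'a \<Rightarrow> ennreal"
  assumes "(\<lambda>(x, y). q x y) \<in> borel_measurable (borel \<Otimes>\<^sub>M borel)"
  shows "(\<integral>\<^sup>+x. (\<integral>\<^sup>+y. q x y \<partial>lborel) \<partial>lborel) = (\<integral>\<^sup>+z. q (fst z) (snd z) \<partial>lborel)"
proof -
  have m: "(\<lambda>z. q (fst z) (snd z)) \<in> borel_measurable (lborel \<Otimes>\<^sub>M lborel)" using assms by (simp add: split_beta')
  show ?thesis using lborel.nn_integral_fst[OF m] by (simp add: lborel_prod)
qed

lemma kern_eq: "d / norm (x - y) powr (real DIM('a) + s * p) = d * kern x y"
  by (simp add: kern_def mult.commute)

text \<open>Near the diagonal the increments of \<open>g\<close> and \<open>\<psi>\<close> carry the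
  energy; away from it the kernel is integrable and the test function bounded. The constant
  \<open>c\<close> joins \<open>lip powr p\<close> and the factor of
  \<open>powr_sum_le\<close>.\<close>

lemma logtest_Wsp0:
  assumes g: "admissible g" and fin: "(\<integral>\<^sup>+z. near (r2 - r1) g z \<partial>lborel) < \<infinity>"
  shows "logtest g \<in> Wsp0 s p (ball x0 r2)"
proof -
  note [measurable] = admissibleD(1)[OF g]
  define h where "h x = logtest g x powr p" for x
  define c where "c = (2 * lip) powr p"
  have hle: "h x \<le> indicator (ball x0 r2) x * (\<rho> powr (1 - p)) powr p" for x
    unfolding h_def using powr_mono2[OF _ logtest_nonneg logtest_le[OF g, of x], of p] p by (auto split: split_indicator_asm split_indicator)
  have hi: "integrable lborel h"
  proof (rule Bochner_Integration.integrable_bound[OF indicator_ball_integrable[of "(\<rho> powr (1 - p)) powr p"]])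
    show "h \<in> borel_measurable lborel" unfolding h_def by measurable
    show "AE x in lborel. norm (h x) \<le> norm (indicator (ball x0 r2) x * (\<rho> powr (1 - p)) powr p)"
      using hle by (auto simp: h_def)
  qed
  have fari: "integrable lborel (far (r2 - r1) h)"
    using far_integral r hi by (metis diff_gt_0_iff_gt h_def powr_ge_zero)
  have ni: "integrable lborel (near (r2 - r1) g)" by (rule near_integrable[OF admissibleD(1)[OF g] fin])
  define D where "D z = c * near (r2 - r1) g z + far (r2 - r1) h z" for z
  have Di: "integrable lborel D" unfolding D_def using ni fari by auto
  have D0: "0 \<le> D z" for z unfolding D_def c_def using far_nonneg[of h] by (simp add: h_def)
  have le: "\<bar>logtest g x - logtest g y\<bar> powr p * kern x y \<le> D (x, y)" for x y
  proof (cases "r2 - r1 \<le> norm (x - y)")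
    case True
    have "\<bar>logtest g x - logtest g y\<bar> powr p \<le> max (logtest g x) (logtest g y) powr p"
      using logtest_nonneg[of g x] logtest_nonneg[of g y] p by (intro powr_mono2) (auto simp del: logtest_nonneg)
    also have "\<dots> \<le> h x + h y" by (auto simp: h_def max_def)
    finally have "\<bar>logtest g x - logtest g y\<bar> powr p * kern x y \<le> (h x + h y) * kern x y" by (intro mult_right_mono) auto
    also have "\<dots> = far (r2 - r1) h (x, y)" using True by (simp add: far_def mult.commute)
    also have "\<dots> \<le> D (x, y)" by (simp add: D_def c_def)
    finally show ?thesis .
  next
    case False
    show ?thesis
    proof (cases "x \<in> ball x0 r2 \<and> y \<in> ball x0 r2")
      case True
      have "\<bar>logtest g x - logtest g y\<bar> powr p \<le> (lip * (\<bar>g x - g y\<bar> + \<bar>\<psi> x - \<psi> y\<bar>)) powr p"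
        using logtest_diff[OF g] p by (intro powr_mono2) auto
      also have "\<dots> = lip powr p * (\<bar>g x - g y\<bar> + \<bar>\<psi> x - \<psi> y\<bar>) powr p" by (simp add: powr_mult)
      also have "\<dots> \<le> lip powr p * (2 powr p * (\<bar>g x - g y\<bar> powr p + \<bar>\<psi> x - \<psi> y\<bar> powr p))"
        using p by (intro mult_left_mono powr_sum_le) auto
      also have "\<dots> = c * (\<bar>g x - g y\<bar> powr p + \<bar>\<psi> x - \<psi> y\<bar> powr p)" by (simp add: c_def powr_mult)
      finally have "\<bar>logtest g x - logtest g y\<bar> powr p * kern x y \<le> c * (\<bar>g x - g y\<bar> powr p + \<bar>\<psi> x - \<psi> y\<bar> powr p) * kern x y"
        by (intro mult_right_mono) auto
      also have "\<dots> = c * near (r2 - r1) g (x, y)" using True False by (simp add: near_def)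
      also have "\<dots> \<le> D (x, y)" using far_nonneg[of h "r2 - r1" "(x, y)"] by (simp add: D_def h_def)
      finally show ?thesis .
    next
      case F: False
      then have "logtest g x = 0" "logtest g y = 0" using logtest_close[of x y g] False by auto
      then show ?thesis using D0[of "(x, y)"] p by simp
    qed
  qed
  have lpfin: "Lp_pow p UNIV (logtest g) < \<infinity>"
  proof -
    have "Lp_pow p UNIV (logtest g) = (\<integral>\<^sup>+x. ennreal (h x) \<partial>lborel)"
      by (simp add: Lp_pow_def nn_integral_completion h_def)
    also have "\<dots> = ennreal (integral\<^sup>L lborel h)" by (rule nn_integral_eq_integral[OF hi]) (simp add: h_def)
    finally show ?thesis by simp
  qed
  have "(\<integral>\<^sup>+x\<in>UNIV. (\<integral>\<^sup>+y\<in>UNIV. ennreal (\<bar>logtest g x - logtest g y\<bar> powr p / norm (x - y) powr (real DIM('a) + s * p)) \<partial>lebesgue) \<partial>lebesgue)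
    = (\<integral>\<^sup>+x. (\<integral>\<^sup>+y. ennreal (\<bar>logtest g x - logtest g y\<bar> powr p * kern x y) \<partial>lborel) \<partial>lborel)"
    by (simp add: nn_integral_completion kern_eq)
  also have "\<dots> = (\<integral>\<^sup>+z. ennreal (\<bar>logtest g (fst z) - logtest g (snd z)\<bar> powr p * kern (fst z) (snd z)) \<partial>lborel)"
    by (rule double_integral_lborel) (unfold kern_def, measurable)
  also have "\<dots> \<le> (\<integral>\<^sup>+z. ennreal (D z) \<partial>lborel)"
    using le by (intro nn_integral_mono ennreal_leI) (metis prod.collapse)
  also have "\<dots> < \<infinity>" using Di D0 by (simp add: nn_integral_eq_integral)
  finally have "Wsp_pow s p UNIV (logtest g) < \<infinity>" using lpfin by (simp add: Wsp_pow_def)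
  moreover have "logtest g \<in> borel_measurable (lebesgue_on UNIV)"
    by (intro measurable_restrict_space1 measurable_completion) simp
  moreover have "logtest g x = 0" if "x \<notin> ball x0 r2" for x using logtest_support[of x g] that r by auto
  ultimately show ?thesis using lpfin by (auto simp: Wsp0_def Wsp_def Lp_def)
qed

text \<open>\<open>near\<close> contains increments of \<open>\<psi>\<close> and of
  \<open>g\<close>. The former are paid by \<open>cutenergy\<close>, the latter by the norm of the
  given slice, which agrees with \<open>g\<close> almost everywhere on the ball.\<close>

lemma near_le_Wsp_pow:
  assumes g: "admissible g" and fg: "AE x in lborel. x \<in> ball x0 r2 \<longrightarrow> f x = g x"
  shows "(\<integral>\<^sup>+z. near \<delta> g z \<partial>lborel) \<le> Wsp_pow s p (ball x0 r2) f + (\<integral>\<^sup>+z. cutenergy z \<partial>lborel)"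
proof -
  note [measurable] = admissibleD(1)[OF g]
  define U where "U = ball x0 r2"
  have [measurable]: "U \<in> sets borel" by (simp add: U_def)
  have fg': "AE x in lborel. x \<in> U \<longrightarrow> f x = g x" using fg by (simp add: U_def)
  have "(\<integral>\<^sup>+x\<in>U. (\<integral>\<^sup>+y\<in>U. ennreal (\<bar>f x - f y\<bar> powr p / norm (x - y) powr (real DIM('a) + s * p)) \<partial>lebesgue) \<partial>lebesgue)
    = (\<integral>\<^sup>+x. (\<integral>\<^sup>+y. ennreal (indicator U x * indicator U y * (\<bar>g x - g y\<bar> powr p * kern x y)) \<partial>lborel) \<partial>lborel)"
    unfolding nn_integral_completion kern_eq
  proof (rule nn_integral_cong_AE)
    show "AE x in lborel. (\<integral>\<^sup>+y\<in>U. ennreal (\<bar>f x - f y\<bar> powr p * kern x y) \<partial>lborel) * indicator U x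
      = (\<integral>\<^sup>+y. ennreal (indicator U x * indicator U y * (\<bar>g x - g y\<bar> powr p * kern x y)) \<partial>lborel)"
      using fg'
    proof eventually_elim
      case (elim x)
      show ?case
      proof (cases "x \<in> U")
        case True
        have "(\<integral>\<^sup>+y\<in>U. ennreal (\<bar>f x - f y\<bar> powr p * kern x y) \<partial>lborel) = (\<integral>\<^sup>+y. ennreal (indicator U x * indicator U y * (\<bar>g x - g y\<bar> powr p * kern x y)) \<partial>lborel)"
        proof (rule nn_integral_cong_AE)
          show "AE y in lborel. ennreal (\<bar>f x - f y\<bar> powr p * kern x y) * indicator U y = ennreal (indicator U x * indicator U y * (\<bar>g x - g y\<bar> powr p * kern x y))"
            using fg' by eventually_elim (use elim True in \<open>auto split: split_indicator\<close>)
        qed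
        then show ?thesis using True by simp
      qed simp
    qed
  qed
  also have "\<dots> = (\<integral>\<^sup>+z. ennreal (indicator U (fst z) * indicator U (snd z) * (\<bar>g (fst z) - g (snd z)\<bar> powr p * kern (fst z) (snd z))) \<partial>lborel)"
    by (rule double_integral_lborel) (unfold kern_def, measurable)
  finally have W: "Wsp_pow s p U f = Lp_pow p U f + (\<integral>\<^sup>+z. ennreal (indicator U (fst z) * indicator U (snd z) * (\<bar>g (fst z) - g (snd z)\<bar> powr p * kern (fst z) (snd z))) \<partial>lborel)"
    by (simp add: Wsp_pow_def)
  have "(\<integral>\<^sup>+z. near \<delta> g z \<partial>lborel)
    \<le> (\<integral>\<^sup>+z. ennreal (indicator U (fst z) * indicator U (snd z) * (\<bar>g (fst z) - g (snd z)\<bar> powr p * kern (fst z) (snd z))) + ennreal (cutenergy z) \<partial>lborel)"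
  proof (rule nn_integral_mono)
    fix z :: "'a \<times> 'a"
    have "near \<delta> g z \<le> indicator U (fst z) * indicator U (snd z) * (\<bar>g (fst z) - g (snd z)\<bar> powr p * kern (fst z) (snd z)) + cutenergy z"
      by (cases z) (auto simp: near_def cutenergy_def U_def algebra_simps split: split_indicator)
    then have "ennreal (near \<delta> g z) \<le> ennreal (indicator U (fst z) * indicator U (snd z) * (\<bar>g (fst z) - g (snd z)\<bar> powr p * kern (fst z) (snd z)) + cutenergy z)"
      by (rule ennreal_leI)
    also have "\<dots> = ennreal (indicator U (fst z) * indicator U (snd z) * (\<bar>g (fst z) - g (snd z)\<bar> powr p * kern (fst z) (snd z))) + ennreal (cutenergy z)"
      by (rule ennreal_plus) (auto simp: cutenergy_def split_beta')
    finally show "ennreal (near \<delta> g z) \<le> ennreal (indicator U (fst z) * indicator U (snd z) * (\<bar>g (fst z) - g (snd z)\<bar> powr p * kern (fst z) (snd z))) + ennreal (cutenergy z)" .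
  qed
  also have "\<dots> = (\<integral>\<^sup>+z. ennreal (indicator U (fst z) * indicator U (snd z) * (\<bar>g (fst z) - g (snd z)\<bar> powr p * kern (fst z) (snd z))) \<partial>lborel) + (\<integral>\<^sup>+z. cutenergy z \<partial>lborel)"
  proof (rule nn_integral_add)
    have "(\<lambda>z. ennreal (indicator U (fst z) * indicator U (snd z) * (\<bar>g (fst z) - g (snd z)\<bar> powr p * kern (fst z) (snd z)))) \<in> borel_measurable (borel \<Otimes>\<^sub>M borel)"
      unfolding kern_def by measurable
    then show "(\<lambda>z. ennreal (indicator U (fst z) * indicator U (snd z) * (\<bar>g (fst z) - g (snd z)\<bar> powr p * kern (fst z) (snd z)))) \<in> borel_measurable lborel"
      by (simp add: borel_prod)
  qed simp
  also have "\<dots> \<le> Wsp_pow s p U f + (\<integral>\<^sup>+z. cutenergy z \<partial>lborel)" unfolding W by (intro add_mono) auto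
  finally show ?thesis by (simp add: U_def)
qed

end

text \<open>\<open>w\<close> carries no measurability; it will be the Sobolev norm of a slice as a
  function of time. The constant is therefore subtracted from \<open>f\<close> rather than split off
  from the sum with \<open>w\<close>.\<close>

lemma nn_integral_finite_le_add:
  fixes f :: "'a \<Rightarrow> ennreal"
  assumes [measurable]: "f \<in> borel_measurable M" "A \<in> sets M" and c: "c < \<infinity>" and A: "emeasure M A < \<infinity>"
    and le: "AE x in M. x \<in> A \<longrightarrow> f x \<le> w x + c" and w: "(\<integral>\<^sup>+x\<in>A. w x \<partial>M) < \<infinity>"
  shows "(\<integral>\<^sup>+x\<in>A. f x \<partial>M) < \<infinity>"
proof -
  have "(\<integral>\<^sup>+x\<in>A. f x \<partial>M) \<le> (\<integral>\<^sup>+x. (f x - c) * indicator A x + c * indicator A x \<partial>M)"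
    by (intro nn_integral_mono) (auto split: split_indicator simp: diff_add_self_ennreal le_max_iff_disj ennreal_minus_eq_0 intro: order_trans)
  also have "\<dots> = (\<integral>\<^sup>+x. (f x - c) * indicator A x \<partial>M) + c * emeasure M A"
    by (subst nn_integral_add) (auto simp: nn_integral_cmult_indicator)
  also have "(\<integral>\<^sup>+x. (f x - c) * indicator A x \<partial>M) \<le> (\<integral>\<^sup>+x\<in>A. w x \<partial>M)"
    using le c by (intro nn_integral_mono_AE) (auto elim!: eventually_mono split: split_indicator simp: ennreal_minus_le_iff add.commute)
  finally show ?thesis using c A w by (auto simp: ennreal_mult_less_top intro: le_less_trans)
qed

text \<open>Everything is transferred to Borel representatives with the bounds holding at every point. The slice
  at the special time \<open>t0\<close> is modified separately, because \<open>u\<close> is prescribed there although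
  \<open>t0\<close> is a null set of times.\<close>

lemma log_supersolution_of_weak_supersolution:
  fixes x0 :: "'a::euclidean_space" and u :: "'a \<Rightarrow> real \<Rightarrow> real"
  assumes c: "cutoff C0 x0 r \<psi>" and par: "r > 0" "C0 > 0" "2 < p" "0 < s" "s < 1" "1 \<le> \<Lambda>" "0 < \<rho>"
    and K: "admissible_kernel s p \<Lambda> T K" and \<Omega>: "ball x0 (3 * r / 2) \<subseteq> \<Omega>"
    and t: "0 < ta" "ta < t0" "t0 < tb" "tb < T"
    and u: "weak_supersolution s p T \<Omega> K u"
    and u\<rho>: "AE (x, t) in lebesgue_on (UNIV \<times> {ta<..<tb}). u x t \<ge> \<rho>"
  obtains r1 r2 M u' K' G where "log_supersolution p s \<Lambda> C0 r r1 r2 \<rho> M x0 \<psi> u' K' G ta tb" "t0 \<in> G"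
    "AE z in lborel. snd z \<in> {ta<..<tb} \<longrightarrow> u (fst z) (snd z) = u' (fst z) (snd z)"
    "AE x in lborel. x \<in> ball x0 r2 \<longrightarrow> u x t0 = u' x t0"
proof -
  have T: "T > 0" using t by linarith
  obtain M0 where M0: "AE t in lebesgue_on {0<..<T}. AE x in lebesgue. \<bar>u x t\<bar> \<le> M0"
    and umeas: "(\<lambda>(x, t). u x t) \<in> borel_measurable (lebesgue_on (UNIV \<times> {0<..<T}))"
    using u unfolding weak_supersolution_def Linf_time_def by blast
  define M where "M = max \<rho> M0"
  have \<rho>M: "\<rho> \<le> M" by (simp add: M_def)
  obtain r1 r2 where cr: "cutoff_region p s \<Lambda> C0 r r1 r2 \<rho> M x0 \<psi>" and r2: "r2 < 3 * r / 2"
    using cutoff_regionI[OF c par(1,2,3,4,5,6,7) \<rho>M] by blast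
  interpret cr: cutoff_region p s \<Lambda> C0 r r1 r2 \<rho> M x0 \<psi> by (rule cr)
  define U where "U = ball x0 r2"
  have cU: "compactly_inside U \<Omega>" unfolding U_def by (rule compactly_inside_ball[OF r2 \<Omega>])
  have [measurable]: "U \<in> sets borel" by (simp add: U_def)
  have Ul: "U \<in> sets lebesgue" by (simp add: U_def)
  have Ufin: "emeasure lborel U < \<infinity>" unfolding U_def by (rule emeasure_lborel_ball_finite)
  have uC: "u \<in> Cont_time_Lp T p U" and uW: "u \<in> Lp_loc_time T U (Wsp s p U) (Wsp_pow s p U)"
    using u cU unfolding weak_supersolution_def by blast+

  have Sl: "UNIV \<times> {0<..<T} \<in> sets (lebesgue :: ('a \<times> real) measure)"
    "UNIV \<times> {ta<..<tb} \<in> sets (lebesgue :: ('a \<times> real) measure)"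
    by (intro sets_completionI_sets; simp add: open_Times borel_open)+
  obtain u1 :: "'a \<times> real \<Rightarrow> real" where [measurable]: "u1 \<in> borel_measurable borel"
    and u1: "AE z in lborel. z \<in> UNIV \<times> {0<..<T} \<longrightarrow> (\<lambda>(x, t). u x t) z = u1 z"
    using ex_borel_representative[OF umeas Sl(1)] by blast
  have lower: "AE z in lborel. z \<in> UNIV \<times> {ta<..<tb} \<longrightarrow> \<rho> \<le> u (fst z) (snd z)"
    using u\<rho> unfolding AE_lebesgue_on_iff[OF Sl(2)] by eventually_elim auto
  \<comment> \<open>The essential bound on \<open>u\<close> is given slice by slice; the joint
    statement is formulated for the Borel function \<open>u1\<close> so that the slices can be
    reassembled.\<close>
  have upper: "AE z in lborel. snd z \<in> {0<..<T} \<longrightarrow> u1 z \<le> M0"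
  proof (rule AE_lborel_unswap)
    have "Measurable.pred (borel \<Otimes>\<^sub>M borel) (\<lambda>z::'a \<times> real. snd z \<in> {0<..<T} \<longrightarrow> u1 z \<le> M0)"
      unfolding borel_prod[symmetric] by (measurable; simp add: borel_prod)
    then show "{z. snd z \<in> {0<..<T} \<longrightarrow> u1 z \<le> M0} \<in> sets borel" by (simp add: borel_prod pred_def)
    have "AE t in lborel. t \<in> {0<..<T} \<longrightarrow> (AE x in lborel. \<bar>u x t\<bar> \<le> M0)"
      using M0 by (subst (asm) AE_lebesgue_on_iff) (auto simp: AE_completion_iff)
    then show "AE t in lborel. AE x in lborel. snd (x, t) \<in> {0<..<T} \<longrightarrow> u1 (x, t) \<le> M0"
      using AE_lborel_swap[OF u1]
    proof eventually_elim
      case (elim t)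
      show ?case
      proof (cases "t \<in> {0<..<T}")
        case True
        then have "AE x in lborel. \<bar>u x t\<bar> \<le> M0" using elim(1) by blast
        then show ?thesis using elim(2) by eventually_elim (use True in auto)
      qed auto
    qed
  qed
  \<comment> \<open>Truncation makes the bounds hold everywhere and, by \<open>lower\<close> and
    \<open>upper\<close>, changes nothing almost everywhere in the cylinder.\<close>
  define u2 where "u2 z = max \<rho> (min M (u1 z))" for z
  have [measurable]: "u2 \<in> borel_measurable borel" unfolding u2_def[abs_def] by measurable
  have u2: "AE z in lborel. snd z \<in> {ta<..<tb} \<longrightarrow> u (fst z) (snd z) = u2 z \<and> \<rho> \<le> u (fst z) (snd z) \<and> u (fst z) (snd z) \<le> M"
    using u1 lower upper
  proof eventually_elim
    case (elim z)
    show ?case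
    proof
      assume z: "snd z \<in> {ta<..<tb}"
      then have "snd z \<in> {0<..<T}" using t by auto
      then have "u (fst z) (snd z) = u1 z" "u1 z \<le> M" "\<rho> \<le> u1 z" using elim z by (auto simp: M_def split_beta' mem_Times_iff)
      then show "u (fst z) (snd z) = u2 z \<and> \<rho> \<le> u (fst z) (snd z) \<and> u (fst z) (snd z) \<le> M" by (simp add: u2_def)
    qed
  qed
  have slices: "AE \<tau> in lborel. AE x in lborel. \<tau> \<in> {ta<..<tb} \<longrightarrow> u x \<tau> = u2 (x, \<tau>) \<and> \<rho> \<le> u x \<tau> \<and> u x \<tau> \<le> M"
    using AE_lborel_swap[OF u2] by simp
  have b0: "AE x in lborel. x \<in> U \<longrightarrow> \<rho> \<le> u x t0 \<and> u x t0 \<le> M"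
  proof (rule Cont_time_Lp_bounds[OF uC _ _ t(2,3,1,4)])
    show "AE \<tau> in lborel. \<tau> \<in> {ta<..<tb} \<longrightarrow> (AE x in lborel. x \<in> U \<longrightarrow> \<rho> \<le> u x \<tau> \<and> u x \<tau> \<le> M)"
      using slices
    proof eventually_elim
      case (elim \<tau>)
      show ?case
      proof
        assume \<tau>: "\<tau> \<in> {ta<..<tb}"
        from elim show "AE x in lborel. x \<in> U \<longrightarrow> \<rho> \<le> u x \<tau> \<and> u x \<tau> \<le> M"
          by eventually_elim (use \<tau> in blast)
      qed
    qed
  qed (use par in auto)
  have "(\<lambda>x. u x t0) \<in> borel_measurable (lebesgue_on U)" using uC t by (auto simp: Cont_time_Lp_def Lp_def)
  then obtain c0 where [measurable]: "c0 \<in> borel_measurable borel" and c0: "AE x in lborel. x \<in> U \<longrightarrow> u x t0 = c0 x"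
    using ex_borel_representative[OF _ Ul] by blast
  define u' where "u' x t = (if t = t0 then max \<rho> (min M (c0 x)) else u2 (x, t))" for x t
  have u'm: "(\<lambda>(x, t). u' x t) \<in> borel_measurable borel"
  proof -
    have [measurable]: "u2 \<in> borel_measurable (borel \<Otimes>\<^sub>M borel)" by (simp add: borel_prod)
    have "(\<lambda>(x, t). u' x t) \<in> borel_measurable (borel \<Otimes>\<^sub>M borel)" unfolding u'_def split_beta' by measurable
    then show ?thesis by (simp add: borel_prod)
  qed
  note [measurable (raw)] = borel_measurable_uncurry2[OF u'm]
  have u'b: "\<rho> \<le> u' x t" "u' x t \<le> M" for x t using \<rho>M by (auto simp: u'_def u2_def)
  have adm: "cr.admissible (\<lambda>x. u' x t)" for t unfolding cr.admissible_def using u'b by auto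
  have at0: "AE x in lborel. x \<in> U \<longrightarrow> u x t0 = u' x t0"
    using b0 c0 by eventually_elim (auto simp: u'_def)
  have at\<tau>: "AE \<tau> in lborel. \<tau> \<in> {ta..tb} \<longrightarrow> (AE x in lborel. u x \<tau> = u' x \<tau>)"
    using slices AE_lborel_singleton[of t0] AE_lborel_singleton[of ta] AE_lborel_singleton[of tb]
  proof eventually_elim
    case (elim \<tau>)
    then show ?case by (auto elim!: eventually_mono simp: u'_def)
  qed
  \<comment> \<open>Agreement is asked on \<open>U\<close> only: at \<open>t0\<close>, continuity in
    L^p over \<open>U\<close> gives no information about the slice elsewhere.\<close>
  define G where "G = {t \<in> {ta..tb}. AE x in lborel. x \<in> U \<longrightarrow> u x t = u' x t}"
  have GI: "\<tau> \<in> G" if "\<tau> \<in> {ta..tb}" "AE x in lborel. u x \<tau> = u' x \<tau>" for \<tau>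
    using that by (auto simp: G_def elim!: eventually_mono)
  have t0G: "t0 \<in> G" using at0 t by (simp add: G_def)

  have Kmeas: "(\<lambda>(x, y, t). K x y t) \<in> borel_measurable (lebesgue_on (UNIV \<times> UNIV \<times> {0<..<T}))"
    and Kb: "\<And>t x y. t \<in> {0<..<T} \<Longrightarrow> x \<noteq> y \<Longrightarrow> inverse \<Lambda> * cr.kern x y \<le> K x y t \<and> K x y t \<le> \<Lambda> * cr.kern x y"
    using K unfolding admissible_kernel_def cr.kern_def by auto
  have Kl: "UNIV \<times> UNIV \<times> {0<..<T} \<in> sets (lebesgue :: ('a \<times> 'a \<times> real) measure)"
    by (intro sets_completionI_sets) (simp add: open_Times borel_open)
  obtain K1 :: "'a \<times> 'a \<times> real \<Rightarrow> real" where K1m: "K1 \<in> borel_measurable borel"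
    and K1: "AE z in lborel. z \<in> UNIV \<times> UNIV \<times> {0<..<T} \<longrightarrow> (\<lambda>(x, y, t). K x y t) z = K1 z"
    using ex_borel_representative[OF Kmeas Kl] by blast
  \<comment> \<open>Truncation makes the bounds hold at all times, also outside (0, T), where
    \<open>K\<close> is unconstrained.\<close>
  define K' where "K' x y t = max (inverse \<Lambda> * cr.kern x y) (min (\<Lambda> * cr.kern x y) (K1 (x, y, t)))" for x y t
  have K'm: "(\<lambda>(x, y, t). K' x y t) \<in> borel_measurable borel"
  proof -
    have [measurable]: "K1 \<in> borel_measurable (borel \<Otimes>\<^sub>M (borel \<Otimes>\<^sub>M borel))" using K1m by (simp add: borel_prod)
    have "(\<lambda>(x, y, t). K' x y t) \<in> borel_measurable (borel \<Otimes>\<^sub>M (borel \<Otimes>\<^sub>M borel))"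
      unfolding K'_def cr.kern_def split_beta' by measurable
    then show ?thesis by (simp add: borel_prod)
  qed
  note [measurable (raw)] = borel_measurable_uncurry3[OF K'm]
  have "inverse \<Lambda> \<le> \<Lambda>" using par(6) by (meson inverse_le_1_iff order_trans)
  then have K'b: "inverse \<Lambda> * cr.kern x y \<le> K' x y t" "K' x y t \<le> \<Lambda> * cr.kern x y" if "x \<noteq> y" for x y t
    by (auto simp: K'_def mult_right_mono)
  have K'eq: "AE \<tau> in lborel. AE y in lborel. AE x in lborel. \<tau> \<in> {ta..tb} \<longrightarrow> x \<noteq> y \<longrightarrow> K x y \<tau> = K' x y \<tau>"
    using AE_lborel_swap[OF AE_lborel_swap[OF K1]]
  proof eventually_elim
    case (elim \<tau>)
    then show ?case
    proof eventually_elim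
      case (elim y)
      then show ?case
      proof eventually_elim
        case (elim x)
        show ?case
        proof (intro impI)
          assume *: "\<tau> \<in> {ta..tb}" "x \<noteq> y"
          then have "\<tau> \<in> {0<..<T}" using t by auto
          then show "K x y \<tau> = K' x y \<tau>" using elim Kb[of \<tau> x y] * by (simp add: K'_def)
        qed
      qed
    qed
  qed

  have G1: "G \<subseteq> {ta..tb}" by (auto simp: G_def)
  have G2: "negligible ({ta..tb} - G)"
  proof (rule negligible_of_AE)
    show "AE \<tau> in lborel. \<tau> \<in> {ta..tb} \<longrightarrow> \<tau> \<in> G" using at\<tau> by eventually_elim (use GI in auto)
  qed

  have energy: "(\<integral>\<^sup>+\<tau>\<in>{ta..tb}. (\<integral>\<^sup>+z. cr.near (r2 - r1) (\<lambda>x. u' x \<tau>) z \<partial>lborel) \<partial>lborel) < \<infinity>"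
  proof (rule nn_integral_finite_le_add)
    have "(\<lambda>(\<tau>, z). cr.near (r2 - r1) (\<lambda>x. u' x \<tau>) z) \<in> borel_measurable (borel \<Otimes>\<^sub>M borel)"
      unfolding cr.near_def cr.kern_def borel_prod[symmetric] split_beta' by measurable
    then show "(\<lambda>\<tau>. \<integral>\<^sup>+z. cr.near (r2 - r1) (\<lambda>x. u' x \<tau>) z \<partial>lborel) \<in> borel_measurable lborel" by measurable
    show "(\<integral>\<^sup>+z. cr.cutenergy z \<partial>lborel) < \<infinity>"
      using cr.cutenergy_integrable by (subst nn_integral_eq_integral) (auto simp: cr.cutenergy_def split_beta')
    show "AE \<tau> in lborel. \<tau> \<in> {ta..tb} \<longrightarrow> (\<integral>\<^sup>+z. cr.near (r2 - r1) (\<lambda>x. u' x \<tau>) z \<partial>lborel) \<le> Wsp_pow s p U (\<lambda>x. u x \<tau>) + (\<integral>\<^sup>+z. cr.cutenergy z \<partial>lborel)"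
      using at\<tau>
    proof eventually_elim
      case (elim \<tau>)
      show ?case
      proof
        assume "\<tau> \<in> {ta..tb}"
        then have "AE x in lborel. u x \<tau> = u' x \<tau>" using elim by blast
        then have "AE x in lborel. x \<in> ball x0 r2 \<longrightarrow> u x \<tau> = u' x \<tau>" by eventually_elim simp
        then show "(\<integral>\<^sup>+z. cr.near (r2 - r1) (\<lambda>x. u' x \<tau>) z \<partial>lborel) \<le> Wsp_pow s p U (\<lambda>x. u x \<tau>) + (\<integral>\<^sup>+z. cr.cutenergy z \<partial>lborel)"
          unfolding U_def by (rule cr.near_le_Wsp_pow[OF adm])
      qed
    qed
    have "ta < tb" using t by simp
    then show "(\<integral>\<^sup>+\<tau>\<in>{ta..tb}. Wsp_pow s p U (\<lambda>x. u x \<tau>) \<partial>lborel) < \<infinity>"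
      using uW t unfolding Lp_loc_time_def nn_integral_completion by blast
  qed (auto simp: emeasure_lborel_Icc_eq)

  have tcont: "\<exists>\<eta>>0. \<forall>t\<in>G. \<forall>t'\<in>G. \<bar>t' - t\<bar> < \<eta> \<longrightarrow> (LINT x|lborel. indicator (ball x0 r2) x * \<bar>u' x t' - u' x t\<bar>) \<le> e"
    if e: "0 < e" for e
  proof -
    \<comment> \<open>In \<open>integral_le_Lp_pow\<close>, \<epsilon> keeps the part below the
      threshold at most e/2, and \<kappa> does the same for the part above it.\<close>
    define \<epsilon> where "\<epsilon> = e / 2 / (measure lborel U + 1)"
    define \<kappa> where "\<kappa> = e / 2 * \<epsilon> powr (p - 1)"
    have U0: "0 < measure lborel U + 1" by (simp add: add_nonneg_pos)
    have \<epsilon>: "\<epsilon> > 0" using e U0 by (simp add: \<epsilon>_def)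
    have \<kappa>: "\<kappa> > 0" "\<epsilon> powr (1 - p) * \<kappa> = e / 2"
      using e \<epsilon> by (auto simp: \<kappa>_def powr_add[symmetric])
    have \<epsilon>U: "\<epsilon> * measure lborel U \<le> e / 2"
    proof -
      have "\<epsilon> * measure lborel U \<le> \<epsilon> * (measure lborel U + 1)" using \<epsilon> by (intro mult_left_mono) auto
      also have "k / (measure lborel U + 1) * (measure lborel U + 1) = k" for k using U0 by simp
      then have "\<epsilon> * (measure lborel U + 1) = e / 2" unfolding \<epsilon>_def .
      finally show ?thesis .
    qed
    obtain \<eta> where \<eta>: "\<eta> > 0" "\<And>t t'. t \<in> {ta..tb} \<Longrightarrow> t' \<in> {ta..tb} \<Longrightarrow> \<bar>t' - t\<bar> < \<eta> \<Longrightarrow> Lp_pow p U (\<lambda>x. u x t' - u x t) \<le> ennreal \<kappa>"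
      using Cont_time_Lp_uniform[OF uC _ Ul t(1,4) \<kappa>(1)] par by auto
    have "(LINT x|lborel. indicator (ball x0 r2) x * \<bar>u' x t' - u' x t\<bar>) \<le> e"
      if G: "t \<in> G" "t' \<in> G" "\<bar>t' - t\<bar> < \<eta>" for t t'
    proof -
      have "AE x in lborel. x \<in> U \<longrightarrow> u x t = u' x t" "AE x in lborel. x \<in> U \<longrightarrow> u x t' = u' x t'" using G by (auto simp: G_def)
      then have "AE x in lborel. x \<in> U \<longrightarrow> u x t' - u x t = u' x t' - u' x t" by eventually_elim simp
      from Lp_pow_cong_AE[OF this, of p]
      have "(\<integral>\<^sup>+x. ennreal (\<bar>u' x t' - u' x t\<bar> powr p) * indicator U x \<partial>lborel) \<le> ennreal \<kappa>"
        using \<eta>(2)[OF subsetD[OF G1 G(1)] subsetD[OF G1 G(2)] G(3)] by simp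
      then have "(LINT x|lborel. indicator U x * \<bar>u' x t' - u' x t\<bar>) \<le> \<epsilon> * measure lborel U + \<epsilon> powr (1 - p) * \<kappa>"
        using par \<epsilon> \<kappa>(1) Ufin by (intro integral_le_Lp_pow) auto
      also have "\<dots> \<le> e" using \<epsilon>U \<kappa>(2) by simp
      finally show ?thesis by (simp add: U_def)
    qed
    then show ?thesis using \<eta>(1) by blast
  qed

  have tested: "0 \<le> (LINT x|lborel. u' x t' powr (p - 1) * cr.logtest (\<lambda>x. u' x t') x)
          - (LINT x|lborel. u' x t1 powr (p - 1) * cr.logtest (\<lambda>x. u' x t') x)
          + (LINT \<tau>:{t1..t'}|lborel. (LINT y|lborel. (LINT x|lborel.
               cr.flux (\<lambda>x. u' x \<tau>) x y * (cr.logtest (\<lambda>x. u' x t') x - cr.logtest (\<lambda>x. u' x t') y) * K' x y \<tau>)))"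
    if t1: "t1 \<in> G" "t' \<in> G" "t1 < t'" and fin: "(\<integral>\<^sup>+z. cr.near (r2 - r1) (\<lambda>x. u' x t') z \<partial>lborel) < \<infinity>" for t1 t'
  proof -
    define \<phi> where "\<phi> = cr.logtest (\<lambda>x. u' x t')"
    have \<phi>m [measurable]: "\<phi> \<in> borel_measurable borel" unfolding \<phi>_def by (intro cr.logtest_measurable) measurable
    have \<phi>U: "\<phi> x = 0" if "x \<notin> U" for x
      using that cr.r unfolding \<phi>_def by (intro cr.logtest_support) (auto simp: U_def)
    have b: "0 < t1" "t' < T" using t1 G1 t by auto
    \<comment> \<open>Agreement on \<open>U\<close> suffices here because \<open>\<phi>\<close>
      vanishes outside. This is what allows \<open>t1\<close> or \<open>t'\<close> to be
      \<open>t0\<close>.\<close>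
    have st: "(LINT x:U|lebesgue. u x \<tau> powr (p - 1) * \<phi> x) = (LINT x|lborel. u' x \<tau> powr (p - 1) * \<phi> x)" if "\<tau> \<in> G" for \<tau>
      unfolding set_lebesgue_integral_def
    proof (rule integral_completion_AE)
      have "AE x in lborel. x \<in> U \<longrightarrow> u x \<tau> = u' x \<tau>" using that by (simp add: G_def)
      then show "AE x in lborel. indicator U x *\<^sub>R (u x \<tau> powr (p - 1) * \<phi> x) = u' x \<tau> powr (p - 1) * \<phi> x"
        by eventually_elim (use \<phi>U in \<open>auto split: split_indicator\<close>)
    qed measurable
    \<comment> \<open>The form sees the slices on the whole space, where agreement is known at
      almost every \<tau>; under the time integral that is enough.\<close>
    have form: "(LINT \<tau>:{t1..t'}|lebesgue. (LINT y|lebesgue. (LINT x|lebesgue.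
             \<bar>u x \<tau> - u y \<tau>\<bar> powr (p - 2) * (u x \<tau> - u y \<tau>) * (\<phi> x - \<phi> y) * K x y \<tau>)))
      = (LINT \<tau>:{t1..t'}|lborel. (LINT y|lborel. (LINT x|lborel. cr.flux (\<lambda>x. u' x \<tau>) x y * (\<phi> x - \<phi> y) * K' x y \<tau>)))"
      unfolding set_lebesgue_integral_def
    proof (rule integral_completion_AE)
      show "(\<lambda>\<tau>. indicator {t1..t'} \<tau> *\<^sub>R (LINT y|lborel. (LINT x|lborel. cr.flux (\<lambda>x. u' x \<tau>) x y * (\<phi> x - \<phi> y) * K' x y \<tau>))) \<in> borel_measurable lborel"
        unfolding cr.flux_def by measurable
      show "AE \<tau> in lborel. indicator {t1..t'} \<tau> *\<^sub>R (LINT y|lebesgue. (LINT x|lebesgue.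
             \<bar>u x \<tau> - u y \<tau>\<bar> powr (p - 2) * (u x \<tau> - u y \<tau>) * (\<phi> x - \<phi> y) * K x y \<tau>))
        = indicator {t1..t'} \<tau> *\<^sub>R (LINT y|lborel. (LINT x|lborel. cr.flux (\<lambda>x. u' x \<tau>) x y * (\<phi> x - \<phi> y) * K' x y \<tau>))"
        using at\<tau> K'eq
      proof eventually_elim
        case (elim \<tau>)
        show ?case
        proof (cases "\<tau> \<in> {t1..t'}")
          case True
          then have \<tau>: "\<tau> \<in> {ta..tb}" using t1 G1 by auto
          then have ux: "AE x in lborel. u x \<tau> = u' x \<tau>" using elim by blast
          have "(LINT y|lebesgue. (LINT x|lebesgue. \<bar>u x \<tau> - u y \<tau>\<bar> powr (p - 2) * (u x \<tau> - u y \<tau>) * (\<phi> x - \<phi> y) * K x y \<tau>))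
            = (LINT y|lborel. (LINT x|lborel. cr.flux (\<lambda>x. u' x \<tau>) x y * (\<phi> x - \<phi> y) * K' x y \<tau>))"
          proof (rule integral_completion_AE)
            show "(\<lambda>y. LINT x|lborel. cr.flux (\<lambda>x. u' x \<tau>) x y * (\<phi> x - \<phi> y) * K' x y \<tau>) \<in> borel_measurable lborel"
              unfolding cr.flux_def by measurable
            show "AE y in lborel. (LINT x|lebesgue. \<bar>u x \<tau> - u y \<tau>\<bar> powr (p - 2) * (u x \<tau> - u y \<tau>) * (\<phi> x - \<phi> y) * K x y \<tau>)
              = (LINT x|lborel. cr.flux (\<lambda>x. u' x \<tau>) x y * (\<phi> x - \<phi> y) * K' x y \<tau>)"
              using ux elim(2)
            proof eventually_elim
              case (elim y)
              note y = elim
              show ?case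
              proof (rule integral_completion_AE)
                show "(\<lambda>x. cr.flux (\<lambda>x. u' x \<tau>) x y * (\<phi> x - \<phi> y) * K' x y \<tau>) \<in> borel_measurable lborel"
                  unfolding cr.flux_def by measurable
                show "AE x in lborel. \<bar>u x \<tau> - u y \<tau>\<bar> powr (p - 2) * (u x \<tau> - u y \<tau>) * (\<phi> x - \<phi> y) * K x y \<tau>
                  = cr.flux (\<lambda>x. u' x \<tau>) x y * (\<phi> x - \<phi> y) * K' x y \<tau>"
                  using ux y(2)
                proof eventually_elim
                  case (elim x)
                  \<comment> \<open>On the diagonal both sides vanish with the flux, whatever the
                    two kernels are.\<close>
                  then show ?case using y(1) \<tau> by (cases "x = y") (auto simp: cr.flux_def)
                qed
              qed
            qed
          qed
          then show ?thesis by simp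
        qed simp
      qed
    qed
    have "\<phi> \<in> Wsp0 s p U" unfolding \<phi>_def U_def by (rule cr.logtest_Wsp0[OF adm fin])
    moreover have "0 \<le> \<phi> x" for x by (simp add: \<phi>_def)
    ultimately have "(LINT x:U|lebesgue. u x t' powr (p - 1) * \<phi> x) - (LINT x:U|lebesgue. u x t1 powr (p - 1) * \<phi> x)
        + (LINT \<tau>:{t1..t'}|lebesgue. (LINT y|lebesgue. (LINT x|lebesgue.
             \<bar>u x \<tau> - u y \<tau>\<bar> powr (p - 2) * (u x \<tau> - u y \<tau>) * (\<phi> x - \<phi> y) * K x y \<tau>))) \<ge> 0"
      using weak_supersolution_stationary_test[OF u cU b(1) t1(3) b(2) \<phi>m] by blast
    then show ?thesis unfolding st[OF t1(1)] st[OF t1(2)] form unfolding \<phi>_def .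
  qed

  have "log_supersolution p s \<Lambda> C0 r r1 r2 \<rho> M x0 \<psi> u' K' G ta tb"
    by (intro log_supersolution.intro log_supersolution_axioms.intro cr) (fact u'm u'b K'm K'b G1 G2 energy tcont tested)+
  moreover have "AE z in lborel. snd z \<in> {ta<..<tb} \<longrightarrow> u (fst z) (snd z) = u' (fst z) (snd z)"
  proof -
    have "AE z in (lborel :: ('a \<times> real) measure). snd z \<noteq> t0"
    proof (rule AE_lborel_unswap)
      have "closed {z :: 'a \<times> real. snd z = t0}" by (intro closed_Collect_eq continuous_intros)
      then have "- {z :: 'a \<times> real. snd z = t0} \<in> sets borel" by (intro borel_comp borel_closed)
      also have "- {z :: 'a \<times> real. snd z = t0} = {z. snd z \<noteq> t0}" by auto
      finally show "{z :: 'a \<times> real. snd z \<noteq> t0} \<in> sets borel" .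
      show "AE t in lborel. AE x in lborel. snd (x :: 'a, t) \<noteq> t0"
        using AE_lborel_singleton[of t0] by eventually_elim simp
    qed
    then show ?thesis using u2 by eventually_elim (auto simp: u'_def)
  qed
  ultimately show ?thesis using that t0G at0 unfolding U_def by blast
qed

text \<open>The inclusion of the ball of radius 3r/2 in \<open>\<Omega>\<close> is what admits a
  test function supported with the cut-off. \<open>C\<close> is quantified before all data, so it
  may depend on the dimension, \<open>p\<close>, \<open>s\<close>, \<open>\<Lambda>\<close> and
  \<open>C0\<close> only.\<close>

theorem lemma5p3:
  fixes p s \<Lambda> C0 :: real
  assumes "p > 2" and "0 < s" and "s < 1" and "\<Lambda> \<ge> 1" and "C0 > 0"
  shows "\<exists>C>0. \<forall>(\<Omega> :: (real ^ 'n) set) T K x0 r t0 \<rho> u \<psi>.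
    bounded_smooth_domain \<Omega> \<longrightarrow> T > 0 \<longrightarrow> admissible_kernel s p \<Lambda> T K \<longrightarrow>
    r > 0 \<longrightarrow> ball x0 (3 * r / 2) \<subseteq> \<Omega> \<longrightarrow>
    t0 \<in> {r powr (p * s)<..<T - r powr (p * s)} \<longrightarrow>
    weak_supersolution s p T \<Omega> K u \<longrightarrow>
    \<rho> > 0 \<longrightarrow>
    (AE (x, t) in lebesgue_on (UNIV \<times> {t0 - r powr (p * s)<..<t0 + r powr (p * s)}). u x t \<ge> \<rho>) \<longrightarrow>
    cutoff C0 x0 r \<psi> \<longrightarrow>
    (let b = log_mean p x0 r \<psi> (\<lambda>x. u x t0) in
      \<forall>\<mu>>0.
        emeasure lebesgue {(x, t) \<in> U_plus s p x0 t0 r. ln (u x t) < - \<mu> - b}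
          \<le> ennreal (C * r powr (real CARD('n) + p * s) / \<mu> powr (p - 1)) \<and>
        emeasure lebesgue {(x, t) \<in> U_minus s p x0 t0 r. ln (u x t) > \<mu> - b}
          \<le> ennreal (C * r powr (real CARD('n) + p * s) / \<mu> powr (p - 1)))"
proof -
  have ps: "0 < p * s" "p * s < p" using assms by auto
  obtain A where A0: "A > 0" and A: "\<And>r. r > 0 \<Longrightarrow> (\<integral>\<^sup>+z. ennreal (min 1 ((C0 * norm z / r) powr p) / norm z powr (real DIM(real ^ 'n) + p * s))
      \<partial>(lborel :: (real ^ 'n) measure)) \<le> ennreal (A * r powr - (p * s))"
    using nn_integral_kernel_truncated[OF ps \<open>C0 > 0\<close>, where 'a = "real ^ 'n"] by blast
  define n where "n = DIM(real ^ 'n)"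
  have n: "n = CARD('n)" by (simp add: n_def)
  \<comment> \<open>\<open>d\<close> and \<open>C\<close> are \<open>drift\<close> and
    \<open>level_const\<close> written out: they must be fixed before there are data to interpret
    the locale with. \<open>const\<close> identifies them later.\<close>
  define d where "d = (4 * (p - 1)) powr (p - 1) * \<Lambda> * (2 * A) * (3 / 2) ^ n / (p - 1)"
  define C where "C = 2 powr (p + 1) * \<Lambda> * 3 powr (real n + p * s) * 2 powr (p - 1) + unit_ball_vol (real n) * (2 * d) powr (p - 1)"
  have C0: "C > 0" unfolding C_def using assms by (intro add_pos_nonneg mult_pos_pos mult_nonneg_nonneg) auto
  have main: "emeasure lebesgue {(x, t) \<in> U_plus s p x0 t0 r. ln (u x t) < - \<mu> - log_mean p x0 r \<psi> (\<lambda>x. u x t0)}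
          \<le> ennreal (C * r powr (real n + p * s) / \<mu> powr (p - 1)) \<and>
        emeasure lebesgue {(x, t) \<in> U_minus s p x0 t0 r. ln (u x t) > \<mu> - log_mean p x0 r \<psi> (\<lambda>x. u x t0)}
          \<le> ennreal (C * r powr (real n + p * s) / \<mu> powr (p - 1))"
    if K: "admissible_kernel s p \<Lambda> T K" and r: "r > 0" and \<Omega>: "ball x0 (3 * r / 2) \<subseteq> \<Omega>"
      and t0: "t0 \<in> {r powr (p * s)<..<T - r powr (p * s)}"
      and u: "weak_supersolution s p T \<Omega> K u" and \<rho>: "\<rho> > 0"
      and u\<rho>: "AE (x, t) in lebesgue_on (UNIV \<times> {t0 - r powr (p * s)<..<t0 + r powr (p * s)}). u x t \<ge> \<rho>"
      and c: "cutoff C0 x0 r \<psi>" and \<mu>: "\<mu> > 0"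
    for \<Omega> :: "(real ^ 'n) set" and T K x0 r t0 \<rho> u \<psi> \<mu>
  proof -
    define R where "R = r powr (p * s)"
    have R: "R > 0" "0 < t0 - R" "t0 - R < t0" "t0 < t0 + R" "t0 + R < T" using t0 r by (auto simp: R_def)
    obtain r1 r2 M u' K' G where L: "log_supersolution p s \<Lambda> C0 r r1 r2 \<rho> M x0 \<psi> u' K' G (t0 - R) (t0 + R)" and t0G: "t0 \<in> G"
      and eq: "AE z in lborel. snd z \<in> {t0 - R<..<t0 + R} \<longrightarrow> u (fst z) (snd z) = u' (fst z) (snd z)"
      and eq0: "AE x in lborel. x \<in> ball x0 r2 \<longrightarrow> u x t0 = u' x t0"
      using log_supersolution_of_weak_supersolution[OF c r \<open>C0 > 0\<close> \<open>p > 2\<close> assms(2-4) \<rho> K \<Omega> R(2-5) u] u\<rho> unfolding R_def by blast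
    interpret L: log_supersolution p s \<Lambda> C0 r r1 r2 \<rho> M x0 \<psi> u' K' G "t0 - R" "t0 + R" by (rule L)
    have const: "L.level_const A = C" by (simp add: L.level_const_def L.drift_def C_def d_def n_def)
    have ball: "\<psi> x = 0" if "x \<notin> ball x0 r1" for x using L.\<psi>_support that by blast
    have sub: "x \<in> ball x0 r2 \<and> x \<in> ball x0 (3 * r / 2)" if "x \<in> ball x0 r1" for x using that L.r by auto
    \<comment> \<open>\<open>\<psi>\<close> vanishes outside \<open>ball x0 r1\<close>, so agreement
      of the two slices on \<open>ball x0 r2\<close> determines the weighted integral.\<close>
    have "(LINT x:ball x0 (3 * r / 2)|lebesgue. ln (u x t0) * \<psi> x powr p) = L.logmean t0"
      unfolding L.logmean_def set_lebesgue_integral_def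
    proof (rule integral_completion_AE)
      show "AE x in lborel. indicator (ball x0 (3 * r / 2)) x *\<^sub>R (ln (u x t0) * \<psi> x powr p) = \<psi> x powr p * ln (u' x t0)"
        using eq0
      proof eventually_elim
        case (elim x)
        then show ?case using ball[of x] sub[of x] by (cases "x \<in> ball x0 r1") auto
      qed
    qed measurable
    moreover have "(LINT x:ball x0 (3 * r / 2)|lebesgue. \<psi> x powr p) = L.mass"
      unfolding L.mass_def set_lebesgue_integral_def
    proof (rule integral_completion_AE)
      have "indicator (ball x0 (3 * r / 2)) x *\<^sub>R \<psi> x powr p = \<psi> x powr p" for x
        using ball[of x] sub[of x] by (cases "x \<in> ball x0 r1") auto
      then show "AE x in lborel. indicator (ball x0 (3 * r / 2)) x *\<^sub>R \<psi> x powr p = \<psi> x powr p" by simp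
    qed measurable
    ultimately have b: "log_mean p x0 r \<psi> (\<lambda>x. u x t0) = - L.vbar t0" by (simp add: log_mean_def L.vbar_def)
    obtain N where N: "N \<in> null_sets lborel" "{z. \<not> (snd z \<in> {t0 - R<..<t0 + R} \<longrightarrow> u (fst z) (snd z) = u' (fst z) (snd z))} \<subseteq> N"
      using eq by (auto elim!: AE_E simp: null_sets_def)
    have est: "emeasure lebesgue S \<le> ennreal (C * r powr (real n + p * s) / \<mu> powr (p - 1))"
      if \<sigma>: "\<sigma> = 1 \<or> \<sigma> = -1" and ab: "a + R = b" "t0 - R \<le> a" "b \<le> t0 + R" "\<sigma> = 1 \<Longrightarrow> b = t0" "\<sigma> = -1 \<Longrightarrow> a = t0"
        and S: "\<And>x t. (x, t) \<in> S \<Longrightarrow> x \<in> ball x0 r \<and> a < t \<and> t < b \<and> \<mu> < \<sigma> * (ln (u x t) - L.vbar t0)" for S \<sigma> a b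
    proof -
      define Z where "Z = {(x, t). x \<in> ball x0 r \<and> a < t \<and> t < b \<and> \<mu> < \<sigma> * (ln (u' x t) - L.vbar t0)}"
      have ab': "b = a + r powr (p * s)" using ab by (simp add: R_def)
      note Z = L.level_set_bound[OF A[OF r] A0 t0G \<sigma> \<mu> ab' ab(2-5), folded Z_def]
      \<comment> \<open>A point of the given level set at which \<open>u\<close> and its
        representative differ lies in the null set \<open>N\<close>.\<close>
      have "S \<subseteq> Z \<union> N"
      proof
        fix z assume z: "z \<in> S"
        obtain x t where xt: "z = (x, t)" by force
        note * = S[OF z[unfolded xt]]
        show "z \<in> Z \<union> N"
        proof (cases "u x t = u' x t")
          case True
          then show ?thesis using * by (simp add: Z_def xt)
        next
          case False
          have "t \<in> {t0 - R<..<t0 + R}" using * ab by auto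
          then show ?thesis using subsetD[OF N(2), of "(x, t)"] False by (simp add: xt)
        qed
      qed
      moreover have ZN: "Z \<union> N \<in> sets lborel" using Z(1) N(1) by auto
      ultimately have "emeasure lebesgue S \<le> emeasure lebesgue (Z \<union> N)"
        by (intro emeasure_mono) auto
      also have "\<dots> = emeasure lborel (Z \<union> N)" using ZN by simp
      also have "\<dots> = emeasure lborel Z" using Z(1) N(1) by (intro emeasure_Un_null_set) auto
      also have "\<dots> \<le> ennreal (C * r powr (real n + p * s) / \<mu> powr (p - 1))" using Z(2) unfolding const n_def .
      finally show ?thesis .
    qed
    show ?thesis
    proof
      \<comment> \<open>As b = - vbar(t0), the condition ln u < - \<mu> - b reads \<mu> < - (ln u -
        vbar(t0)), which is the case \<sigma> = -1.\<close>
      show "emeasure lebesgue {(x, t) \<in> U_plus s p x0 t0 r. ln (u x t) < - \<mu> - log_mean p x0 r \<psi> (\<lambda>x. u x t0)}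
          \<le> ennreal (C * r powr (real n + p * s) / \<mu> powr (p - 1))"
        using R by (intro est[of "-1" t0 "t0 + R"]) (auto simp: U_plus_def R_def b mult.commute)
      show "emeasure lebesgue {(x, t) \<in> U_minus s p x0 t0 r. ln (u x t) > \<mu> - log_mean p x0 r \<psi> (\<lambda>x. u x t0)}
          \<le> ennreal (C * r powr (real n + p * s) / \<mu> powr (p - 1))"
        using R by (intro est[of 1 "t0 - R" t0]) (auto simp: U_minus_def R_def b mult.commute)
    qed
  qed
  show ?thesis
    unfolding Let_def using C0 main unfolding n by blast
qed

end
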